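(* Let $M$ be a smooth manifold with a linear connection $\widetilde{\nabla}$, and let $F\in\Omega_1^1(M)$ be a smooth tensor field of type $(1,1)$ on $M$ which is everywhere different from zero. Consider the differential equation $$\widetilde{\nabla}_{\dot\gamma}\dot\gamma=F\dot\gamma \qquad ( * )$$ for curves $\gamma$ in $M$. Then there exists a lift $\nabla$ of $\widetilde{\nabla}$ (a linear connection on the manifold $L(M)$) such that, for every $u\in L(M)$ and every $X\in T_u(L(M))$ with $\nu(X)=F(\pi(u))$, the geodesic of $\nabla$ with initial condition $X$ is mapped by the canonical projection $\pi$ to the solution of $( * )$ with initial condition $\pi_*(X)$. Hence all solutions of $( * )$ are obtained as projections under $\pi$ of geodesics of $\nabla$.
   Context: $\pi:L(M)\to M$ is the bundle of linear frames of the $n$-dimensional manifold $M$, a principal bundle with group $GL(n,\mathbb{R})$; a frame $u\in L(M)$ is regarded as a linear isomorphism $u:\mathbb{R}^n\to T_{\pi(u)}(M)$. $\omega$ is the $\mathfrak{gl}(n,\mathbb{R})$-valued connection form on $L(M)$ of $\widetilde{\nabla}$; horizontal vectors are those in $\ker\omega$, and for a vector or vector field $Y$ on $M$, $Y^h$ denotes its horizontal lift to $L(M)$. The vertical projection of $X\in T_u(L(M))$ is $\nu(X)=u\,\omega(X)\,u^{-1}$, an endomorphism of $T_{\pi(u)}(M)$. A linear connection $\nabla$ on the manifold $L(M)$ (i.e. on the tangent bundle $T(L(M))$) is a lift of $\widetilde{\nabla}$ if $\pi_*(\nabla_{X^h}Y^h)=\widetilde{\nabla}_XY$ for every tangent vector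 $X$ to $M$ and every vector field $Y$ on $M$, where $X^h$ is taken at any point of $L(M)$ over the base point of $X$. *)

theory Defs
  imports "HOL-Analysis.Analysis"
begin

section \<open>Smooth manifolds\<close>

text \<open>All derivatives below are taken on open sets of finite-dimensional spaces; there
  \<open>smooth_on\<close> is the usual \<open>C\<^sup>\<infinity>\<close> condition.\<close>

primrec Ck_on :: "nat \<Rightarrow> 'e::real_normed_vector set \<Rightarrow> ('e \<Rightarrow> 'f::real_normed_vector) \<Rightarrow> bool" where
  "Ck_on 0 S f \<longleftrightarrow> continuous_on S f"
| "Ck_on (Suc k) S f \<longleftrightarrow>
     (\<forall>x\<in>S. f differentiable (at x)) \<and> (\<forall>v. Ck_on k S (\<lambda>x. frechet_derivative f (at x) v))"

definition smooth_on :: "'e::real_normed_vector set \<Rightarrow> ('e \<Rightarrow> 'f::real_normed_vector) \<Rightarrow> bool" where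
  "smooth_on S f \<longleftrightarrow> (\<forall>k. Ck_on k S f)"

text \<open>A chart is a pair of a domain and a coordinate map; the values of the coordinate map
  outside the domain are irrelevant.\<close>

type_synonym ('a, 'e) chart = "'a set \<times> ('a \<Rightarrow> 'e)"

type_synonym ('a, 'e) atlas = "('a, 'e) chart set"

definition chart_inv :: "('a, 'e) chart \<Rightarrow> 'e \<Rightarrow> 'a" where
  "chart_inv c = inv_into (fst c) (snd c)"

definition transition :: "('a, 'e) chart \<Rightarrow> ('a, 'e) chart \<Rightarrow> 'e \<Rightarrow> 'e" where
  "transition c d = snd d \<circ> chart_inv c"

definition carrier :: "('a, 'e) atlas \<Rightarrow> 'a set" where
  "carrier A = \<Union> (fst ` A)"

definition charts_at :: "('a, 'e) atlas \<Rightarrow> 'a \<Rightarrow> ('a, 'e) chart set" where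
  "charts_at A p = {c \<in> A. p \<in> fst c}"

definition smooth_atlas :: "('a, 'e::euclidean_space) atlas \<Rightarrow> bool" where
  "smooth_atlas A \<longleftrightarrow>
     (\<forall>c\<in>A. inj_on (snd c) (fst c) \<and> open (snd c ` fst c)) \<and>
     (\<forall>c\<in>A. \<forall>d\<in>A. open (snd c ` (fst c \<inter> fst d)) \<and>
        smooth_on (snd c ` (fst c \<inter> fst d)) (transition c d))"

definition mopen :: "('a, 'e::euclidean_space) atlas \<Rightarrow> 'a set \<Rightarrow> bool" where
  "mopen A W \<longleftrightarrow> W \<subseteq> carrier A \<and> (\<forall>c\<in>A. open (snd c ` (W \<inter> fst c)))"

definition manifold_topology :: "('a, 'e::euclidean_space) atlas \<Rightarrow> 'a topology" where
  "manifold_topology A = topology (mopen A)"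

lemma istopology_mopen:
  assumes "smooth_atlas A"
  shows "istopology (mopen A)"
  unfolding istopology_def
proof (intro conjI allI impI)
  fix S T assume ST: "mopen A S" "mopen A T"
  have "open (snd c ` ((S \<inter> T) \<inter> fst c))" if c: "c \<in> A" for c
  proof -
    have "inj_on (snd c) (fst c)"
      using assms c by (auto simp: smooth_atlas_def)
    then have "snd c ` ((S \<inter> fst c) \<inter> (T \<inter> fst c)) = snd c ` (S \<inter> fst c) \<inter> snd c ` (T \<inter> fst c)"
      by (rule inj_on_image_Int) auto
    moreover have "(S \<inter> T) \<inter> fst c = (S \<inter> fst c) \<inter> (T \<inter> fst c)" by blast
    ultimately show ?thesis using ST c by (auto simp: mopen_def)
  qed
  then show "mopen A (S \<inter> T)" using ST by (auto simp: mopen_def)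
next
  fix K assume K: "\<forall>S\<in>K. mopen A S"
  have "open (snd c ` (\<Union> K \<inter> fst c))" if c: "c \<in> A" for c
  proof -
    have "snd c ` (\<Union> K \<inter> fst c) = (\<Union>S\<in>K. snd c ` (S \<inter> fst c))" by blast
    then show ?thesis using K c by (auto simp: mopen_def)
  qed
  then show "mopen A (\<Union> K)" using K by (auto simp: mopen_def)
qed

lemma openin_manifold_topology:
  "smooth_atlas A \<Longrightarrow> openin (manifold_topology A) W \<longleftrightarrow> mopen A W"
  by (simp add: manifold_topology_def istopology_mopen topology_inverse')

lemma topspace_manifold_topology:
  assumes "smooth_atlas A"
  shows "topspace (manifold_topology A) = carrier A"
proof -
  have "mopen A (carrier A)"
  proof -
    have "carrier A \<inter> fst c = fst c" if "c \<in> A" for c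
      using that by (auto simp: carrier_def)
    then show ?thesis using assms by (auto simp: mopen_def smooth_atlas_def)
  qed
  then show ?thesis
    using assms unfolding topspace_def
    by (auto simp: openin_manifold_topology) (auto simp: mopen_def)
qed

definition smooth_manifold :: "('a, 'e::euclidean_space) atlas \<Rightarrow> bool" where
  "smooth_manifold A \<longleftrightarrow> smooth_atlas A \<and>
     Hausdorff_space (manifold_topology A) \<and> second_countable (manifold_topology A)"


section \<open>Tangent vectors, vector fields, curves\<close>

text \<open>A tangent vector at \<open>p\<close> is the family of its coordinate vectors in all charts around \<open>p\<close>,
  related by the derivatives of the transition maps.  Coordinates in the remaining charts are
  set to \<open>0\<close> so that equality of tangent vectors is equality of functions.  The base point is
  not part of the vector.  The vector space operations are pointwise.\<close>

type_synonym ('a, 'e) tvec = "('a, 'e) chart \<Rightarrow> 'e"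

definition tangent_space :: "('a, 'e::euclidean_space) atlas \<Rightarrow> 'a \<Rightarrow> ('a, 'e) tvec set" where
  "tangent_space A p = {v.
     (\<forall>c. c \<notin> charts_at A p \<longrightarrow> v c = 0) \<and>
     (\<forall>c\<in>charts_at A p. \<forall>d\<in>charts_at A p.
        v d = frechet_derivative (transition c d) (at (snd c p)) (v c))}"

text \<open>For \<open>e\<close> in the standard basis, \<open>coord_field A c e\<close> is the coordinate vector field of the
  chart \<open>c\<close> in direction \<open>e\<close>.\<close>

definition coord_field :: "('a, 'e::euclidean_space) atlas \<Rightarrow> ('a, 'e) chart \<Rightarrow> 'e \<Rightarrow> 'a \<Rightarrow> ('a, 'e) tvec" where
  "coord_field A c e p =
     (\<lambda>d. if c \<in> charts_at A p \<and> d \<in> charts_at A p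
          then frechet_derivative (transition c d) (at (snd c p)) e else 0)"

definition smooth_fun :: "('a, 'e::euclidean_space) atlas \<Rightarrow> 'a set \<Rightarrow> ('a \<Rightarrow> real) \<Rightarrow> bool" where
  "smooth_fun A W f \<longleftrightarrow> (\<forall>c\<in>A. smooth_on (snd c ` (W \<inter> fst c)) (f \<circ> chart_inv c))"

definition smooth_vector_field ::
    "('a, 'e::euclidean_space) atlas \<Rightarrow> 'a set \<Rightarrow> ('a \<Rightarrow> ('a, 'e) tvec) \<Rightarrow> bool" where
  "smooth_vector_field A W Y \<longleftrightarrow>
     (\<forall>p\<in>W. Y p \<in> tangent_space A p) \<and>
     (\<forall>c\<in>A. smooth_on (snd c ` (W \<inter> fst c)) (\<lambda>x. Y (chart_inv c x) c))"

text \<open>By the chain rule the next two definitions do not depend on the chart chosen at \<open>p\<close>.\<close>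

definition dir_deriv ::
    "('a, 'e::euclidean_space) atlas \<Rightarrow> 'a \<Rightarrow> ('a, 'e) tvec \<Rightarrow> ('a \<Rightarrow> real) \<Rightarrow> real" where
  "dir_deriv A p X f =
     (let c = (SOME c. c \<in> charts_at A p)
      in frechet_derivative (f \<circ> chart_inv c) (at (snd c p)) (X c))"

definition pushforward ::
    "('a, 'e::euclidean_space) atlas \<Rightarrow> ('b, 'f::euclidean_space) atlas \<Rightarrow> ('a \<Rightarrow> 'b)
       \<Rightarrow> 'a \<Rightarrow> ('a, 'e) tvec \<Rightarrow> ('b, 'f) tvec" where
  "pushforward A B f p X =
     (\<lambda>d. if d \<in> charts_at B (f p)
          then let c = (SOME c. c \<in> charts_at A p)
               in frechet_derivative (snd d \<circ> f \<circ> chart_inv c) (at (snd c p)) (X c)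
          else 0)"

definition smooth_curve :: "('a, 'e::euclidean_space) atlas \<Rightarrow> real set \<Rightarrow> (real \<Rightarrow> 'a) \<Rightarrow> bool" where
  "smooth_curve A I \<gamma> \<longleftrightarrow> \<gamma> ` I \<subseteq> carrier A \<and>
     (\<forall>c\<in>A. open {t \<in> I. \<gamma> t \<in> fst c} \<and> smooth_on {t \<in> I. \<gamma> t \<in> fst c} (snd c \<circ> \<gamma>))"

definition velocity :: "('a, 'e::euclidean_space) atlas \<Rightarrow> (real \<Rightarrow> 'a) \<Rightarrow> real \<Rightarrow> ('a, 'e) tvec" where
  "velocity A \<gamma> t =
     (\<lambda>c. if c \<in> charts_at A (\<gamma> t) then vector_derivative (snd c \<circ> \<gamma>) (at t) else 0)"

definition open_interval :: "real set \<Rightarrow> bool" where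
  "open_interval I \<longleftrightarrow> open I \<and> is_interval I"

text \<open>Here \<open>F p\<close> is the endomorphism of the tangent space at \<open>p\<close>.\<close>

definition tensor_field_11 ::
    "('a, 'e::euclidean_space) atlas \<Rightarrow> ('a \<Rightarrow> ('a, 'e) tvec \<Rightarrow> ('a, 'e) tvec) \<Rightarrow> bool" where
  "tensor_field_11 A F \<longleftrightarrow>
     (\<forall>p\<in>carrier A. \<forall>v\<in>tangent_space A p. F p v \<in> tangent_space A p) \<and>
     (\<forall>p\<in>carrier A. \<forall>v\<in>tangent_space A p. \<forall>w\<in>tangent_space A p. \<forall>a b.
        F p (\<lambda>c. a *\<^sub>R v c + b *\<^sub>R w c) = (\<lambda>c. a *\<^sub>R F p v c + b *\<^sub>R F p w c)) \<and>
     (\<forall>W Y. mopen A W \<longrightarrow> smooth_vector_field A W Y \<longrightarrow>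
        smooth_vector_field A W (\<lambda>p. F p (Y p)))"


section \<open>Linear connections\<close>

text \<open>A linear connection is a covariant derivative \<open>D p X Y\<close> of a vector field \<open>Y\<close>, smooth on a
  neighbourhood of \<open>p\<close>, in the direction of a tangent vector \<open>X\<close> at \<open>p\<close>.  Letting \<open>Y\<close> be defined
  only locally makes coordinate fields admissible without cutting them off by bump functions;
  a derivative acting on global fields extends uniquely to local ones.  The first condition
  says that \<open>D p X Y\<close> depends only on \<open>Y\<close> near \<open>p\<close>.\<close>

type_synonym ('a, 'e) covd = "'a \<Rightarrow> ('a, 'e) tvec \<Rightarrow> ('a \<Rightarrow> ('a, 'e) tvec) \<Rightarrow> ('a, 'e) tvec"

definition linear_connection :: "('a, 'e::euclidean_space) atlas \<Rightarrow> ('a, 'e) covd \<Rightarrow> bool" where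
  "linear_connection A D \<longleftrightarrow>
     (\<forall>W Y. mopen A W \<longrightarrow> smooth_vector_field A W Y \<longrightarrow>
        (\<forall>p\<in>W. \<forall>X\<in>tangent_space A p.
           (\<forall>Z. (\<forall>q\<in>W. Z q = Y q) \<longrightarrow> D p X Z = D p X Y) \<and>
           D p X Y \<in> tangent_space A p \<and>
           (\<forall>X'\<in>tangent_space A p. \<forall>a b.
              D p (\<lambda>c. a *\<^sub>R X c + b *\<^sub>R X' c) Y = (\<lambda>c. a *\<^sub>R D p X Y c + b *\<^sub>R D p X' Y c)) \<and>
           (\<forall>Z. smooth_vector_field A W Z \<longrightarrow>
              D p X (\<lambda>q c. Y q c + Z q c) = (\<lambda>c. D p X Y c + D p X Z c)) \<and>
           (\<forall>f. smooth_fun A W f \<longrightarrow>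
              D p X (\<lambda>q c. f q *\<^sub>R Y q c) = (\<lambda>c. dir_deriv A p X f *\<^sub>R Y p c + f p *\<^sub>R D p X Y c))) \<and>
        (\<forall>X. smooth_vector_field A W X \<longrightarrow>
           smooth_vector_field A W (\<lambda>p. D p (X p) Y)))"

text \<open>\<open>has_covd_along A D \<gamma> V t w\<close>: the covariant derivative at \<open>t\<close> of the vector field \<open>V\<close> along
  the curve \<open>\<gamma>\<close> is \<open>w\<close>.  In a chart with coordinate fields \<open>\<partial>\<^sub>b\<close> and \<open>V = (\<Sum>b. V\<^sup>b \<partial>\<^sub>b)\<close>, this
  derivative is \<open>\<Sum>b. (dV\<^sup>b/dt) \<partial>\<^sub>b + V\<^sup>b D\<^bsub>\<gamma>'\<^esub> \<partial>\<^sub>b\<close>.\<close>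

definition has_covd_along ::
    "('a, 'e::euclidean_space) atlas \<Rightarrow> ('a, 'e) covd \<Rightarrow> (real \<Rightarrow> 'a) \<Rightarrow> (real \<Rightarrow> ('a, 'e) tvec)
       \<Rightarrow> real \<Rightarrow> ('a, 'e) tvec \<Rightarrow> bool" where
  "has_covd_along A D \<gamma> V t w \<longleftrightarrow>
     w \<in> tangent_space A (\<gamma> t) \<and>
     (\<forall>c\<in>charts_at A (\<gamma> t). \<exists>V'. ((\<lambda>s. V s c) has_vector_derivative V') (at t) \<and>
        w c = V' + (\<Sum>b\<in>Basis. (V t c \<bullet> b) *\<^sub>R D (\<gamma> t) (velocity A \<gamma> t) (coord_field A c b) c))"

definition geodesic :: "('a, 'e::euclidean_space) atlas \<Rightarrow> ('a, 'e) covd \<Rightarrow> real set \<Rightarrow> (real \<Rightarrow> 'a) \<Rightarrow> bool" where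
  "geodesic A D I \<gamma> \<longleftrightarrow> open_interval I \<and> smooth_curve A I \<gamma> \<and>
     (\<forall>t\<in>I. has_covd_along A D \<gamma> (velocity A \<gamma>) t (\<lambda>_. 0))"

definition forced_solution ::
    "('a, 'e::euclidean_space) atlas \<Rightarrow> ('a, 'e) covd \<Rightarrow> ('a \<Rightarrow> ('a, 'e) tvec \<Rightarrow> ('a, 'e) tvec)
       \<Rightarrow> real set \<Rightarrow> (real \<Rightarrow> 'a) \<Rightarrow> bool" where
  "forced_solution A D F I \<sigma> \<longleftrightarrow> open_interval I \<and> smooth_curve A I \<sigma> \<and>
     (\<forall>t\<in>I. has_covd_along A D \<sigma> (velocity A \<sigma>) t (F (\<sigma> t) (velocity A \<sigma> t)))"


section \<open>The bundle of linear frames\<close>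

text \<open>A frame at \<open>p\<close> is a linear isomorphism from \<open>\<real>\<^sup>n\<close> onto the tangent space at \<open>p\<close>.\<close>

type_synonym ('m, 'n) frame = "real^'n \<Rightarrow> ('m, real^'n) tvec"

type_synonym ('m, 'n) frame_point = "'m \<times> ('m, 'n) frame"

type_synonym ('m, 'n) frame_tvec = "(('m, 'n) frame_point, (real^'n) \<times> (real^'n^'n)) tvec"

definition frames :: "('m, real^'n) atlas \<Rightarrow> 'm \<Rightarrow> ('m, 'n) frame set" where
  "frames A p = {u. (\<forall>c. linear (\<lambda>x. u x c)) \<and> bij_betw u UNIV (tangent_space A p)}"

definition frame_bundle :: "('m, real^'n) atlas \<Rightarrow> ('m, 'n) frame_point set" where
  "frame_bundle A = Sigma (carrier A) (frames A)"

definition frame_chart ::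
    "('m, real^'n) atlas \<Rightarrow> ('m, real^'n) chart \<Rightarrow> (('m, 'n) frame_point, (real^'n) \<times> (real^'n^'n)) chart" where
  "frame_chart A c = (Sigma (fst c) (frames A), \<lambda>(p, u). (snd c p, matrix (\<lambda>x. u x c)))"

definition frame_atlas ::
    "('m, real^'n) atlas \<Rightarrow> (('m, 'n) frame_point, (real^'n) \<times> (real^'n^'n)) atlas" where
  "frame_atlas A = frame_chart A ` A"

lemma carrier_frame_atlas: "carrier (frame_atlas A) = frame_bundle A"
  by (auto simp: carrier_def frame_atlas_def frame_bundle_def frame_chart_def)

text \<open>The bundle projection is \<open>fst\<close>.\<close>

abbreviation proj_push ::
    "('m, real^'n) atlas \<Rightarrow> ('m, 'n) frame_point \<Rightarrow> ('m, 'n) frame_tvec \<Rightarrow> ('m, real^'n) tvec" where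
  "proj_push A \<equiv> pushforward (frame_atlas A) A fst"

text \<open>The connection form of \<open>D\<close>: if \<open>X\<close> is the velocity at \<open>0\<close> of a curve of frames \<open>u\<^sub>t\<close>, then
  \<open>u\<^sub>0 (\<omega>(X) x)\<close> is the covariant derivative at \<open>0\<close> of the vector field \<open>u\<^sub>t x\<close> along the
  projected curve, for all \<open>x\<close> in \<open>\<real>\<^sup>n\<close>.  So the curves of parallel frames are the horizontal
  ones, and \<open>\<omega>\<close> reproduces the generators of fundamental vector fields.\<close>

definition connection_form ::
    "('m, real^'n) atlas \<Rightarrow> ('m, real^'n) covd \<Rightarrow> ('m, 'n) frame_point \<Rightarrow> ('m, 'n) frame_tvec \<Rightarrow> real^'n^'n" where
  "connection_form A D z X = (THE w. \<forall>I \<gamma>.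
     open_interval I \<longrightarrow> 0 \<in> I \<longrightarrow> smooth_curve (frame_atlas A) I \<gamma> \<longrightarrow>
     \<gamma> 0 = z \<longrightarrow> velocity (frame_atlas A) \<gamma> 0 = X \<longrightarrow>
     (\<forall>x. has_covd_along A D (\<lambda>t. fst (\<gamma> t)) (\<lambda>t. snd (\<gamma> t) x) 0 (snd z (w *v x))))"

definition vertical_projection ::
    "('m, real^'n) atlas \<Rightarrow> ('m, real^'n) covd \<Rightarrow> ('m, 'n) frame_point \<Rightarrow> ('m, 'n) frame_tvec
       \<Rightarrow> ('m, real^'n) tvec \<Rightarrow> ('m, real^'n) tvec" where
  "vertical_projection A D z X v = snd z (connection_form A D z X *v inv (snd z) v)"

definition horizontal_lift ::
    "('m, real^'n) atlas \<Rightarrow> ('m, real^'n) covd \<Rightarrow> ('m, 'n) frame_point \<Rightarrow> ('m, real^'n) tvec \<Rightarrow> ('m, 'n) frame_tvec" where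
  "horizontal_lift A D z X = (THE Z. Z \<in> tangent_space (frame_atlas A) z \<and>
     connection_form A D z Z = 0 \<and> proj_push A z Z = X)"

definition is_lift ::
    "('m, real^'n) atlas \<Rightarrow> ('m, real^'n) covd \<Rightarrow> (('m, 'n) frame_point, (real^'n) \<times> (real^'n^'n)) covd \<Rightarrow> bool" where
  "is_lift A D N \<longleftrightarrow>
     (\<forall>W Y. mopen A W \<longrightarrow> smooth_vector_field A W Y \<longrightarrow>
        (\<forall>z\<in>frame_bundle A. fst z \<in> W \<longrightarrow> (\<forall>X\<in>tangent_space A (fst z).
           proj_push A z
             (N z (horizontal_lift A D z X) (\<lambda>z'. horizontal_lift A D z' (Y (fst z'))))
           = D (fst z) X Y)))"

end

theory Submission
  imports Defs
begin

text \<open>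
  Write \<open>\<theta>(X) = u\<^sup>-\<^sup>1 (\<pi>\<^sub>* X)\<close> and \<open>\<omega>(X)\<close> for the canonical form and the connection form of a vector \<open>X\<close>
  at a frame \<open>u\<close>.  The pair \<open>(\<theta>, \<omega>)\<close> maps every tangent space of the frame bundle isomorphically onto
  the fixed space \<open>\<real>\<^sup>n \<times> gl(n)\<close>.  Differentiating vector fields componentwise in this parallelization is
  a connection; it is a lift of the given one, because \<open>\<theta>(Y\<^sup>h) = u\<^sup>-\<^sup>1 Y\<close> and the horizontal derivative
  of \<open>u\<^sup>-\<^sup>1 Y\<close> is \<open>u\<^sup>-\<^sup>1\<close> applied to the covariant derivative of \<open>Y\<close>.  Along its geodesics \<open>\<theta>\<close> and \<open>\<omega>\<close>
  of the velocity are constant, so the projection \<open>\<sigma>\<close> has \<open>\<sigma>' = u \<xi>\<close> with constant \<open>\<xi>\<close>, and the covariant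
  derivative of \<open>\<sigma>'\<close> is \<open>u \<omega> \<xi> = \<nu> \<sigma>'\<close>.  This would be the forced equation if \<open>\<nu>\<close> were equal to \<open>F\<close> all
  along the curve, that is, if \<open>\<omega>\<close> were equal to the matrix \<open>f(u) = u\<^sup>-\<^sup>1 F u\<close> of \<open>F\<close> in the frame.

  The lift in the theorem corrects the flat connection accordingly:
  \<open>N\<^sub>X Y\<close> has the components \<open>X(\<theta>(Y))\<close> and \<open>X(\<omega>(Y)) - \<lambda>(Y) df(X)\<close>, where \<open>\<lambda>(Y) = \<langle>\<omega>(Y), f\<rangle> / \<langle>f, f\<rangle>\<close> for
  the Euclidean inner product on matrices.  Division by \<open>\<langle>f, f\<rangle>\<close> is possible because \<open>F\<close> vanishes nowhere.
  The correction has no \<open>\<theta>\<close>-component, so \<open>N\<close> is still a lift.  Along a geodesic \<open>\<theta>\<close> is constant and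
  \<open>\<omega>' = \<lambda> f'\<close>; hence \<open>\<delta> = \<omega> - f\<close> satisfies the homogeneous linear equation
  \<open>\<delta>' = (\<langle>\<delta>, f\<rangle> / \<langle>f, f\<rangle>) f'\<close>, and if \<open>\<delta>\<close> vanishes at one time, it vanishes at all times
  (\<open>geodesic_connection_form\<close>).  So \<open>\<nu> = F\<close> persists and the projection solves the forced equation
  (\<open>geodesic_projects_to_forced_solution\<close>).

  Conversely, given a forced solution \<open>\<sigma>\<close>, let \<open>u\<close> be the frame along \<open>\<sigma>\<close> whose covariant derivative is
  \<open>F u\<close>.  Then \<open>\<omega> = f\<close>, and \<open>\<theta> = u\<^sup>-\<^sup>1 \<sigma>'\<close> is constant because \<open>u\<close> and \<open>\<sigma>'\<close> solve the same linear equation.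
  So \<open>(\<sigma>, u)\<close> is a geodesic (\<open>forced_solution_lifts_to_geodesic\<close>).  The frame exists on the whole interval
  because its equation is linear: it is solved near each time in a chart, and the pieces are glued
  (\<open>frame_transport_exists\<close>).
\<close>

section \<open>Smooth maps between Euclidean spaces\<close>

lemma frechet_derivative_cong_open:
  assumes "open S" "x \<in> S" "\<And>y. y \<in> S \<Longrightarrow> f y = g y"
  shows "frechet_derivative f (at x) = frechet_derivative g (at x)"
    and "f differentiable (at x) \<longleftrightarrow> g differentiable (at x)"
proof -
  have "(f has_derivative f') (at x) \<longleftrightarrow> (g has_derivative f') (at x)" for f'
    using has_derivative_transform_within_open[OF _ assms(1,2), of f f' UNIV g]
      has_derivative_transform_within_open[OF _ assms(1,2), of g f' UNIV f] assms(3) by metis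
  then show "frechet_derivative f (at x) = frechet_derivative g (at x)"
    and "f differentiable (at x) \<longleftrightarrow> g differentiable (at x)"
    by (simp_all add: frechet_derivative_def differentiable_def)
qed

lemma Ck_on_cong:
  assumes "open S" "\<And>x. x \<in> S \<Longrightarrow> f x = g x"
  shows "Ck_on k S f \<longleftrightarrow> Ck_on k S g"
  using assms(2)
proof (induction k arbitrary: f g)
  case 0
  then show ?case by (simp cong: continuous_on_cong)
next
  case (Suc k)
  have "Ck_on k S (\<lambda>x. frechet_derivative f (at x) v) = Ck_on k S (\<lambda>x. frechet_derivative g (at x) v)" for v
    by (rule Suc.IH) (simp add: frechet_derivative_cong_open(1)[OF assms(1) _ Suc.prems])
  then show ?case
    using frechet_derivative_cong_open(2)[OF assms(1) _ Suc.prems] by auto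
qed

lemma Ck_on_subset: "Ck_on k S f \<Longrightarrow> T \<subseteq> S \<Longrightarrow> Ck_on k T f"
  by (induction k arbitrary: f) (auto intro: continuous_on_subset)

lemma Ck_on_Suc_imp: "Ck_on (Suc k) S f \<Longrightarrow> Ck_on k S f"
proof (induction k arbitrary: f)
  case 0
  then have "continuous (at x within S) f" if "x \<in> S" for x
    using that differentiable_imp_continuous_within continuous_at_imp_continuous_at_within by fastforce
  then show ?case by (simp add: continuous_on_eq_continuous_within)
next
  case (Suc k)
  then show ?case unfolding Ck_on.simps(2)[of k S f] Ck_on.simps(2)[of "Suc k" S f] by blast
qed

lemma Ck_on_continuous_on: "Ck_on k S f \<Longrightarrow> continuous_on S f"
  by (induction k) (auto dest: Ck_on_Suc_imp simp del: Ck_on.simps(2))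

lemma Ck_on_SucI:
  assumes "open S" "\<And>x. x \<in> S \<Longrightarrow> (f has_derivative f' x) (at x)" "\<And>v. Ck_on k S (\<lambda>x. f' x v)"
  shows "Ck_on (Suc k) S f"
proof -
  have "Ck_on k S (\<lambda>x. frechet_derivative f (at x) v) = Ck_on k S (\<lambda>x. f' x v)" for v
    by (rule Ck_on_cong[OF assms(1)]) (simp add: frechet_derivative_at[OF assms(2), symmetric])
  then show ?thesis using assms by (auto simp: differentiable_def)
qed

lemma Ck_on_has_derivative:
  "Ck_on (Suc k) S f \<Longrightarrow> x \<in> S \<Longrightarrow> (f has_derivative frechet_derivative f (at x)) (at x)"
  by (simp add: frechet_derivative_works[symmetric])

lemma Ck_on_const: "Ck_on k S (\<lambda>x. c)"
  by (induction k arbitrary: c) auto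

lemma Ck_on_bounded_linear:
  assumes "open S" "bounded_linear L" "Ck_on k S f"
  shows "Ck_on k S (\<lambda>x. L (f x))"
  using assms(3)
proof (induction k arbitrary: f)
  case 0
  then show ?case by (simp add: bounded_linear.continuous_on[OF assms(2)])
next
  case (Suc k)
  show ?case
  proof (rule Ck_on_SucI[OF assms(1)])
    show "((\<lambda>x. L (f x)) has_derivative (\<lambda>v. L (frechet_derivative f (at x) v))) (at x)" if "x \<in> S" for x
      by (rule bounded_linear.has_derivative[OF assms(2) Ck_on_has_derivative[OF Suc.prems that]])
    show "Ck_on k S (\<lambda>x. L (frechet_derivative f (at x) v))" for v
      using Suc by auto
  qed
qed

lemma Ck_on_add:
  assumes "open S" "Ck_on k S f" "Ck_on k S g"
  shows "Ck_on k S (\<lambda>x. f x + g x)"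
  using assms(2,3)
proof (induction k arbitrary: f g)
  case 0
  then show ?case by (simp add: continuous_on_add)
next
  case (Suc k)
  show ?case
    by (rule Ck_on_SucI[OF assms(1) has_derivative_add[OF Ck_on_has_derivative[OF Suc.prems(1)] Ck_on_has_derivative[OF Suc.prems(2)]]])
      (use Suc in auto)
qed

lemma Ck_on_bounded_bilinear:
  assumes "open S" "bounded_bilinear B" "Ck_on k S f" "Ck_on k S g"
  shows "Ck_on k S (\<lambda>x. B (f x) (g x))"
  using assms(3,4)
proof (induction k arbitrary: f g)
  case 0
  then show ?case by (simp add: bounded_bilinear.continuous_on[OF assms(2)])
next
  case (Suc k)
  show ?case
  proof (rule Ck_on_SucI[OF assms(1) bounded_bilinear.FDERIV[OF assms(2) Ck_on_has_derivative[OF Suc.prems(1)] Ck_on_has_derivative[OF Suc.prems(2)]]])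
    show "Ck_on k S (\<lambda>x. B (f x) (frechet_derivative g (at x) v) + B (frechet_derivative f (at x) v) (g x))" for v
      by (intro Ck_on_add[OF assms(1)] Suc.IH)
        (use Suc.prems Ck_on_Suc_imp[OF Suc.prems(1)] Ck_on_Suc_imp[OF Suc.prems(2)] in simp_all)
  qed
qed

lemma Ck_on_sum:
  assumes "open S" "\<And>i. i \<in> I \<Longrightarrow> Ck_on k S (f i)"
  shows "Ck_on k S (\<lambda>x. \<Sum>i\<in>I. f i x)"
  using assms(2) by (induction I rule: infinite_finite_induct) (auto simp: Ck_on_const intro!: Ck_on_add assms(1))

text \<open>The derivative of the composition is expanded in the standard basis of the middle space.  It
  becomes a sum of products of a component of \<open>g'\<close> with a directional derivative of \<open>f\<close> composed with \<open>g\<close>,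
  and the induction hypothesis applies to the latter.\<close>

lemma Ck_on_compose:
  fixes f :: "'b::euclidean_space \<Rightarrow> 'c::real_normed_vector" and g :: "'a::real_normed_vector \<Rightarrow> 'b"
  assumes "open S" "Ck_on k T f" "Ck_on k S g" "g ` S \<subseteq> T"
  shows "Ck_on k S (\<lambda>x. f (g x))"
  using assms(2,3)
proof (induction k arbitrary: f)
  case 0
  then show ?case using continuous_on_compose2[OF _ _ assms(4)] by simp
next
  case (Suc k)
  let ?f' = "\<lambda>x. frechet_derivative f (at x)" and ?g' = "\<lambda>x. frechet_derivative g (at x)"
  show ?case
  proof (rule Ck_on_SucI[OF assms(1)])
    fix x assume x: "x \<in> S"
    then have gx: "g x \<in> T" using assms(4) by auto
    have df: "(f has_derivative ?f' (g x)) (at (g x))" by (rule Ck_on_has_derivative[OF Suc.prems(1) gx])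
    have "?f' (g x) (?g' x v) = (\<Sum>b\<in>Basis. (?g' x v \<bullet> b) *\<^sub>R ?f' (g x) b)" for v
      by (subst euclidean_representation[of "?g' x v", symmetric])
        (simp add: linear_sum[OF has_derivative_linear[OF df]] linear_cmul[OF has_derivative_linear[OF df]])
    then show "((\<lambda>x. f (g x)) has_derivative (\<lambda>v. \<Sum>b\<in>Basis. (?g' x v \<bullet> b) *\<^sub>R ?f' (g x) b)) (at x)"
      using has_derivative_compose[OF Ck_on_has_derivative[OF Suc.prems(2) x] df] by (simp add: o_def)
  next
    fix v
    have g: "Ck_on k S g" "Ck_on k S (\<lambda>x. ?g' x v)"
      using Suc.prems(2) Ck_on_Suc_imp[OF Suc.prems(2)] by simp_all
    have "Ck_on k S (\<lambda>x. ?f' (g x) b)" for b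
      by (rule Suc.IH[OF _ g(1)]) (use Suc.prems(1) in simp)
    then show "Ck_on k S (\<lambda>x. \<Sum>b\<in>Basis. (?g' x v \<bullet> b) *\<^sub>R ?f' (g x) b)"
      by (intro Ck_on_sum Ck_on_bounded_bilinear[OF _ bounded_bilinear_scaleR] assms(1)
          Ck_on_bounded_linear[OF _ bounded_linear_inner_left] g)
  qed
qed

lemma Ck_on_inverse:
  fixes f :: "'a::real_normed_vector \<Rightarrow> real"
  assumes "open S" "Ck_on k S f" "\<And>x. x \<in> S \<Longrightarrow> f x \<noteq> 0"
  shows "Ck_on k S (\<lambda>x. inverse (f x))"
  using assms(2)
proof (induction k)
  case 0
  then show ?case using assms(3) by (auto intro: continuous_on_inverse)
next
  case (Suc k)
  show ?case
  proof (rule Ck_on_SucI[OF assms(1) Deriv.has_derivative_inverse[OF _ Ck_on_has_derivative[OF Suc.prems]]])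
    fix v
    have "Ck_on k S (\<lambda>x. inverse (f x))" using Suc Ck_on_Suc_imp by blast
    moreover have "Ck_on k S (\<lambda>x. frechet_derivative f (at x) v)" using Suc by simp
    ultimately show "Ck_on k S (\<lambda>x. - (inverse (f x) * frechet_derivative f (at x) v * inverse (f x)))"
      by (intro Ck_on_bounded_linear[OF _ bounded_linear_minus[OF bounded_linear_ident]] assms(1)
          Ck_on_bounded_bilinear[OF _ bounded_bilinear_mult])
  qed (use assms(3) in auto)
qed

lemma smooth_on_cong: "open S \<Longrightarrow> (\<And>x. x \<in> S \<Longrightarrow> f x = g x) \<Longrightarrow> smooth_on S f \<longleftrightarrow> smooth_on S g"
  unfolding smooth_on_def using Ck_on_cong[of S f g] by blast

lemma smooth_on_subset: "smooth_on S f \<Longrightarrow> T \<subseteq> S \<Longrightarrow> smooth_on T f"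
  by (meson smooth_on_def Ck_on_subset)

lemma smooth_on_continuous_on: "smooth_on S f \<Longrightarrow> continuous_on S f"
  by (meson smooth_on_def Ck_on_continuous_on)

lemma smooth_on_has_derivative:
  "smooth_on S f \<Longrightarrow> x \<in> S \<Longrightarrow> (f has_derivative frechet_derivative f (at x)) (at x)"
  by (meson smooth_on_def Ck_on_has_derivative)

lemma smooth_on_linear_derivative: "smooth_on S f \<Longrightarrow> x \<in> S \<Longrightarrow> linear (frechet_derivative f (at x))"
  using smooth_on_has_derivative has_derivative_linear by blast

lemma smooth_on_has_vector_derivative:
  "smooth_on S f \<Longrightarrow> x \<in> S \<Longrightarrow> (f has_vector_derivative vector_derivative f (at x)) (at x)"
  using smooth_on_has_derivative differentiableI vector_derivative_works by blast

lemma smooth_on_derivative: "smooth_on S f \<Longrightarrow> smooth_on S (\<lambda>x. frechet_derivative f (at x) v)"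
  unfolding smooth_on_def
proof
  fix k assume "\<forall>k. Ck_on k S f"
  then have "Ck_on (Suc k) S f" by blast
  then show "Ck_on k S (\<lambda>x. frechet_derivative f (at x) v)" by simp
qed

lemma frechet_derivative_eq_vector_derivative:
  "f differentiable (at x) \<Longrightarrow> frechet_derivative f (at x) v = v *\<^sub>R vector_derivative f (at x)"
  by (metis frechet_derivative_at has_vector_derivative_def vector_derivative_works)

lemma smooth_on_vector_derivative:
  assumes "open S" "smooth_on S f" shows "smooth_on S (\<lambda>x. vector_derivative f (at x))"
proof -
  have "frechet_derivative f (at x) 1 = vector_derivative f (at x)" if "x \<in> S" for x
    using frechet_derivative_eq_vector_derivative[of f x 1] smooth_on_has_derivative[OF assms(2) that]
    by (simp add: differentiableI)
  then show ?thesis using smooth_on_derivative[OF assms(2), of 1]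
      smooth_on_cong[OF assms(1), of "\<lambda>x. frechet_derivative f (at x) 1" "\<lambda>x. vector_derivative f (at x)"] by blast
qed

lemma smooth_on_const: "smooth_on S (\<lambda>x. c)"
  by (simp add: smooth_on_def Ck_on_const)

lemma smooth_on_bounded_linear: "open S \<Longrightarrow> bounded_linear L \<Longrightarrow> smooth_on S f \<Longrightarrow> smooth_on S (\<lambda>x. L (f x))"
  by (simp add: smooth_on_def Ck_on_bounded_linear)

lemma smooth_on_id: "open S \<Longrightarrow> smooth_on S (\<lambda>x. x)"
  unfolding smooth_on_def
proof
  fix k assume S: "open S"
  show "Ck_on k S (\<lambda>x. x)"
  proof (cases k)
    case (Suc j)
    show ?thesis unfolding Suc by (rule Ck_on_SucI[OF S has_derivative_ident Ck_on_const])
  qed simp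
qed

lemma smooth_on_bounded_bilinear:
  "open S \<Longrightarrow> bounded_bilinear B \<Longrightarrow> smooth_on S f \<Longrightarrow> smooth_on S g \<Longrightarrow> smooth_on S (\<lambda>x. B (f x) (g x))"
  by (simp add: smooth_on_def Ck_on_bounded_bilinear)

lemma smooth_on_compose:
  fixes f :: "'b::euclidean_space \<Rightarrow> 'c::real_normed_vector"
  shows "open S \<Longrightarrow> smooth_on T f \<Longrightarrow> smooth_on S g \<Longrightarrow> g ` S \<subseteq> T \<Longrightarrow> smooth_on S (\<lambda>x. f (g x))"
  unfolding smooth_on_def using Ck_on_compose[of S _ T f g] by blast

lemma smooth_on_add: "open S \<Longrightarrow> smooth_on S f \<Longrightarrow> smooth_on S g \<Longrightarrow> smooth_on S (\<lambda>x. f x + g x)"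
  by (simp add: smooth_on_def Ck_on_add)

lemma smooth_on_minus: "open S \<Longrightarrow> smooth_on S f \<Longrightarrow> smooth_on S (\<lambda>x. - f x)"
  by (rule smooth_on_bounded_linear[OF _ bounded_linear_minus[OF bounded_linear_ident]])

lemma smooth_on_diff: "open S \<Longrightarrow> smooth_on S f \<Longrightarrow> smooth_on S g \<Longrightarrow> smooth_on S (\<lambda>x. f x - g x)"
  using smooth_on_add[OF _ _ smooth_on_minus] by fastforce

lemma smooth_on_sum: "open S \<Longrightarrow> (\<And>i. i \<in> I \<Longrightarrow> smooth_on S (f i)) \<Longrightarrow> smooth_on S (\<lambda>x. \<Sum>i\<in>I. f i x)"
  by (simp add: smooth_on_def Ck_on_sum)

lemmas smooth_on_scaleR = smooth_on_bounded_bilinear[OF _ bounded_bilinear_scaleR]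
  and smooth_on_mult = smooth_on_bounded_bilinear[OF _ bounded_bilinear_mult]
  and smooth_on_inner = smooth_on_bounded_bilinear[OF _ bounded_bilinear_inner]

lemma smooth_on_inverse:
  fixes f :: "'a::real_normed_vector \<Rightarrow> real"
  shows "open S \<Longrightarrow> smooth_on S f \<Longrightarrow> (\<And>x. x \<in> S \<Longrightarrow> f x \<noteq> 0) \<Longrightarrow> smooth_on S (\<lambda>x. inverse (f x))"
  by (simp add: smooth_on_def Ck_on_inverse)

lemma smooth_on_divide:
  fixes f :: "'a::real_normed_vector \<Rightarrow> real"
  shows "open S \<Longrightarrow> smooth_on S f \<Longrightarrow> smooth_on S g \<Longrightarrow> (\<And>x. x \<in> S \<Longrightarrow> g x \<noteq> 0) \<Longrightarrow> smooth_on S (\<lambda>x. f x / g x)"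
  by (simp add: divide_inverse smooth_on_mult smooth_on_inverse)

lemma smooth_on_Pair:
  assumes "open S" "smooth_on S f" "smooth_on S g"
  shows "smooth_on S (\<lambda>x. (f x, g x))"
proof -
  have "bounded_linear (\<lambda>x. (x, 0))" "bounded_linear (\<lambda>x. (0, x))"
    by (intro bounded_linear_Pair bounded_linear_ident bounded_linear_zero)+
  from smooth_on_add[OF assms(1) smooth_on_bounded_linear[OF assms(1) this(1) assms(2)]
      smooth_on_bounded_linear[OF assms(1) this(2) assms(3)]]
  show ?thesis by simp
qed

lemma smooth_on_fst: "open S \<Longrightarrow> smooth_on S f \<Longrightarrow> smooth_on S (\<lambda>x. fst (f x))"
  by (rule smooth_on_bounded_linear[OF _ bounded_linear_fst])

lemma smooth_on_snd: "open S \<Longrightarrow> smooth_on S f \<Longrightarrow> smooth_on S (\<lambda>x. snd (f x))"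
  by (rule smooth_on_bounded_linear[OF _ bounded_linear_snd])

lemma smooth_on_derivative_apply:
  fixes f :: "'a::euclidean_space \<Rightarrow> 'b::real_normed_vector"
  assumes "open S" "smooth_on S f" "smooth_on S g"
  shows "smooth_on S (\<lambda>x. frechet_derivative f (at x) (g x))"
proof -
  have "frechet_derivative f (at x) (g x) = (\<Sum>b\<in>Basis. (g x \<bullet> b) *\<^sub>R frechet_derivative f (at x) b)" if "x \<in> S" for x
    by (subst euclidean_representation[of "g x", symmetric])
      (simp add: linear_sum[OF smooth_on_linear_derivative[OF assms(2) that]] linear_cmul[OF smooth_on_linear_derivative[OF assms(2) that]])
  moreover have "smooth_on S (\<lambda>x. \<Sum>b\<in>Basis. (g x \<bullet> b) *\<^sub>R frechet_derivative f (at x) b)"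
    by (intro smooth_on_sum smooth_on_scaleR smooth_on_inner smooth_on_const smooth_on_derivative assms)
  ultimately show ?thesis
    using smooth_on_cong[OF assms(1), of "\<lambda>x. frechet_derivative f (at x) (g x)"] by simp
qed

lemma smooth_on_prod:
  fixes f :: "'i \<Rightarrow> 'a::real_normed_vector \<Rightarrow> real"
  assumes "open S" "\<And>i. i \<in> I \<Longrightarrow> smooth_on S (f i)"
  shows "smooth_on S (\<lambda>x. \<Prod>i\<in>I. f i x)"
  using assms(2) by (induction I rule: infinite_finite_induct) (auto simp: smooth_on_const intro!: smooth_on_mult assms(1))

lemma smooth_on_componentwise:
  fixes f :: "'a::real_normed_vector \<Rightarrow> 'b::euclidean_space"
  assumes "open S" "\<And>b. b \<in> Basis \<Longrightarrow> smooth_on S (\<lambda>x. f x \<bullet> b)"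
  shows "smooth_on S f"
proof -
  have "smooth_on S (\<lambda>x. \<Sum>b\<in>Basis. (f x \<bullet> b) *\<^sub>R b)"
    by (intro smooth_on_sum smooth_on_scaleR smooth_on_const assms)
  then show ?thesis by (simp add: euclidean_representation)
qed

lemma smooth_on_vec_nth: "open S \<Longrightarrow> smooth_on S f \<Longrightarrow> smooth_on S (\<lambda>x. f x $ i)"
  by (rule smooth_on_bounded_linear[OF _ bounded_linear_vec_nth])

lemma smooth_on_vec_lambda:
  fixes f :: "'i::finite \<Rightarrow> 'a::real_normed_vector \<Rightarrow> 'b::euclidean_space"
  assumes "open S" "\<And>i. smooth_on S (f i)"
  shows "smooth_on S (\<lambda>x. \<chi> i. f i x)"
proof (rule smooth_on_componentwise[OF assms(1)])
  fix b :: "'b^'i" assume "b \<in> Basis"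
  then obtain i u where "b = axis i u" by (auto simp: Basis_vec_def)
  then show "smooth_on S (\<lambda>x. (\<chi> i. f i x) \<bullet> b)"
    by (simp add: inner_axis smooth_on_inner smooth_on_const assms)
qed

lemma smooth_on_det:
  fixes f :: "'a::real_normed_vector \<Rightarrow> real^'n^'n"
  assumes "open S" "smooth_on S f"
  shows "smooth_on S (\<lambda>x. det (f x))"
  unfolding det_def
  by (intro smooth_on_sum smooth_on_mult smooth_on_prod smooth_on_const smooth_on_vec_nth assms)

lemma matrix_inv_mult:
  fixes M :: "real^'n^'n"
  assumes "invertible M"
  shows "M ** matrix_inv M = mat 1" "matrix_inv M ** M = mat 1"
  using assms someI_ex[of "\<lambda>N. M ** N = mat 1 \<and> N ** M = mat 1"]
  by (auto simp: invertible_def matrix_inv_def)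

text \<open>By Cramer's rule the entries of the inverse are quotients of determinants, and these are
  polynomials in the entries of the matrix.\<close>

lemma smooth_on_matrix_inv:
  fixes f :: "'a::real_normed_vector \<Rightarrow> real^'n^'n"
  assumes "open S" "smooth_on S f" "\<And>x. x \<in> S \<Longrightarrow> invertible (f x)"
  shows "smooth_on S (\<lambda>x. matrix_inv (f x))"
proof -
  define e :: "'n \<Rightarrow> real^'n" where "e = (\<lambda>j. axis j 1)"
  have eq: "matrix_inv (f x) = (\<chi> k j. det (\<chi> i l. if l = k then e j $ i else f x $ i $ l) / det (f x))" if x: "x \<in> S" for x
  proof -
    have "f x *v (matrix_inv (f x) *v e j) = e j" for j
      by (simp add: matrix_vector_mul_assoc matrix_inv_mult[OF assms(3)[OF x]])
    then have "matrix_inv (f x) *v e j = (\<chi> k. det (\<chi> i l. if l = k then e j $ i else f x $ i $ l) / det (f x))" for j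
      using cramer[of "f x" "matrix_inv (f x) *v e j" "e j"] assms(3)[OF x] by (simp add: invertible_det_nz)
    moreover have "matrix_inv (f x) $ k $ j = (matrix_inv (f x) *v e j) $ k" for j k
      by (simp add: e_def column_def matrix_vector_mult_basis)
    ultimately show ?thesis by (simp add: vec_eq_iff)
  qed
  have "smooth_on S (\<lambda>x. (if l = k then e j $ i else f x $ i $ l))" for i j k l
    by (cases "l = k") (auto intro!: smooth_on_const smooth_on_vec_nth assms)
  then have "smooth_on S (\<lambda>x. \<chi> k j. det (\<chi> i l. if l = k then e j $ i else f x $ i $ l) / det (f x))"
    by (intro smooth_on_vec_lambda smooth_on_divide smooth_on_det assms)
      (use assms(3) in \<open>auto simp: invertible_det_nz\<close>)
  then show ?thesis using smooth_on_cong[OF assms(1), of "\<lambda>x. matrix_inv (f x)", OF eq] by simp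
qed

lemma bounded_bilinear_matrix_mult: "bounded_bilinear ((**) :: real^'m^'n \<Rightarrow> real^'k^'m \<Rightarrow> real^'k^'n)"
  unfolding bilinear_conv_bounded_bilinear[symmetric] bilinear_def
  by (auto intro!: linearI simp: matrix_add_ldistrib matrix_scalar_ac scalar_matrix_assoc
      matrix_matrix_mult_def vec_eq_iff sum.distrib sum_distrib_left algebra_simps)

lemma bounded_bilinear_matrix_vector_mult: "bounded_bilinear ((*v) :: real^'m^'n \<Rightarrow> real^'m \<Rightarrow> real^'n)"
  unfolding bilinear_conv_bounded_bilinear[symmetric] bilinear_def
  by (auto intro!: linearI simp: matrix_vector_mult_def vec_eq_iff sum.distrib sum_distrib_left algebra_simps)

lemmas smooth_on_matrix_mult = smooth_on_bounded_bilinear[OF _ bounded_bilinear_matrix_mult]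
  and smooth_on_matrix_vector_mult = smooth_on_bounded_bilinear[OF _ bounded_bilinear_matrix_vector_mult]

lemma smooth_on_matrix:
  fixes f :: "'a::real_normed_vector \<Rightarrow> real^'n \<Rightarrow> real^'m"
  assumes "open S" "\<And>b. smooth_on S (\<lambda>x. f x b)"
  shows "smooth_on S (\<lambda>x. matrix (f x))"
  unfolding matrix_def by (intro smooth_on_vec_lambda smooth_on_vec_nth assms)

section \<open>Charts, tangent vectors and smooth maps on a manifold\<close>

definition transition_deriv :: "('a, 'e::euclidean_space) chart \<Rightarrow> ('a, 'e) chart \<Rightarrow> 'a \<Rightarrow> 'e \<Rightarrow> 'e" where
  "transition_deriv c d p = frechet_derivative (transition c d) (at (snd c p))"

text \<open>Values in an arbitrary normed space are allowed because matrices attached to frames will be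
  differentiated; for real values this is \<open>smooth_fun\<close>.\<close>

definition smooth_map :: "('a, 'e::euclidean_space) atlas \<Rightarrow> 'a set \<Rightarrow> ('a \<Rightarrow> 'f::real_normed_vector) \<Rightarrow> bool" where
  "smooth_map A W g \<longleftrightarrow> (\<forall>c\<in>A. smooth_on (snd c ` (W \<inter> fst c)) (\<lambda>x. g (chart_inv c x)))"

text \<open>The vector-valued version of \<open>dir_deriv\<close>.\<close>

definition deriv_along :: "('a, 'e::euclidean_space) atlas \<Rightarrow> 'a \<Rightarrow> ('a, 'e) tvec \<Rightarrow> ('a \<Rightarrow> 'f::real_normed_vector) \<Rightarrow> 'f" where
  "deriv_along A p X g =
     (let c = (SOME c. c \<in> charts_at A p)
      in frechet_derivative (\<lambda>x. g (chart_inv c x)) (at (snd c p)) (X c))"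

lemma smooth_fun_eq_smooth_map: "smooth_fun A W f = smooth_map A W f"
  by (simp add: smooth_fun_def smooth_map_def comp_def)

lemma dir_deriv_eq_deriv_along: "dir_deriv A p X f = deriv_along A p X f"
  by (simp add: dir_deriv_def deriv_along_def comp_def)

lemma some_chart: "p \<in> carrier A \<Longrightarrow> (SOME c. c \<in> charts_at A p) \<in> charts_at A p"
  by (rule someI_ex) (auto simp: carrier_def charts_at_def)

lemma smooth_map_subset: "smooth_map A W g \<Longrightarrow> V \<subseteq> W \<Longrightarrow> smooth_map A V g"
  unfolding smooth_map_def by (blast intro: smooth_on_subset)

lemma smooth_vector_field_subset: "smooth_vector_field A W Y \<Longrightarrow> V \<subseteq> W \<Longrightarrow> smooth_vector_field A V Y"
  unfolding smooth_vector_field_def by (blast intro: smooth_on_subset)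

context
  fixes A :: "('a, 'e::euclidean_space) atlas"
  assumes A: "smooth_atlas A"
begin

lemma chart_inv_left: "c \<in> A \<Longrightarrow> p \<in> fst c \<Longrightarrow> chart_inv c (snd c p) = p"
  using A by (auto simp: smooth_atlas_def chart_inv_def)

lemma chart_inv_mem:
  assumes "c \<in> A" "x \<in> snd c ` (W \<inter> fst c)"
  shows "chart_inv c x \<in> W" "chart_inv c x \<in> fst c" "snd c (chart_inv c x) = x"
  using assms by (auto simp: chart_inv_left)

lemma transition_apply: "c \<in> A \<Longrightarrow> p \<in> fst c \<Longrightarrow> transition c d (snd c p) = snd d p"
  by (simp add: transition_def chart_inv_left)

lemma open_chart_image: "mopen A W \<Longrightarrow> c \<in> A \<Longrightarrow> open (snd c ` (W \<inter> fst c))"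
  by (auto simp: mopen_def)

lemma mopen_Int: "mopen A V \<Longrightarrow> mopen A W \<Longrightarrow> mopen A (V \<inter> W)"
  using istopology_mopen[OF A] by (simp add: istopology_def)

lemma mopen_chart:
  assumes "c \<in> A" shows "mopen A (fst c)"
  unfolding mopen_def
proof (intro conjI ballI)
  show "fst c \<subseteq> carrier A" using assms by (auto simp: carrier_def)
  show "open (snd d ` (fst c \<inter> fst d))" if "d \<in> A" for d
    using A assms that by (auto simp: smooth_atlas_def Int_commute)
qed

lemma mopen_carrier: "mopen A (carrier A)"
  using openin_manifold_topology[OF A] topspace_manifold_topology[OF A] openin_topspace by metis

lemma smooth_transition:
  assumes "c \<in> A" "d \<in> A"
  shows "open (snd c ` (fst c \<inter> fst d))" "smooth_on (snd c ` (fst c \<inter> fst d)) (transition c d)"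
  using A assms by (auto simp: smooth_atlas_def)

lemma transition_has_derivative:
  assumes "c \<in> charts_at A p" "d \<in> charts_at A p"
  shows "(transition c d has_derivative transition_deriv c d p) (at (snd c p))"
  unfolding transition_deriv_def
  by (rule smooth_on_has_derivative[OF smooth_transition(2)]) (use assms in \<open>auto simp: charts_at_def\<close>)

lemma linear_transition_deriv:
  "c \<in> charts_at A p \<Longrightarrow> d \<in> charts_at A p \<Longrightarrow> linear (transition_deriv c d p)"
  using transition_has_derivative has_derivative_linear by blast

lemma transition_deriv_refl:
  assumes "c \<in> charts_at A p"
  shows "transition_deriv c c p v = v"
proof -
  have c: "c \<in> A" "p \<in> fst c" using assms by (auto simp: charts_at_def)
  have "(transition c c has_derivative (\<lambda>v. v)) (at (snd c p))"
    by (rule has_derivative_transform_within_open[OF has_derivative_ident smooth_transition(1)[OF c(1) c(1)]])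
      (use c in \<open>auto simp: transition_apply\<close>)
  then show ?thesis using has_derivative_unique[OF transition_has_derivative[OF assms assms]] by metis
qed

lemma transition_deriv_trans:
  assumes "c \<in> charts_at A p" "d \<in> charts_at A p" "e \<in> charts_at A p"
  shows "transition_deriv d e p (transition_deriv c d p v) = transition_deriv c e p v"
proof -
  have c: "c \<in> A" "p \<in> fst c" and d: "d \<in> A" "p \<in> fst d" and e: "e \<in> A" "p \<in> fst e"
    using assms by (auto simp: charts_at_def)
  have "((\<lambda>x. transition d e (transition c d x)) has_derivative (\<lambda>v. transition_deriv d e p (transition_deriv c d p v))) (at (snd c p))"
    using has_derivative_compose[OF transition_has_derivative[OF assms(1,2)], of "transition d e" "transition_deriv d e p"]
      transition_has_derivative[OF assms(2,3)] transition_apply[OF c, of d] by simp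
  then have "(transition c e has_derivative (\<lambda>v. transition_deriv d e p (transition_deriv c d p v))) (at (snd c p))"
    by (rule has_derivative_transform_within_open[OF _ smooth_transition(1)[OF c(1) d(1)]])
      (use c d in \<open>auto simp: transition_apply\<close>)
  then show ?thesis using has_derivative_unique[OF transition_has_derivative[OF assms(1,3)]] by metis
qed

lemma tangent_transition:
  "v \<in> tangent_space A p \<Longrightarrow> c \<in> charts_at A p \<Longrightarrow> d \<in> charts_at A p \<Longrightarrow> v d = transition_deriv c d p (v c)"
  unfolding tangent_space_def transition_deriv_def by blast

lemma tangent_outside: "v \<in> tangent_space A p \<Longrightarrow> c \<notin> charts_at A p \<Longrightarrow> v c = 0"
  unfolding tangent_space_def by blast

lemma tangent_eqI:
  assumes "v \<in> tangent_space A p" "w \<in> tangent_space A p" "c \<in> charts_at A p" "v c = w c"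
  shows "v = w"
proof
  fix d show "v d = w d"
    using assms tangent_transition[OF assms(1,3), of d] tangent_transition[OF assms(2,3), of d]
      tangent_outside[OF assms(1), of d] tangent_outside[OF assms(2), of d]
    by (cases "d \<in> charts_at A p") auto
qed

lemma tangent_lincomb:
  assumes "v \<in> tangent_space A p" "w \<in> tangent_space A p"
  shows "(\<lambda>c. a *\<^sub>R v c + b *\<^sub>R w c) \<in> tangent_space A p"
  unfolding tangent_space_def
proof (intro CollectI conjI allI ballI impI)
  fix c d assume cd: "c \<in> charts_at A p" "d \<in> charts_at A p"
  have "linear (frechet_derivative (transition c d) (at (snd c p)))"
    using linear_transition_deriv[OF cd] by (simp add: transition_deriv_def)
  then show "a *\<^sub>R v d + b *\<^sub>R w d = frechet_derivative (transition c d) (at (snd c p)) (a *\<^sub>R v c + b *\<^sub>R w c)"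
    using tangent_transition[OF assms(1) cd] tangent_transition[OF assms(2) cd]
    by (simp add: transition_deriv_def linear_add linear_cmul)
qed (simp add: tangent_outside[OF assms(1)] tangent_outside[OF assms(2)])

lemma tangent_zero: "(\<lambda>_. 0) \<in> tangent_space A p"
  unfolding tangent_space_def
  using linear_transition_deriv by (auto simp: transition_deriv_def linear_0)

lemma coord_field_apply:
  "c \<in> charts_at A p \<Longrightarrow> d \<in> charts_at A p \<Longrightarrow> coord_field A c e p d = transition_deriv c d p e"
  by (simp add: coord_field_def transition_deriv_def)

lemma coord_field_self: "c \<in> charts_at A p \<Longrightarrow> coord_field A c e p c = e"
  by (simp add: coord_field_apply transition_deriv_refl)

lemma coord_field_tangent:
  "c \<in> charts_at A p \<Longrightarrow> coord_field A c e p \<in> tangent_space A p"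
  unfolding tangent_space_def
  by (auto simp: coord_field_apply transition_deriv_trans simp flip: transition_deriv_def) (simp add: coord_field_def)

lemma coord_field_of_tangent:
  "v \<in> tangent_space A p \<Longrightarrow> c \<in> charts_at A p \<Longrightarrow> coord_field A c (v c) p = v"
  by (rule tangent_eqI[of _ p _ c]) (simp_all add: coord_field_tangent coord_field_self)

lemma coord_field_lincomb:
  "c \<in> charts_at A p \<Longrightarrow> coord_field A c (a *\<^sub>R x + b *\<^sub>R y) p = (\<lambda>d. a *\<^sub>R coord_field A c x p d + b *\<^sub>R coord_field A c y p d)"
  by (rule tangent_eqI[of _ p _ c]) (simp_all add: coord_field_tangent coord_field_self tangent_lincomb)

text \<open>On a set inside one chart domain, smoothness in that chart suffices, since transition maps are
  smooth.\<close>

lemma smooth_mapI_chart: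
  assumes c: "c \<in> A" and W: "mopen A W" "W \<subseteq> fst c" and g: "smooth_on (snd c ` W) (\<lambda>x. g (chart_inv c x))"
  shows "smooth_map A W g"
  unfolding smooth_map_def
proof
  fix d assume d: "d \<in> A"
  have op: "open (snd d ` (W \<inter> fst d))" by (rule open_chart_image[OF W(1) d])
  have "smooth_on (snd d ` (W \<inter> fst d)) (\<lambda>x. g (chart_inv c (transition d c x)))"
  proof (rule smooth_on_compose[OF op g])
    show "smooth_on (snd d ` (W \<inter> fst d)) (transition d c)"
      by (rule smooth_on_subset[OF smooth_transition(2)[OF d c]]) (use W in auto)
    show "transition d c ` snd d ` (W \<inter> fst d) \<subseteq> snd c ` W"
      using W by (auto simp: transition_apply[OF d])
  qed
  moreover have "g (chart_inv c (transition d c x)) = g (chart_inv d x)" if "x \<in> snd d ` (W \<inter> fst d)" for x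
    using that W c d by (auto simp: transition_apply chart_inv_left subset_iff)
  ultimately show "smooth_on (snd d ` (W \<inter> fst d)) (\<lambda>x. g (chart_inv d x))"
    using smooth_on_cong[OF op, of "\<lambda>x. g (chart_inv c (transition d c x))" "\<lambda>x. g (chart_inv d x)"] by simp
qed

text \<open>The chain rule for the transition map makes the derivative independent of the chart that the
  definition picks, so that every chart may be used to compute it.\<close>

lemma deriv_along_has_derivative:
  assumes g: "mopen A W" "smooth_map A W g" "p \<in> W" and X: "X \<in> tangent_space A p" and c: "c \<in> charts_at A p"
  shows "((\<lambda>x. g (chart_inv c x)) has_derivative (\<lambda>v. deriv_along A p (coord_field A c v p) g)) (at (snd c p))"
    and "deriv_along A p X g = frechet_derivative (\<lambda>x. g (chart_inv c x)) (at (snd c p)) (X c)"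
proof -
  define d where "d = (SOME c. c \<in> charts_at A p)"
  have d: "d \<in> charts_at A p" unfolding d_def by (rule some_chart) (use c in \<open>auto simp: charts_at_def carrier_def\<close>)
  have cA: "c \<in> A" "p \<in> fst c" and dA: "d \<in> A" "p \<in> fst d" using c d by (auto simp: charts_at_def)
  let ?gd = "\<lambda>x. g (chart_inv d x)" and ?gc = "\<lambda>x. g (chart_inv c x)"
  let ?D = "frechet_derivative ?gd (at (snd d p))"
  have "(?gd has_derivative ?D) (at (snd d p))"
    by (rule smooth_on_has_derivative[of "snd d ` (W \<inter> fst d)"]) (use g dA in \<open>auto simp: smooth_map_def\<close>)
  then have D0: "((\<lambda>x. ?gd (transition c d x)) has_derivative (\<lambda>v. ?D (transition_deriv c d p v))) (at (snd c p))"
    using has_derivative_compose[OF transition_has_derivative[OF c d], of ?gd ?D] transition_apply[OF cA, of d] by simp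
  have eq: "g (chart_inv d (transition c d x)) = g (chart_inv c x)" if "x \<in> snd c ` (fst c \<inter> fst d)" for x
    using that cA dA by (auto simp: transition_apply chart_inv_left)
  have D: "(?gc has_derivative (\<lambda>v. ?D (transition_deriv c d p v))) (at (snd c p))"
    by (rule has_derivative_transform_within_open[OF D0 smooth_transition(1)[OF cA(1) dA(1)] _ eq]) (use cA dA in auto)
  then show "(?gc has_derivative (\<lambda>v. deriv_along A p (coord_field A c v p) g)) (at (snd c p))"
    by (simp add: deriv_along_def coord_field_apply[OF c d] flip: d_def)
  show "deriv_along A p X g = frechet_derivative ?gc (at (snd c p)) (X c)"
    by (simp add: deriv_along_def tangent_transition[OF X c d] frechet_derivative_at[OF D, symmetric] flip: d_def)
qed

lemma deriv_along_chart:
  assumes c: "c \<in> charts_at A p" and X: "X \<in> tangent_space A p"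
  shows "smooth_map A (fst c) (snd c)" and "deriv_along A p X (snd c) = X c"
proof -
  have cA: "c \<in> A" "p \<in> fst c" using c by (auto simp: charts_at_def)
  have op: "open (snd c ` fst c)" using A cA by (simp add: smooth_atlas_def)
  have eq: "x = snd c (chart_inv c x)" if "x \<in> snd c ` fst c" for x
    using that by (auto simp: chart_inv_left[OF cA(1)])
  show sm: "smooth_map A (fst c) (snd c)"
  proof (rule smooth_mapI_chart[OF cA(1) mopen_chart[OF cA(1)] order_refl])
    show "smooth_on (snd c ` fst c) (\<lambda>x. snd c (chart_inv c x))"
      using smooth_on_cong[OF op, of "\<lambda>x. x" "\<lambda>x. snd c (chart_inv c x)", OF eq] smooth_on_id[OF op] by simp
  qed
  have "frechet_derivative (\<lambda>x. x) (at (snd c p)) = frechet_derivative (\<lambda>x. snd c (chart_inv c x)) (at (snd c p))"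
    by (rule frechet_derivative_cong_open(1)[OF op _ eq]) (use cA in auto)
  moreover have "frechet_derivative (\<lambda>x. x) (at (snd c p)) = (\<lambda>v. v)"
    by (rule frechet_derivative_at[OF has_derivative_ident, symmetric])
  ultimately show "deriv_along A p X (snd c) = X c"
    using deriv_along_has_derivative(2)[OF mopen_chart[OF cA(1)] sm cA(2) X c] by metis
qed

lemma deriv_along_cong:
  assumes "mopen A W" "p \<in> W" "\<And>q. q \<in> W \<Longrightarrow> f q = g q"
  shows "deriv_along A p X f = deriv_along A p X g"
proof -
  define d where "d = (SOME c. c \<in> charts_at A p)"
  have "d \<in> charts_at A p" unfolding d_def by (rule some_chart) (use assms in \<open>auto simp: mopen_def\<close>)
  then have d: "d \<in> A" "p \<in> fst d" by (auto simp: charts_at_def)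
  have "frechet_derivative (\<lambda>x. f (chart_inv d x)) (at (snd d p)) = frechet_derivative (\<lambda>x. g (chart_inv d x)) (at (snd d p))"
    by (rule frechet_derivative_cong_open(1)[OF open_chart_image[OF assms(1) d(1)]])
      (use assms d in \<open>auto simp: chart_inv_left\<close>)
  then show ?thesis by (simp add: deriv_along_def flip: d_def)
qed

lemma deriv_along_lincomb:
  assumes "mopen A W" "smooth_map A W g" "p \<in> W" "X \<in> tangent_space A p" "Y \<in> tangent_space A p"
  shows "deriv_along A p (\<lambda>c. a *\<^sub>R X c + b *\<^sub>R Y c) g = a *\<^sub>R deriv_along A p X g + b *\<^sub>R deriv_along A p Y g"
proof -
  obtain c where c: "c \<in> charts_at A p" using assms by (auto simp: mopen_def charts_at_def carrier_def)
  then have "linear (frechet_derivative (\<lambda>x. g (chart_inv c x)) (at (snd c p)))"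
    using assms smooth_on_linear_derivative[of "snd c ` (W \<inter> fst c)"] by (auto simp: smooth_map_def charts_at_def)
  then show ?thesis
    using assms deriv_along_has_derivative(2)[OF assms(1-3) _ c] by (simp add: tangent_lincomb linear_add linear_cmul)
qed

lemma smooth_map_has_derivative:
  assumes "smooth_map A W g" "p \<in> W" "c \<in> charts_at A p"
  shows "((\<lambda>x. g (chart_inv c x)) has_derivative frechet_derivative (\<lambda>x. g (chart_inv c x)) (at (snd c p))) (at (snd c p))"
  by (rule smooth_on_has_derivative[of "snd c ` (W \<inter> fst c)"])
    (use assms in \<open>auto simp: smooth_map_def charts_at_def\<close>)

lemma some_chart_mopen: "mopen A W \<Longrightarrow> p \<in> W \<Longrightarrow> (SOME c. c \<in> charts_at A p) \<in> charts_at A p"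
  by (rule some_chart) (auto simp: mopen_def)

lemma deriv_along_bounded_linear:
  assumes "mopen A W" "smooth_map A W g" "p \<in> W" "bounded_linear L"
  shows "deriv_along A p X (\<lambda>q. L (g q)) = L (deriv_along A p X g)"
  using bounded_linear.has_derivative[OF assms(4) smooth_map_has_derivative[OF assms(2,3) some_chart_mopen[OF assms(1,3)]]]
  by (simp add: deriv_along_def Let_def frechet_derivative_at[symmetric])

lemma deriv_along_bounded_bilinear:
  assumes "mopen A W" "smooth_map A W f" "smooth_map A W g" "p \<in> W" "bounded_bilinear B"
  shows "deriv_along A p X (\<lambda>q. B (f q) (g q)) = B (f p) (deriv_along A p X g) + B (deriv_along A p X f) (g p)"
proof -
  let ?d = "SOME c. c \<in> charts_at A p"
  have d: "?d \<in> charts_at A p" by (rule some_chart_mopen[OF assms(1,4)])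
  then have "chart_inv ?d (snd ?d p) = p" by (simp add: charts_at_def chart_inv_left)
  then show ?thesis
    using bounded_bilinear.FDERIV[OF assms(5) smooth_map_has_derivative[OF assms(2,4) d] smooth_map_has_derivative[OF assms(3,4) d]]
    by (simp add: deriv_along_def Let_def frechet_derivative_at[symmetric])
qed

lemma deriv_along_add:
  assumes "mopen A W" "smooth_map A W f" "smooth_map A W g" "p \<in> W"
  shows "deriv_along A p X (\<lambda>q. f q + g q) = deriv_along A p X f + deriv_along A p X g"
  using has_derivative_add[OF smooth_map_has_derivative[OF assms(2,4)] smooth_map_has_derivative[OF assms(3,4)],
      OF some_chart_mopen some_chart_mopen, OF assms(1,4) assms(1,4)]
  by (simp add: deriv_along_def Let_def frechet_derivative_at[symmetric])

lemma deriv_along_const: "deriv_along A p X (\<lambda>q. k) = 0"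
  by (simp add: deriv_along_def)

lemma smooth_map_const: "smooth_map A W (\<lambda>q. k)"
  by (simp add: smooth_map_def smooth_on_const)

lemma smooth_map_bounded_linear:
  "mopen A W \<Longrightarrow> bounded_linear L \<Longrightarrow> smooth_map A W f \<Longrightarrow> smooth_map A W (\<lambda>q. L (f q))"
  unfolding smooth_map_def
  by (intro ballI, rule smooth_on_bounded_linear[OF open_chart_image], assumption+, blast+)

lemma smooth_map_diff:
  "mopen A W \<Longrightarrow> smooth_map A W f \<Longrightarrow> smooth_map A W g \<Longrightarrow> smooth_map A W (\<lambda>q. f q - g q)"
  unfolding smooth_map_def
  by (intro ballI, rule smooth_on_diff[OF open_chart_image], assumption+, blast+)

lemma smooth_map_deriv_along:
  assumes "mopen A W" "smooth_map A W g" "smooth_vector_field A W X"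
  shows "smooth_map A W (\<lambda>p. deriv_along A p (X p) g)"
  unfolding smooth_map_def
proof
  fix c assume c: "c \<in> A"
  let ?S = "snd c ` (W \<inter> fst c)"
  have op: "open ?S" by (rule open_chart_image[OF assms(1) c])
  have "smooth_on ?S (\<lambda>x. frechet_derivative (\<lambda>x. g (chart_inv c x)) (at x) (X (chart_inv c x) c))"
    by (rule smooth_on_derivative_apply[OF op]) (use assms c in \<open>auto simp: smooth_map_def smooth_vector_field_def\<close>)
  moreover have "deriv_along A (chart_inv c x) (X (chart_inv c x)) g
      = frechet_derivative (\<lambda>x. g (chart_inv c x)) (at x) (X (chart_inv c x) c)" if "x \<in> ?S" for x
    using deriv_along_has_derivative(2)[OF assms(1,2), of "chart_inv c x" "X (chart_inv c x)" c]
      chart_inv_mem[OF c that] c assms(3) by (simp add: smooth_vector_field_def charts_at_def)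
  ultimately show "smooth_on ?S (\<lambda>x. deriv_along A (chart_inv c x) (X (chart_inv c x)) g)"
    using smooth_on_cong[OF op, of "\<lambda>x. deriv_along A (chart_inv c x) (X (chart_inv c x)) g"] by simp
qed

lemma smooth_map_component:
  assumes W: "mopen A W" and Y: "smooth_vector_field A W Y" and c: "c \<in> A"
  shows "smooth_map A (W \<inter> fst c) (\<lambda>p. Y p c)"
proof (rule smooth_mapI_chart[OF c mopen_Int[OF W mopen_chart[OF c]]])
  show "smooth_on (snd c ` (W \<inter> fst c)) (\<lambda>x. Y (chart_inv c x) c)"
    using Y c by (simp add: smooth_vector_field_def)
qed simp

text \<open>The components in another chart arise by applying the derivative of the transition map,
  which is smooth in the base point.\<close>

lemma smooth_vector_fieldI_chart:
  assumes c: "c \<in> A" and W: "mopen A W" "W \<subseteq> fst c" and T: "\<And>p. p \<in> W \<Longrightarrow> Y p \<in> tangent_space A p"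
    and g: "smooth_on (snd c ` W) (\<lambda>x. Y (chart_inv c x) c)"
  shows "smooth_vector_field A W Y"
  unfolding smooth_vector_field_def
proof (intro conjI ballI T)
  fix d assume d: "d \<in> A"
  let ?S = "snd d ` (W \<inter> fst d)"
  have op: "open ?S" by (rule open_chart_image[OF W(1) d])
  have "smooth_on ?S (\<lambda>x. Y (chart_inv d x) c)"
    using smooth_mapI_chart[OF c W, of "\<lambda>p. Y p c"] g d by (simp add: smooth_map_def)
  moreover have "smooth_on (transition d c ` ?S) (\<lambda>y. frechet_derivative (transition c d) (at y) b)" for b
    by (rule smooth_on_derivative, rule smooth_on_subset[OF smooth_transition(2)[OF c d]])
      (use W in \<open>auto simp: transition_apply[OF d]\<close>)
  then have "smooth_on ?S (\<lambda>x. frechet_derivative (transition c d) (at (transition d c x)) b)" for b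
    by (rule smooth_on_compose[OF op _ smooth_on_subset[OF smooth_transition(2)[OF d c]] order_refl]) (use W in auto)
  ultimately have "smooth_on ?S (\<lambda>x. \<Sum>b\<in>Basis. (Y (chart_inv d x) c \<bullet> b) *\<^sub>R frechet_derivative (transition c d) (at (transition d c x)) b)"
    by (intro smooth_on_sum smooth_on_scaleR smooth_on_inner smooth_on_const op)
  moreover have "Y (chart_inv d x) d = (\<Sum>b\<in>Basis. (Y (chart_inv d x) c \<bullet> b) *\<^sub>R frechet_derivative (transition c d) (at (transition d c x)) b)"
    if "x \<in> ?S" for x
  proof -
    let ?p = "chart_inv d x"
    note p = chart_inv_mem[OF d that]
    have ch: "c \<in> charts_at A ?p" "d \<in> charts_at A ?p" using p W c d by (auto simp: charts_at_def)
    note lin = linear_transition_deriv[OF ch]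
    have tr: "transition d c x = snd c ?p" using transition_apply[OF d p(2), of c] p(3) by simp
    have "Y ?p d = transition_deriv c d ?p (\<Sum>b\<in>Basis. (Y ?p c \<bullet> b) *\<^sub>R b)"
      using tangent_transition[OF T ch] p(1) by (simp add: euclidean_representation)
    also have "\<dots> = (\<Sum>b\<in>Basis. (Y ?p c \<bullet> b) *\<^sub>R transition_deriv c d ?p b)"
      by (simp add: linear_sum[OF lin] linear_cmul[OF lin])
    finally show ?thesis by (simp add: tr transition_deriv_def)
  qed
  ultimately show "smooth_on ?S (\<lambda>x. Y (chart_inv d x) d)"
    using smooth_on_cong[OF op, of "\<lambda>x. Y (chart_inv d x) d"] by simp
qed

lemma smooth_coord_field:
  assumes "c \<in> A" shows "smooth_vector_field A (fst c) (coord_field A c e)"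
proof (rule smooth_vector_fieldI_chart[OF assms mopen_chart[OF assms] order_refl])
  show "coord_field A c e p \<in> tangent_space A p" if "p \<in> fst c" for p
    by (rule coord_field_tangent) (use that assms in \<open>simp add: charts_at_def\<close>)
  have "open (snd c ` fst c)" using A assms by (simp add: smooth_atlas_def)
  moreover have "coord_field A c e (chart_inv c x) c = e" if "x \<in> snd c ` fst c" for x
    by (rule coord_field_self) (use that assms in \<open>auto simp: charts_at_def chart_inv_left\<close>)
  ultimately show "smooth_on (snd c ` fst c) (\<lambda>x. coord_field A c e (chart_inv c x) c)"
    using smooth_on_cong[of "snd c ` fst c" "\<lambda>x. coord_field A c e (chart_inv c x) c" "\<lambda>x. e"] smooth_on_const by simp
qed

lemma curve_chart:
  assumes "smooth_curve A I \<gamma>" "c \<in> A"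
  shows "open {t \<in> I. \<gamma> t \<in> fst c}" "smooth_on {t \<in> I. \<gamma> t \<in> fst c} (\<lambda>t. snd c (\<gamma> t))"
  using assms by (auto simp: smooth_curve_def comp_def)

lemma curve_has_vector_derivative:
  assumes "smooth_curve A I \<gamma>" "t \<in> I" "c \<in> charts_at A (\<gamma> t)"
  shows "((\<lambda>s. snd c (\<gamma> s)) has_vector_derivative velocity A \<gamma> t c) (at t)"
proof -
  have "((\<lambda>s. snd c (\<gamma> s)) has_vector_derivative vector_derivative (\<lambda>s. snd c (\<gamma> s)) (at t)) (at t)"
    by (rule smooth_on_has_vector_derivative[OF curve_chart(2)[OF assms(1)]]) (use assms in \<open>auto simp: charts_at_def\<close>)
  then show ?thesis using assms(3) by (simp add: velocity_def comp_def)
qed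

lemma velocity_tangent:
  assumes "smooth_curve A I \<gamma>" "t \<in> I"
  shows "velocity A \<gamma> t \<in> tangent_space A (\<gamma> t)"
  unfolding tangent_space_def
proof (intro CollectI conjI allI ballI impI)
  fix c d assume c: "c \<in> charts_at A (\<gamma> t)" and d: "d \<in> charts_at A (\<gamma> t)"
  have cA: "c \<in> A" "d \<in> A" "\<gamma> t \<in> fst c" "\<gamma> t \<in> fst d" using c d by (auto simp: charts_at_def)
  let ?J = "{s \<in> I. \<gamma> s \<in> fst c}"
  have "((\<lambda>s. transition c d (snd c (\<gamma> s))) has_vector_derivative transition_deriv c d (\<gamma> t) (velocity A \<gamma> t c)) (at t)"
    using vector_derivative_diff_chain_within[OF curve_has_vector_derivative[OF assms c]
        has_derivative_at_withinI[OF transition_has_derivative[OF c d]]] by (simp add: comp_def)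
  then have "((\<lambda>s. snd d (\<gamma> s)) has_vector_derivative transition_deriv c d (\<gamma> t) (velocity A \<gamma> t c)) (at t)"
    by (rule has_vector_derivative_transform_within_open[OF _ curve_chart(1)[OF assms(1) cA(1)]])
      (use assms(2) cA in \<open>auto simp: transition_apply\<close>)
  then show "velocity A \<gamma> t d = frechet_derivative (transition c d) (at (snd c (\<gamma> t))) (velocity A \<gamma> t c)"
    using vector_derivative_unique_at[OF curve_has_vector_derivative[OF assms d]] by (simp add: transition_deriv_def)
qed (simp add: velocity_def)

text \<open>A derivative along a tangent vector can be computed along any curve with this velocity.
  Several identities on the frame bundle are derived in this way, without second derivatives of transition maps.\<close>

lemma curve_compose_has_vector_derivative:
  assumes \<gamma>: "smooth_curve A I \<gamma>" "t \<in> I" and g: "mopen A W" "smooth_map A W g" "\<gamma> t \<in> W"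
  shows "((\<lambda>s. g (\<gamma> s)) has_vector_derivative deriv_along A (\<gamma> t) (velocity A \<gamma> t) g) (at t)"
proof -
  obtain c where c: "c \<in> charts_at A (\<gamma> t)" using g by (auto simp: mopen_def charts_at_def carrier_def)
  then have cA: "c \<in> A" "\<gamma> t \<in> fst c" by (auto simp: charts_at_def)
  note vt = velocity_tangent[OF \<gamma>]
  have "((\<lambda>s. g (chart_inv c (snd c (\<gamma> s)))) has_vector_derivative deriv_along A (\<gamma> t) (velocity A \<gamma> t) g) (at t)"
    using vector_derivative_diff_chain_within[OF curve_has_vector_derivative[OF \<gamma> c]
        has_derivative_at_withinI[OF deriv_along_has_derivative(1)[OF g vt c]]]
    by (simp add: comp_def coord_field_of_tangent[OF vt c])
  then show ?thesis
    by (rule has_vector_derivative_transform_within_open[OF _ curve_chart(1)[OF \<gamma>(1) cA(1)]])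
      (use \<gamma>(2) cA in \<open>auto simp: chart_inv_left\<close>)
qed

lemma smooth_on_curve_compose:
  assumes \<gamma>: "smooth_curve A I \<gamma>" and c: "c \<in> A" and g: "smooth_map A W g" "fst c \<subseteq> W"
  shows "smooth_on {t \<in> I. \<gamma> t \<in> fst c} (\<lambda>t. g (\<gamma> t))"
proof -
  let ?J = "{t \<in> I. \<gamma> t \<in> fst c}"
  have "W \<inter> fst c = fst c" using g by auto
  then have "smooth_on (snd c ` fst c) (\<lambda>x. g (chart_inv c x))" using bspec[OF g(1)[unfolded smooth_map_def] c] by simp
  from smooth_on_compose[OF curve_chart(1)[OF \<gamma> c] this curve_chart(2)[OF \<gamma> c]]
  have "smooth_on ?J (\<lambda>t. g (chart_inv c (snd c (\<gamma> t))))" by auto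
  then show ?thesis
    using smooth_on_cong[OF curve_chart(1)[OF \<gamma> c], of "\<lambda>t. g (chart_inv c (snd c (\<gamma> t)))" "\<lambda>t. g (\<gamma> t)"] chart_inv_left[OF c] by simp
qed

end

section \<open>Linear connections in charts\<close>

text \<open>The term of order zero of the connection in the chart \<open>c\<close>: for \<open>X\<close> and \<open>v\<close> in the coordinate basis,
  the components of the value are Christoffel symbols.\<close>

definition christoffel ::
    "('a, 'e::euclidean_space) atlas \<Rightarrow> ('a, 'e) covd \<Rightarrow> ('a, 'e) chart \<Rightarrow> 'a \<Rightarrow> ('a, 'e) tvec \<Rightarrow> 'e \<Rightarrow> 'e" where
  "christoffel A D c p X v = (\<Sum>b\<in>Basis. (v \<bullet> b) *\<^sub>R D p X (coord_field A c b) c)"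

lemma linear_christoffel: "linear (christoffel A D c p X)"
  unfolding christoffel_def
  by (rule linearI) (simp_all add: inner_add_left scaleR_left_distrib sum.distrib scaleR_sum_right)

lemma has_vector_derivative_frame_expansion:
  fixes v :: "real \<Rightarrow> 'e::euclidean_space" and g :: "'e \<Rightarrow> real \<Rightarrow> 'f::real_normed_vector"
  assumes "(v has_vector_derivative v') (at t)"
    and "\<And>b. b \<in> Basis \<Longrightarrow> (g b has_vector_derivative g' b) (at t)"
  shows "((\<lambda>s. \<Sum>b\<in>Basis. (v s \<bullet> b) *\<^sub>R g b s) has_vector_derivative
     (\<Sum>b\<in>Basis. (v' \<bullet> b) *\<^sub>R g b t) + (\<Sum>b\<in>Basis. (v t \<bullet> b) *\<^sub>R g' b)) (at t)"
proof -
  have "((\<lambda>s. v s \<bullet> b) has_vector_derivative v' \<bullet> b) (at t)" for b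
    by (rule bounded_linear.has_vector_derivative[OF bounded_linear_inner_left assms(1)])
  then have "((\<lambda>s. \<Sum>b\<in>Basis. (v s \<bullet> b) *\<^sub>R g b s) has_vector_derivative
     (\<Sum>b\<in>Basis. (v t \<bullet> b) *\<^sub>R g' b + (v' \<bullet> b) *\<^sub>R g b t)) (at t)"
    by (intro has_vector_derivative_sum bounded_bilinear.has_vector_derivative[OF bounded_bilinear_scaleR] assms(2))
  then show ?thesis by (simp add: sum.distrib add.commute)
qed

context
  fixes A :: "('a, 'e::euclidean_space) atlas"
  assumes A: "smooth_atlas A"
begin

lemma smooth_vector_field_add:
  assumes "mopen A W" "smooth_vector_field A W Y" "smooth_vector_field A W Z"
  shows "smooth_vector_field A W (\<lambda>q c. Y q c + Z q c)"
  unfolding smooth_vector_field_def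
proof (intro conjI ballI)
  show "(\<lambda>c. Y p c + Z p c) \<in> tangent_space A p" if "p \<in> W" for p
    using tangent_lincomb[OF A, of "Y p" p "Z p" 1 1] assms that by (simp add: smooth_vector_field_def)
  show "smooth_on (snd c ` (W \<inter> fst c)) (\<lambda>x. Y (chart_inv c x) c + Z (chart_inv c x) c)" if "c \<in> A" for c
    by (rule smooth_on_add[OF open_chart_image[OF A assms(1) that]])
      (use assms that in \<open>simp_all add: smooth_vector_field_def\<close>)
qed

lemma smooth_vector_field_scaleR:
  assumes "mopen A W" "smooth_vector_field A W Y" "smooth_map A W f"
  shows "smooth_vector_field A W (\<lambda>q c. f q *\<^sub>R Y q c)"
  unfolding smooth_vector_field_def
proof (intro conjI ballI)
  show "(\<lambda>c. f p *\<^sub>R Y p c) \<in> tangent_space A p" if "p \<in> W" for p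
    using tangent_lincomb[OF A, of "Y p" p "Y p" "f p" 0] assms that by (simp add: smooth_vector_field_def)
  show "smooth_on (snd c ` (W \<inter> fst c)) (\<lambda>x. f (chart_inv c x) *\<^sub>R Y (chart_inv c x) c)" if "c \<in> A" for c
    by (rule smooth_on_scaleR[OF open_chart_image[OF A assms(1) that]])
      (use assms that in \<open>simp_all add: smooth_vector_field_def smooth_map_def\<close>)
qed

lemma smooth_vector_field_zero: "smooth_vector_field A W (\<lambda>q c. 0)"
  by (simp add: smooth_vector_field_def tangent_zero[OF A] smooth_on_const)

context
  fixes D :: "('a, 'e) covd"
  assumes D: "linear_connection A D"
begin

lemma covd_local:
  "mopen A W \<Longrightarrow> smooth_vector_field A W Y \<Longrightarrow> p \<in> W \<Longrightarrow> X \<in> tangent_space A p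
    \<Longrightarrow> (\<And>q. q \<in> W \<Longrightarrow> Z q = Y q) \<Longrightarrow> D p X Z = D p X Y"
  using D unfolding linear_connection_def by blast

lemma covd_tangent:
  "mopen A W \<Longrightarrow> smooth_vector_field A W Y \<Longrightarrow> p \<in> W \<Longrightarrow> X \<in> tangent_space A p \<Longrightarrow> D p X Y \<in> tangent_space A p"
  using D unfolding linear_connection_def by blast

lemma covd_lincomb:
  "mopen A W \<Longrightarrow> smooth_vector_field A W Y \<Longrightarrow> p \<in> W \<Longrightarrow> X \<in> tangent_space A p \<Longrightarrow> X' \<in> tangent_space A p
    \<Longrightarrow> D p (\<lambda>c. a *\<^sub>R X c + b *\<^sub>R X' c) Y = (\<lambda>c. a *\<^sub>R D p X Y c + b *\<^sub>R D p X' Y c)"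
  using D unfolding linear_connection_def by blast

lemma covd_add:
  "mopen A W \<Longrightarrow> smooth_vector_field A W Y \<Longrightarrow> smooth_vector_field A W Z \<Longrightarrow> p \<in> W \<Longrightarrow> X \<in> tangent_space A p
    \<Longrightarrow> D p X (\<lambda>q c. Y q c + Z q c) = (\<lambda>c. D p X Y c + D p X Z c)"
  using D unfolding linear_connection_def by blast

lemma covd_scaleR:
  "mopen A W \<Longrightarrow> smooth_vector_field A W Y \<Longrightarrow> smooth_map A W f \<Longrightarrow> p \<in> W \<Longrightarrow> X \<in> tangent_space A p
    \<Longrightarrow> D p X (\<lambda>q c. f q *\<^sub>R Y q c) = (\<lambda>c. deriv_along A p X f *\<^sub>R Y p c + f p *\<^sub>R D p X Y c)"
  using D unfolding linear_connection_def smooth_fun_eq_smooth_map dir_deriv_eq_deriv_along by blast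

lemma covd_smooth:
  "mopen A W \<Longrightarrow> smooth_vector_field A W Y \<Longrightarrow> smooth_vector_field A W X \<Longrightarrow> smooth_vector_field A W (\<lambda>p. D p (X p) Y)"
  using D unfolding linear_connection_def by blast

lemma covd_zero:
  assumes "mopen A W" "p \<in> W" "X \<in> tangent_space A p"
  shows "D p X (\<lambda>q c. 0) = (\<lambda>c. 0)"
  using covd_scaleR[OF assms(1) smooth_vector_field_zero smooth_map_const[OF A, where k=0] assms(2,3)]
  by (simp add: deriv_along_const[OF A])

text \<open>Near \<open>p\<close> the field is a combination of coordinate fields with smooth coefficients, and the Leibniz
  rule applies to each term.  Additivity is available for two fields only, hence the induction over
  subsets of the basis.\<close>

lemma covd_in_chart:
  assumes W: "mopen A W" and Y: "smooth_vector_field A W Y" and p: "p \<in> W" and X: "X \<in> tangent_space A p"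
    and c: "c \<in> charts_at A p"
  shows "D p X Y c = deriv_along A p X (\<lambda>q. Y q c) + christoffel A D c p X (Y p c)"
proof -
  have cA: "c \<in> A" "p \<in> fst c" using c by (auto simp: charts_at_def)
  let ?V = "W \<inter> fst c"
  have V: "mopen A ?V" "p \<in> ?V" using mopen_Int[OF A W mopen_chart[OF A cA(1)]] p cA by auto
  have comp: "smooth_map A ?V (\<lambda>q. Y q c)" by (rule smooth_map_component[OF A W Y cA(1)])
  have compb: "smooth_map A ?V (\<lambda>q. Y q c \<bullet> b)" for b
    by (rule smooth_map_bounded_linear[OF A V(1) bounded_linear_inner_left comp])
  have cf: "smooth_vector_field A ?V (coord_field A c b)" for b
    by (rule smooth_vector_field_subset[OF smooth_coord_field[OF A cA(1)]]) auto
  let ?Z = "\<lambda>S q d. \<Sum>b\<in>S. (Y q c \<bullet> b) *\<^sub>R coord_field A c b q d"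
  have "smooth_vector_field A ?V (?Z S) \<and>
    D p X (?Z S) c = (\<Sum>b\<in>S. deriv_along A p X (\<lambda>q. Y q c \<bullet> b) *\<^sub>R b + (Y p c \<bullet> b) *\<^sub>R D p X (coord_field A c b) c)"
    if "finite S" for S
    using that
  proof induction
    case empty
    then show ?case by (simp add: smooth_vector_field_zero covd_zero[OF V X])
  next
    case (insert b S)
    have sb: "smooth_vector_field A ?V (\<lambda>q d. (Y q c \<bullet> b) *\<^sub>R coord_field A c b q d)"
      by (rule smooth_vector_field_scaleR[OF V(1) cf compb])
    have "D p X (?Z (insert b S)) = (\<lambda>d. D p X (\<lambda>q d. (Y q c \<bullet> b) *\<^sub>R coord_field A c b q d) d + D p X (?Z S) d)"
      using covd_add[OF V(1) sb _ V(2) X, of "?Z S"] insert by simp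
    moreover have "smooth_vector_field A ?V (?Z (insert b S))"
      using smooth_vector_field_add[OF V(1) sb, of "?Z S"] insert by simp
    ultimately show ?case
      using insert covd_scaleR[OF V(1) cf compb V(2) X, of b b] coord_field_self[OF A c, of b] by simp
  qed
  from conjunct2[OF this[OF finite_Basis]]
  have "D p X (?Z Basis) c = (\<Sum>b\<in>Basis. deriv_along A p X (\<lambda>q. Y q c \<bullet> b) *\<^sub>R b) + christoffel A D c p X (Y p c)"
    by (simp add: sum.distrib christoffel_def)
  moreover have "(\<Sum>b\<in>Basis. deriv_along A p X (\<lambda>q. Y q c \<bullet> b) *\<^sub>R b) = deriv_along A p X (\<lambda>q. Y q c)"
    using deriv_along_bounded_linear[OF A V(1) comp V(2) bounded_linear_inner_left]
    by (simp add: euclidean_representation)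
  moreover have "?Z Basis q = Y q" if "q \<in> ?V" for q
  proof -
    have ch: "c \<in> charts_at A q" and T: "Y q \<in> tangent_space A q"
      using that cA Y by (auto simp: charts_at_def smooth_vector_field_def)
    have "?Z Basis q d = Y q d" for d
    proof (cases "d \<in> charts_at A q")
      case True
      note lin = linear_transition_deriv[OF A ch True]
      have "Y q d = transition_deriv c d q (\<Sum>b\<in>Basis. (Y q c \<bullet> b) *\<^sub>R b)"
        using tangent_transition[OF A T ch True] by (simp add: euclidean_representation)
      then show ?thesis by (simp add: coord_field_apply[OF A ch True] linear_sum[OF lin] linear_cmul[OF lin])
    next
      case False
      then show ?thesis using tangent_outside[OF A T False] by (simp add: coord_field_def)
    qed
    then show ?thesis by blast
  qed
  then have "D p X (?Z Basis) = D p X Y"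
    by (intro covd_local[OF V(1) smooth_vector_field_subset[OF Y] V(2) X]) auto
  ultimately show ?thesis by simp
qed

text \<open>The inhomogeneous transformation law.  It is the chart formula in \<open>d\<close> for a coordinate field of
  \<open>c\<close>; the first term on the right contains the second derivatives of the transition map.\<close>

lemma christoffel_transition:
  assumes X: "X \<in> tangent_space A p" and c: "c \<in> charts_at A p" and d: "d \<in> charts_at A p"
  shows "transition_deriv c d p (christoffel A D c p X v) =
    deriv_along A p X (\<lambda>q. coord_field A c v q d) + christoffel A D d p X (transition_deriv c d p v)"
proof -
  have cA: "c \<in> A" "p \<in> fst c" using c by (auto simp: charts_at_def)
  note W = mopen_chart[OF A cA(1)] smooth_coord_field[OF A cA(1), of v] cA(2)
  have "deriv_along A p X (\<lambda>q. coord_field A c v q c) = deriv_along A p X (\<lambda>q. v)"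
    by (rule deriv_along_cong[OF A W(1,3)]) (use cA in \<open>auto simp: coord_field_self[OF A] charts_at_def\<close>)
  then have "D p X (coord_field A c v) c = christoffel A D c p X v"
    using covd_in_chart[OF W X c] by (simp add: deriv_along_const[OF A] coord_field_self[OF A c])
  then show ?thesis
    using covd_in_chart[OF W X d] tangent_transition[OF A covd_tangent[OF W X] c d]
    by (simp add: coord_field_apply[OF A c d])
qed

lemma christoffel_lincomb:
  assumes "X \<in> tangent_space A p" "X' \<in> tangent_space A p" "c \<in> charts_at A p"
  shows "christoffel A D c p (\<lambda>d. a *\<^sub>R X d + b *\<^sub>R X' d) v = a *\<^sub>R christoffel A D c p X v + b *\<^sub>R christoffel A D c p X' v"
proof -
  have cA: "c \<in> A" "p \<in> fst c" using assms by (auto simp: charts_at_def)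
  show ?thesis
    unfolding christoffel_def covd_lincomb[OF mopen_chart[OF A cA(1)] smooth_coord_field[OF A cA(1)] cA(2) assms(1,2)]
    by (simp add: scaleR_right_distrib sum.distrib scaleR_sum_right scaleR_left_commute mult.commute)
qed

lemma smooth_map_christoffel:
  assumes c: "c \<in> A"
  shows "smooth_map A (fst c) (\<lambda>p. christoffel A D c p (coord_field A c e p) v)"
proof -
  have "smooth_map A (fst c) (\<lambda>p. D p (coord_field A c e p) (coord_field A c b) c)" for b
    using smooth_map_component[OF A mopen_chart[OF A c] covd_smooth[OF mopen_chart[OF A c] smooth_coord_field[OF A c] smooth_coord_field[OF A c]] c]
    by simp
  then show ?thesis
    unfolding smooth_map_def christoffel_def
    by (auto intro!: smooth_on_sum smooth_on_scaleR smooth_on_const open_chart_image[OF A mopen_chart[OF A c]])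
qed

text \<open>One chart suffices: when the chart is changed, the derivative of \<open>V\<close> acquires a term with second
  derivatives of the transition map, and this is the one by which the Christoffel terms differ.\<close>

lemma has_covd_alongI:
  assumes \<gamma>: "smooth_curve A I \<gamma>" "t \<in> I" and V: "\<And>s. s \<in> I \<Longrightarrow> V s \<in> tangent_space A (\<gamma> s)"
    and c: "c \<in> charts_at A (\<gamma> t)" and V': "((\<lambda>s. V s c) has_vector_derivative V') (at t)"
    and w: "w \<in> tangent_space A (\<gamma> t)" "w c = V' + christoffel A D c (\<gamma> t) (velocity A \<gamma> t) (V t c)"
  shows "has_covd_along A D \<gamma> V t w"
  unfolding has_covd_along_def
proof (intro conjI ballI w(1))
  fix d assume d: "d \<in> charts_at A (\<gamma> t)"
  have cA: "c \<in> A" "\<gamma> t \<in> fst c" and dA: "d \<in> A" "\<gamma> t \<in> fst d" using c d by (auto simp: charts_at_def)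
  let ?X = "velocity A \<gamma> t" and ?T = "transition_deriv c d (\<gamma> t)"
  note lin = linear_transition_deriv[OF A c d]
  let ?g' = "\<lambda>b. deriv_along A (\<gamma> t) ?X (\<lambda>q. coord_field A c b q d)"
  have g: "((\<lambda>s. coord_field A c b (\<gamma> s) d) has_vector_derivative ?g' b) (at t)" for b
    by (rule curve_compose_has_vector_derivative[OF A \<gamma> mopen_Int[OF A mopen_chart[OF A cA(1)] mopen_chart[OF A dA(1)]]
          smooth_map_component[OF A mopen_chart[OF A cA(1)] smooth_coord_field[OF A cA(1)] dA(1)]])
      (use cA dA in auto)
  have "((\<lambda>s. \<Sum>b\<in>Basis. (V s c \<bullet> b) *\<^sub>R coord_field A c b (\<gamma> s) d) has_vector_derivative
     (\<Sum>b\<in>Basis. (V' \<bullet> b) *\<^sub>R coord_field A c b (\<gamma> t) d) + (\<Sum>b\<in>Basis. (V t c \<bullet> b) *\<^sub>R ?g' b)) (at t)"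
    by (rule has_vector_derivative_frame_expansion[OF V' g])
  then have "((\<lambda>s. V s d) has_vector_derivative
     (\<Sum>b\<in>Basis. (V' \<bullet> b) *\<^sub>R coord_field A c b (\<gamma> t) d) + (\<Sum>b\<in>Basis. (V t c \<bullet> b) *\<^sub>R ?g' b)) (at t)"
  proof (rule has_vector_derivative_transform_within_open)
    show "open ({s \<in> I. \<gamma> s \<in> fst c} \<inter> {s \<in> I. \<gamma> s \<in> fst d})"
      using curve_chart(1)[OF A \<gamma>(1)] cA dA by blast
    fix s assume "s \<in> {s \<in> I. \<gamma> s \<in> fst c} \<inter> {s \<in> I. \<gamma> s \<in> fst d}"
    then have s: "s \<in> I" "c \<in> charts_at A (\<gamma> s)" "d \<in> charts_at A (\<gamma> s)"
      using cA dA by (auto simp: charts_at_def)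
    note lin = linear_transition_deriv[OF A s(2,3)]
    have "V s d = transition_deriv c d (\<gamma> s) (\<Sum>b\<in>Basis. (V s c \<bullet> b) *\<^sub>R b)"
      using tangent_transition[OF A V[OF s(1)] s(2,3)] by (simp add: euclidean_representation)
    then show "(\<Sum>b\<in>Basis. (V s c \<bullet> b) *\<^sub>R coord_field A c b (\<gamma> s) d) = V s d"
      by (simp add: coord_field_apply[OF A s(2,3)] linear_sum[OF lin] linear_cmul[OF lin])
  qed (use \<gamma> cA dA in auto)
  moreover have sumb: "f v = (\<Sum>b\<in>Basis. (v \<bullet> b) *\<^sub>R f b)" if "linear f" for f :: "'e \<Rightarrow> 'e" and v
    by (subst euclidean_representation[of v, symmetric]) (simp only: linear_sum[OF that] linear_cmul[OF that])
  have "w d = (\<Sum>b\<in>Basis. (V' \<bullet> b) *\<^sub>R coord_field A c b (\<gamma> t) d) + (\<Sum>b\<in>Basis. (V t c \<bullet> b) *\<^sub>R ?g' b)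
    + (\<Sum>b\<in>Basis. (V t d \<bullet> b) *\<^sub>R D (\<gamma> t) ?X (coord_field A d b) d)"
  proof -
    have "w d = ?T V' + ?T (christoffel A D c (\<gamma> t) ?X (V t c))"
      using tangent_transition[OF A w(1) c d] w(2) by (simp add: linear_add[OF lin])
    also have "?T (christoffel A D c (\<gamma> t) ?X (V t c)) = (\<Sum>b\<in>Basis. (V t c \<bullet> b) *\<^sub>R ?T (christoffel A D c (\<gamma> t) ?X b))"
      by (rule sumb) (use linear_compose[OF linear_christoffel lin] in \<open>simp add: comp_def\<close>)
    also have "\<dots> = (\<Sum>b\<in>Basis. (V t c \<bullet> b) *\<^sub>R ?g' b) + (\<Sum>b\<in>Basis. (V t c \<bullet> b) *\<^sub>R christoffel A D d (\<gamma> t) ?X (?T b))"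
      by (simp add: christoffel_transition[OF velocity_tangent[OF A \<gamma>] c d] scaleR_right_distrib sum.distrib)
    also have "(\<Sum>b\<in>Basis. (V t c \<bullet> b) *\<^sub>R christoffel A D d (\<gamma> t) ?X (?T b)) = christoffel A D d (\<gamma> t) ?X (?T (V t c))"
      by (rule sumb[symmetric]) (use linear_compose[OF lin linear_christoffel] in \<open>simp add: comp_def\<close>)
    also have "?T (V t c) = V t d" using tangent_transition[OF A V[OF \<gamma>(2)] c d] by simp
    finally show ?thesis using sumb[OF lin, of V'] by (simp add: coord_field_apply[OF A c d] christoffel_def)
  qed
  ultimately show "\<exists>V'. ((\<lambda>s. V s d) has_vector_derivative V') (at t) \<and>
      w d = V' + (\<Sum>b\<in>Basis. (V t d \<bullet> b) *\<^sub>R D (\<gamma> t) ?X (coord_field A d b) d)"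
    by blast
qed

lemma has_covd_along_chart:
  assumes "has_covd_along A D \<gamma> V t w" "c \<in> charts_at A (\<gamma> t)" "((\<lambda>s. V s c) has_vector_derivative V') (at t)"
  shows "w c = V' + christoffel A D c (\<gamma> t) (velocity A \<gamma> t) (V t c)"
  using assms vector_derivative_unique_at[OF assms(3)] unfolding has_covd_along_def christoffel_def by blast

end

end

section \<open>Connections built from a parallelization\<close>

text \<open>\<open>Phi p\<close> identifies the tangent space at \<open>p\<close> with a fixed vector space, with inverse \<open>Psi p\<close>; both
  directions are smooth.  The term \<open>S\<close> is subtracted from the derivative in this parallelization.  It is
  bilinear in the direction and in the components of the field, and so affects no axiom of a connection.\<close>

locale parallelization =
  fixes B :: "('a, 'e::euclidean_space) atlas"
    and Phi :: "'a \<Rightarrow> ('a, 'e) tvec \<Rightarrow> 'f::euclidean_space"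
    and Psi :: "'a \<Rightarrow> 'f \<Rightarrow> ('a, 'e) tvec"
    and S :: "'a \<Rightarrow> ('a, 'e) tvec \<Rightarrow> 'f \<Rightarrow> 'f"
  assumes B: "smooth_atlas B"
    and Psi_Phi: "\<And>p X. p \<in> carrier B \<Longrightarrow> X \<in> tangent_space B p \<Longrightarrow> Psi p (Phi p X) = X"
    and Phi_Psi: "\<And>p y. p \<in> carrier B \<Longrightarrow> Phi p (Psi p y) = y"
    and Psi_tangent: "\<And>p y. p \<in> carrier B \<Longrightarrow> Psi p y \<in> tangent_space B p"
    and Phi_lincomb: "\<And>p X Y a b. p \<in> carrier B \<Longrightarrow> X \<in> tangent_space B p \<Longrightarrow> Y \<in> tangent_space B p
        \<Longrightarrow> Phi p (\<lambda>c. a *\<^sub>R X c + b *\<^sub>R Y c) = a *\<^sub>R Phi p X + b *\<^sub>R Phi p Y"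
    and Phi_smooth: "\<And>W Y. mopen B W \<Longrightarrow> smooth_vector_field B W Y \<Longrightarrow> smooth_map B W (\<lambda>p. Phi p (Y p))"
    and Psi_smooth: "\<And>W y. mopen B W \<Longrightarrow> smooth_map B W y \<Longrightarrow> smooth_vector_field B W (\<lambda>p. Psi p (y p))"
    and S_lincomb: "\<And>p X Y a b y. p \<in> carrier B \<Longrightarrow> X \<in> tangent_space B p \<Longrightarrow> Y \<in> tangent_space B p
        \<Longrightarrow> S p (\<lambda>c. a *\<^sub>R X c + b *\<^sub>R Y c) y = a *\<^sub>R S p X y + b *\<^sub>R S p Y y"
    and S_linear: "\<And>p X. p \<in> carrier B \<Longrightarrow> X \<in> tangent_space B p \<Longrightarrow> linear (S p X)"
    and S_smooth: "\<And>W X y. mopen B W \<Longrightarrow> smooth_vector_field B W X \<Longrightarrow> smooth_map B W y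
        \<Longrightarrow> smooth_map B W (\<lambda>p. S p (X p) (y p))"
begin

definition conn :: "('a, 'e) covd" where
  "conn p X Y = Psi p (deriv_along B p X (\<lambda>q. Phi q (Y q)) - S p X (Phi p (Y p)))"

lemma Psi_lincomb:
  assumes "p \<in> carrier B"
  shows "Psi p (a *\<^sub>R x + b *\<^sub>R y) = (\<lambda>c. a *\<^sub>R Psi p x c + b *\<^sub>R Psi p y c)"
  using Psi_Phi[OF assms, of "\<lambda>c. a *\<^sub>R Psi p x c + b *\<^sub>R Psi p y c"] assms
  by (simp add: Phi_lincomb Psi_tangent tangent_lincomb[OF B] Phi_Psi)

text \<open>Componentwise differentiation is additive and satisfies the Leibniz rule because \<open>Phi p\<close> is
  linear, and the bilinear term \<open>S\<close> does not disturb this.\<close>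

lemma linear_connection_conn: "linear_connection B conn"
  unfolding linear_connection_def smooth_fun_eq_smooth_map dir_deriv_eq_deriv_along
proof (intro allI impI conjI ballI)
  fix W Y p X assume W: "mopen B W" and Y: "smooth_vector_field B W Y" and p: "p \<in> W" and X: "X \<in> tangent_space B p"
  have pB: "p \<in> carrier B" using W p by (auto simp: mopen_def)
  have sY: "smooth_map B W (\<lambda>q. Phi q (Y q))" by (rule Phi_smooth[OF W Y])
  have qB: "q \<in> carrier B" if "q \<in> W" for q using W that by (auto simp: mopen_def)
  show "conn p X Z = conn p X Y" if "\<forall>q\<in>W. Z q = Y q" for Z
    using deriv_along_cong[OF B W p, of "\<lambda>q. Phi q (Z q)" "\<lambda>q. Phi q (Y q)" X] that p by (simp add: conn_def)
  show "conn p X Y \<in> tangent_space B p" by (simp add: conn_def Psi_tangent[OF pB])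
  show "conn p (\<lambda>c. a *\<^sub>R X c + b *\<^sub>R X' c) Y = (\<lambda>c. a *\<^sub>R conn p X Y c + b *\<^sub>R conn p X' Y c)"
    if X': "X' \<in> tangent_space B p" for X' a b
    unfolding conn_def
    by (simp add: deriv_along_lincomb[OF B W sY p X X'] S_lincomb[OF pB X X'] algebra_simps flip: Psi_lincomb[OF pB])
  show "conn p X (\<lambda>q c. Y q c + Z q c) = (\<lambda>c. conn p X Y c + conn p X Z c)"
    if Z: "smooth_vector_field B W Z" for Z
  proof -
    have *: "Phi q (\<lambda>c. Y q c + Z q c) = Phi q (Y q) + Phi q (Z q)" if "q \<in> W" for q
      using Phi_lincomb[OF qB[OF that], of "Y q" "Z q" 1 1] Y Z that by (simp add: smooth_vector_field_def)
    have "deriv_along B p X (\<lambda>q. Phi q (\<lambda>c. Y q c + Z q c)) = deriv_along B p X (\<lambda>q. Phi q (Y q) + Phi q (Z q))"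
      by (rule deriv_along_cong[OF B W p]) (rule *)
    then show ?thesis
      using Psi_lincomb[OF pB, of 1 _ 1]
      by (simp add: conn_def deriv_along_add[OF B W sY Phi_smooth[OF W Z] p] *[OF p]
          linear_add[OF S_linear[OF pB X]] add_diff_add)
  qed
  show "conn p X (\<lambda>q c. f q *\<^sub>R Y q c) = (\<lambda>c. deriv_along B p X f *\<^sub>R Y p c + f p *\<^sub>R conn p X Y c)"
    if f: "smooth_map B W f" for f
  proof -
    have *: "Phi q (\<lambda>c. f q *\<^sub>R Y q c) = f q *\<^sub>R Phi q (Y q)" if "q \<in> W" for q
      using Phi_lincomb[OF qB[OF that], of "Y q" "Y q" "f q" 0] Y that by (simp add: smooth_vector_field_def)
    have "deriv_along B p X (\<lambda>q. Phi q (\<lambda>c. f q *\<^sub>R Y q c)) = deriv_along B p X (\<lambda>q. f q *\<^sub>R Phi q (Y q))"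
      by (rule deriv_along_cong[OF B W p]) (rule *)
    also have "\<dots> = f p *\<^sub>R deriv_along B p X (\<lambda>q. Phi q (Y q)) + deriv_along B p X f *\<^sub>R Phi p (Y p)"
      by (rule deriv_along_bounded_bilinear[OF B W f sY p bounded_bilinear_scaleR])
    finally have "conn p X (\<lambda>q c. f q *\<^sub>R Y q c) = Psi p (deriv_along B p X f *\<^sub>R Phi p (Y p)
        + f p *\<^sub>R (deriv_along B p X (\<lambda>q. Phi q (Y q)) - S p X (Phi p (Y p))))"
      by (simp add: conn_def *[OF p] linear_cmul[OF S_linear[OF pB X]] algebra_simps)
    also have "\<dots> = (\<lambda>c. deriv_along B p X f *\<^sub>R Y p c + f p *\<^sub>R conn p X Y c)"
      using Y p Psi_Phi[OF pB, of "Y p"] by (simp only: Psi_lincomb[OF pB] conn_def smooth_vector_field_def)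
    finally show ?thesis .
  qed
next
  fix W Y X assume W: "mopen B W" and Y: "smooth_vector_field B W Y" and X: "smooth_vector_field B W X"
  show "smooth_vector_field B W (\<lambda>p. conn p (X p) Y)"
    unfolding conn_def
    by (intro Psi_smooth smooth_map_diff[OF B] smooth_map_deriv_along[OF B] S_smooth Phi_smooth W X Y)
qed

text \<open>For a field along a curve, the derivative of its components in the parallelization differs by \<open>S\<close>
  from the components of the covariant derivative.  The definition of the latter refers to coordinate
  fields of a chart, and \<open>V\<close> is expanded in these.\<close>

lemma Phi_along_has_vector_derivative:
  assumes \<gamma>: "smooth_curve B I \<gamma>" "t \<in> I" and V: "\<And>s. s \<in> I \<Longrightarrow> V s \<in> tangent_space B (\<gamma> s)"
    and c: "c \<in> charts_at B (\<gamma> t)" and V': "((\<lambda>s. V s c) has_vector_derivative V') (at t)"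
  shows "((\<lambda>s. Phi (\<gamma> s) (V s)) has_vector_derivative
     Phi (\<gamma> t) (coord_field B c (V' + christoffel B conn c (\<gamma> t) (velocity B \<gamma> t) (V t c)) (\<gamma> t))
     + S (\<gamma> t) (velocity B \<gamma> t) (Phi (\<gamma> t) (V t))) (at t)"
proof -
  have cB: "c \<in> B" "\<gamma> t \<in> fst c" using c by (auto simp: charts_at_def)
  let ?X = "velocity B \<gamma> t" and ?cf = "coord_field B c"
  have car: "q \<in> carrier B" if "c \<in> charts_at B q" for q using that by (auto simp: charts_at_def carrier_def)
  note X = velocity_tangent[OF B \<gamma>]
  have lin: "linear (\<lambda>v. Phi q (?cf v q))" if "c \<in> charts_at B q" for q
  proof (rule linearI)
    fix x y r
    show "Phi q (?cf (x + y) q) = Phi q (?cf x q) + Phi q (?cf y q)"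
      using coord_field_lincomb[OF B that, of 1 x 1 y] Phi_lincomb[OF car[OF that], of "?cf x q" "?cf y q" 1 1]
      by (simp add: coord_field_tangent[OF B that])
    show "Phi q (?cf (r *\<^sub>R x) q) = r *\<^sub>R Phi q (?cf x q)"
      using coord_field_lincomb[OF B that, of r x 0 x] Phi_lincomb[OF car[OF that], of "?cf x q" "?cf x q" r 0]
      by (simp add: coord_field_tangent[OF B that])
  qed
  have ex: "h v = (\<Sum>b\<in>Basis. (v \<bullet> b) *\<^sub>R h b)" if "linear h" for h :: "'e \<Rightarrow> 'f" and v
    by (subst euclidean_representation[of v, symmetric]) (simp only: linear_sum[OF that] linear_cmul[OF that])
  let ?g' = "\<lambda>b. deriv_along B (\<gamma> t) ?X (\<lambda>q. Phi q (?cf b q))"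
  have g: "((\<lambda>s. Phi (\<gamma> s) (?cf b (\<gamma> s))) has_vector_derivative ?g' b) (at t)" for b
    by (rule curve_compose_has_vector_derivative[OF B \<gamma> mopen_chart[OF B cB(1)]
          Phi_smooth[OF mopen_chart[OF B cB(1)] smooth_coord_field[OF B cB(1)]] cB(2)])
  have "((\<lambda>s. \<Sum>b\<in>Basis. (V s c \<bullet> b) *\<^sub>R Phi (\<gamma> s) (?cf b (\<gamma> s))) has_vector_derivative
     (\<Sum>b\<in>Basis. (V' \<bullet> b) *\<^sub>R Phi (\<gamma> t) (?cf b (\<gamma> t))) + (\<Sum>b\<in>Basis. (V t c \<bullet> b) *\<^sub>R ?g' b)) (at t)"
    by (rule has_vector_derivative_frame_expansion[OF V' g])
  then have 1: "((\<lambda>s. Phi (\<gamma> s) (V s)) has_vector_derivative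
     (\<Sum>b\<in>Basis. (V' \<bullet> b) *\<^sub>R Phi (\<gamma> t) (?cf b (\<gamma> t))) + (\<Sum>b\<in>Basis. (V t c \<bullet> b) *\<^sub>R ?g' b)) (at t)"
  proof (rule has_vector_derivative_transform_within_open[OF _ curve_chart(1)[OF B \<gamma>(1) cB(1)]])
    fix s assume "s \<in> {s \<in> I. \<gamma> s \<in> fst c}"
    then have s: "s \<in> I" "c \<in> charts_at B (\<gamma> s)" using cB by (auto simp: charts_at_def)
    show "(\<Sum>b\<in>Basis. (V s c \<bullet> b) *\<^sub>R Phi (\<gamma> s) (?cf b (\<gamma> s))) = Phi (\<gamma> s) (V s)"
      using ex[OF lin[OF s(2)], of "V s c"] coord_field_of_tangent[OF B V[OF s(1)] s(2)] by simp
  qed (use \<gamma> cB in auto)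
  have chr: "Phi (\<gamma> t) (?cf (conn (\<gamma> t) ?X (?cf b) c) (\<gamma> t)) = ?g' b - S (\<gamma> t) ?X (Phi (\<gamma> t) (?cf b (\<gamma> t)))" for b
    using coord_field_of_tangent[OF B Psi_tangent[OF car[OF c]] c] Phi_Psi[OF car[OF c]] by (simp add: conn_def)
  have "Phi (\<gamma> t) (?cf (christoffel B conn c (\<gamma> t) ?X (V t c)) (\<gamma> t))
    = (\<Sum>b\<in>Basis. (V t c \<bullet> b) *\<^sub>R (?g' b - S (\<gamma> t) ?X (Phi (\<gamma> t) (?cf b (\<gamma> t)))))"
    by (simp add: christoffel_def linear_sum[OF lin[OF c]] linear_cmul[OF lin[OF c]] chr)
  also have "\<dots> = (\<Sum>b\<in>Basis. (V t c \<bullet> b) *\<^sub>R ?g' b) - S (\<gamma> t) ?X (\<Sum>b\<in>Basis. (V t c \<bullet> b) *\<^sub>R Phi (\<gamma> t) (?cf b (\<gamma> t)))"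
    using S_linear[OF car[OF c] X] by (simp add: linear_sum linear_cmul scaleR_right_diff_distrib sum_subtractf)
  also have "(\<Sum>b\<in>Basis. (V t c \<bullet> b) *\<^sub>R Phi (\<gamma> t) (?cf b (\<gamma> t))) = Phi (\<gamma> t) (V t)"
    using ex[OF lin[OF c], of "V t c"] coord_field_of_tangent[OF B V[OF \<gamma>(2)] c] by simp
  finally show ?thesis
    using 1 ex[OF lin[OF c], of V'] by (simp add: linear_add[OF lin[OF c]])
qed

lemma Phi_eq_0_iff:
  assumes "p \<in> carrier B" "X \<in> tangent_space B p"
  shows "Phi p X = 0 \<longleftrightarrow> X = (\<lambda>_. 0)"
proof -
  have "Phi p (\<lambda>_. 0) = 0" using Phi_lincomb[OF assms(1) assms(2) assms(2), of 0 0] by simp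
  then show ?thesis using Psi_Phi[OF assms] Psi_Phi[OF assms(1) tangent_zero[OF B]] by metis
qed

text \<open>This turns the geodesic equation into an ordinary differential equation for a curve in one fixed
  vector space, valid on the whole interval and free of charts.\<close>

lemma geodesic_iff:
  assumes I: "open_interval I" and \<gamma>: "smooth_curve B I \<gamma>"
  shows "geodesic B conn I \<gamma> \<longleftrightarrow>
    (\<forall>t\<in>I. ((\<lambda>s. Phi (\<gamma> s) (velocity B \<gamma> s)) has_vector_derivative
       S (\<gamma> t) (velocity B \<gamma> t) (Phi (\<gamma> t) (velocity B \<gamma> t))) (at t))"
proof -
  have "has_covd_along B conn \<gamma> (velocity B \<gamma>) t (\<lambda>_. 0) \<longleftrightarrow>
    ((\<lambda>s. Phi (\<gamma> s) (velocity B \<gamma> s)) has_vector_derivative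
       S (\<gamma> t) (velocity B \<gamma> t) (Phi (\<gamma> t) (velocity B \<gamma> t))) (at t)" (is "?L \<longleftrightarrow> ?R") if t: "t \<in> I" for t
  proof -
    have car: "\<gamma> t \<in> carrier B" using \<gamma> t by (auto simp: smooth_curve_def)
    then obtain c where c: "c \<in> charts_at B (\<gamma> t)" by (auto simp: charts_at_def carrier_def)
    then have cB: "c \<in> B" "\<gamma> t \<in> fst c" by (auto simp: charts_at_def)
    let ?J = "{s \<in> I. \<gamma> s \<in> fst c}"
    note J = curve_chart[OF B \<gamma> cB(1)]
    define V' where "V' = vector_derivative (\<lambda>s. vector_derivative (\<lambda>s. snd c (\<gamma> s)) (at s)) (at t)"
    have "((\<lambda>s. vector_derivative (\<lambda>s. snd c (\<gamma> s)) (at s)) has_vector_derivative V') (at t)"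
      unfolding V'_def by (rule smooth_on_has_vector_derivative[OF smooth_on_vector_derivative[OF J]]) (use t cB in auto)
    then have V': "((\<lambda>s. velocity B \<gamma> s c) has_vector_derivative V') (at t)"
      by (rule has_vector_derivative_transform_within_open[OF _ J(1)])
        (use t cB in \<open>auto simp: velocity_def charts_at_def comp_def\<close>)
    define k where "k = V' + christoffel B conn c (\<gamma> t) (velocity B \<gamma> t) (velocity B \<gamma> t c)"
    have cf0: "coord_field B c k (\<gamma> t) = (\<lambda>_. 0) \<longleftrightarrow> k = 0"
      using coord_field_self[OF B c, of k] coord_field_of_tangent[OF B tangent_zero[OF B] c] by (auto dest: fun_cong)
    note vt = velocity_tangent[OF B \<gamma>]
    have "?L \<longleftrightarrow> k = 0"
    proof
      assume ?L then show "k = 0" using has_covd_along_chart[OF B linear_connection_conn, of \<gamma> "velocity B \<gamma>" t "\<lambda>_. 0", OF _ c V'] unfolding k_def by metis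
    next
      assume "k = 0" then show ?L
        by (intro has_covd_alongI[OF B linear_connection_conn \<gamma> t vt c V' tangent_zero[OF B]]) (simp_all add: k_def)
    qed
    moreover have "?R \<longleftrightarrow> Phi (\<gamma> t) (coord_field B c k (\<gamma> t)) = 0"
    proof -
      note d = Phi_along_has_vector_derivative[OF \<gamma> t vt c V', folded k_def]
      show ?thesis
      proof
        assume ?R
        from vector_derivative_unique_at[OF d this] show "Phi (\<gamma> t) (coord_field B c k (\<gamma> t)) = 0" by simp
      next
        assume "Phi (\<gamma> t) (coord_field B c k (\<gamma> t)) = 0"
        with d show ?R by simp
      qed
    qed
    ultimately show ?thesis using Phi_eq_0_iff[OF car coord_field_tangent[OF B c]] cf0 by simp
  qed
  then show ?thesis using I \<gamma> by (simp add: geodesic_def)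
qed

end

section \<open>The frame bundle as a manifold\<close>

text \<open>The columns are the coordinate vectors of the frame; this is the second component of
  \<open>frame_chart\<close>.\<close>

definition frame_matrix :: "('m, real^'n) chart \<Rightarrow> ('m, 'n) frame \<Rightarrow> real^'n^'n" where
  "frame_matrix c u = matrix (\<lambda>x. u x c)"

definition frame_of_matrix ::
    "('m, real^'n) atlas \<Rightarrow> ('m, real^'n) chart \<Rightarrow> 'm \<Rightarrow> real^'n^'n \<Rightarrow> ('m, 'n) frame" where
  "frame_of_matrix A c p U = (\<lambda>y. coord_field A c (U *v y) p)"

lemma matrix_apply:
  fixes h :: "real^'n \<Rightarrow> real^'m"
  shows "linear h \<Longrightarrow> matrix h *v x = h x"
  by (simp add: matrix_works linear_matrix_vector_mul_eq)

lemma fst_frame_chart: "fst (frame_chart A c) = Sigma (fst c) (frames A)"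
  by (simp add: frame_chart_def)

lemma mem_frame_chart: "z \<in> fst (frame_chart A c) \<longleftrightarrow> fst z \<in> fst c \<and> snd z \<in> frames A (fst z)"
  by (cases z) (simp add: frame_chart_def)

lemma snd_frame_chart: "snd (frame_chart A c) z = (snd c (fst z), frame_matrix c (snd z))"
  by (simp add: frame_chart_def frame_matrix_def split_beta)

lemma charts_at_frame_atlas:
  "snd z \<in> frames A (fst z) \<Longrightarrow> charts_at (frame_atlas A) z = frame_chart A ` charts_at A (fst z)"
  by (cases z) (auto simp: charts_at_def frame_atlas_def fst_frame_chart)

lemma frame_chart_at:
  "snd z \<in> frames A (fst z) \<Longrightarrow> c \<in> charts_at A (fst z) \<Longrightarrow> frame_chart A c \<in> charts_at (frame_atlas A) z"
  by (simp add: charts_at_frame_atlas)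

lemma frame_apply: "u \<in> frames A p \<Longrightarrow> u y c = frame_matrix c u *v y"
  by (simp add: frames_def frame_matrix_def matrix_apply del: split_paired_All)

lemma frame_tangent: "u \<in> frames A p \<Longrightarrow> u y \<in> tangent_space A p"
  by (auto simp: frames_def bij_betw_def)

lemma frame_inv_right: "u \<in> frames A p \<Longrightarrow> v \<in> tangent_space A p \<Longrightarrow> u (inv u v) = v"
  by (simp add: frames_def bij_betw_def f_inv_into_f)

lemma frame_inj: "u \<in> frames A p \<Longrightarrow> inj u"
  by (simp add: frames_def bij_betw_def)

lemma frame_inv_left: "u \<in> frames A p \<Longrightarrow> inv u (u y) = y"
  by (simp add: frame_inj)

lemma open_invertible: "open {U :: real^'n^'n. invertible U}"
  unfolding invertible_det_nz
  by (intro open_Collect_neq smooth_on_continuous_on smooth_on_det smooth_on_id smooth_on_const open_UNIV)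

lemma matrix_inv_cancel:
  fixes U :: "real^'n^'n"
  assumes "invertible U"
  shows "U *v (matrix_inv U *v x) = x" "matrix_inv U *v (U *v x) = x"
    "U ** (matrix_inv U ** M) = M" "matrix_inv U ** (U ** M) = M"
  using matrix_inv_mult[OF assms] by (simp_all add: matrix_vector_mul_assoc matrix_mul_assoc)

context
  fixes A :: "('m, real^'n) atlas"
  assumes A: "smooth_atlas A"
begin

lemma invertible_frame_matrix:
  assumes u: "u \<in> frames A p" and c: "c \<in> charts_at A p"
  shows "invertible (frame_matrix c u)"
proof -
  have "inj ((*v) (frame_matrix c u))"
  proof (rule injI)
    fix x y assume "frame_matrix c u *v x = frame_matrix c u *v y"
    then have "u x = u y"
      by (intro tangent_eqI[OF A frame_tangent[OF u] frame_tangent[OF u] c]) (simp add: frame_apply[OF u])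
    then show "x = y" using frame_inj[OF u] by (simp add: inj_eq)
  qed
  then show ?thesis by (simp add: invertible_left_inverse matrix_left_invertible_injective)
qed

lemma frame_inv_eq:
  assumes u: "u \<in> frames A p" and c: "c \<in> charts_at A p" and v: "v \<in> tangent_space A p"
  shows "inv u v = matrix_inv (frame_matrix c u) *v v c"
  using frame_apply[OF u, of "inv u v" c] frame_inv_right[OF u v]
  by (simp add: matrix_inv_cancel[OF invertible_frame_matrix[OF u c]])

lemma frame_of_matrix_in_frames:
  assumes c: "c \<in> charts_at A p" and U: "invertible U"
  shows "frame_of_matrix A c p U \<in> frames A p"
  unfolding frames_def
proof (intro CollectI conjI allI)
  fix d
  show "linear (\<lambda>x. frame_of_matrix A c p U x d)"
  proof (rule linearI)
    show "frame_of_matrix A c p U (x + y) d = frame_of_matrix A c p U x d + frame_of_matrix A c p U y d" for x y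
      using coord_field_lincomb[OF A c, of 1 "U *v x" 1 "U *v y"]
      by (simp add: frame_of_matrix_def matrix_vector_right_distrib)
    show "frame_of_matrix A c p U (r *\<^sub>R x) d = r *\<^sub>R frame_of_matrix A c p U x d" for r x
      using coord_field_lincomb[OF A c, of r "U *v x" 0 "U *v x"]
      by (simp add: frame_of_matrix_def matrix_vector_mult_scaleR)
  qed
next
  show "bij_betw (frame_of_matrix A c p U) UNIV (tangent_space A p)"
  proof (rule bij_betw_byWitness[where f' = "\<lambda>v. matrix_inv U *v v c"])
    show "\<forall>v\<in>tangent_space A p. frame_of_matrix A c p U (matrix_inv U *v v c) = v"
      by (simp add: frame_of_matrix_def matrix_inv_cancel[OF U] coord_field_of_tangent[OF A _ c])
  qed (auto simp: frame_of_matrix_def coord_field_self[OF A c] matrix_inv_cancel[OF U] coord_field_tangent[OF A c])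
qed

lemma frame_matrix_of_matrix:
  "c \<in> charts_at A p \<Longrightarrow> frame_matrix c (frame_of_matrix A c p U) = U"
  by (simp add: frame_matrix_def frame_of_matrix_def coord_field_self[OF A])

lemma frame_of_frame_matrix:
  assumes u: "u \<in> frames A p" and c: "c \<in> charts_at A p"
  shows "frame_of_matrix A c p (frame_matrix c u) = u"
  unfolding frame_of_matrix_def
  using coord_field_of_tangent[OF A frame_tangent[OF u] c] by (simp add: frame_apply[OF u])

lemma frame_matrix_transition:
  assumes u: "u \<in> frames A p" and c: "c \<in> charts_at A p" and d: "d \<in> charts_at A p"
  shows "frame_matrix d u = matrix (transition_deriv c d p) ** frame_matrix c u"
  unfolding matrix_eq
  using tangent_transition[OF A frame_tangent[OF u] c d] matrix_apply[OF linear_transition_deriv[OF A c d]]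
  by (simp add: frame_apply[OF u] flip: matrix_vector_mul_assoc)

text \<open>The coordinates of the frames over \<open>V\<close> form a product: the matrix of a frame is invertible, and
  each invertible matrix is the matrix of a frame.\<close>

lemma frame_chart_image:
  assumes c: "c \<in> A"
  shows "snd (frame_chart A c) ` (Sigma V (frames A) \<inter> fst (frame_chart A c)) = (snd c ` (V \<inter> fst c)) \<times> {U :: real^'n^'n. invertible U}"
proof (intro equalityI subsetI)
  fix y assume "y \<in> snd (frame_chart A c) ` (Sigma V (frames A) \<inter> fst (frame_chart A c))"
  then obtain p u where "p \<in> V \<inter> fst c" "u \<in> frames A p" "y = (snd c p, frame_matrix c u)"
    by (auto simp: fst_frame_chart snd_frame_chart)
  then show "y \<in> (snd c ` (V \<inter> fst c)) \<times> {U :: real^'n^'n. invertible U}"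
    using c invertible_frame_matrix by (auto simp: charts_at_def)
next
  fix y assume "y \<in> (snd c ` (V \<inter> fst c)) \<times> {U :: real^'n^'n. invertible U}"
  then obtain p U where pU: "p \<in> V" "p \<in> fst c" "invertible U" "y = (snd c p, U)" by auto
  then have ch: "c \<in> charts_at A p" using c by (simp add: charts_at_def)
  show "y \<in> snd (frame_chart A c) ` (Sigma V (frames A) \<inter> fst (frame_chart A c))"
    by (rule image_eqI[of _ _ "(p, frame_of_matrix A c p U)"])
      (use pU in \<open>simp_all add: fst_frame_chart snd_frame_chart frame_matrix_of_matrix[OF ch] frame_of_matrix_in_frames[OF ch]\<close>)
qed

lemma frame_chart_inj: "c \<in> A \<Longrightarrow> inj_on (snd (frame_chart A c)) (fst (frame_chart A c))"
proof (rule inj_onI)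
  fix z w assume c: "c \<in> A" and z: "z \<in> fst (frame_chart A c)" and w: "w \<in> fst (frame_chart A c)"
    and eq: "snd (frame_chart A c) z = snd (frame_chart A c) w"
  have zw: "fst z \<in> fst c" "snd z \<in> frames A (fst z)" "fst w \<in> fst c" "snd w \<in> frames A (fst w)"
    using z w by (auto simp: fst_frame_chart)
  have "snd c (fst z) = snd c (fst w)" using eq by (simp add: snd_frame_chart)
  then have "fst z = fst w"
    using chart_inv_left[OF A c zw(1)] chart_inv_left[OF A c zw(3)] by metis
  moreover have "c \<in> charts_at A (fst z)" using c zw by (simp add: charts_at_def)
  ultimately have "snd z = snd w"
    using frame_of_frame_matrix zw eq by (metis snd_frame_chart snd_conv)
  with \<open>fst z = fst w\<close> show "z = w" by (simp add: prod_eq_iff)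
qed

lemma chart_inv_frame_chart:
  assumes c: "c \<in> A" and p: "p \<in> fst c" and U: "invertible U"
  shows "chart_inv (frame_chart A c) (snd c p, U) = (p, frame_of_matrix A c p U)"
proof -
  have ch: "c \<in> charts_at A p" using c p by (simp add: charts_at_def)
  have "snd (frame_chart A c) (p, frame_of_matrix A c p U) = (snd c p, U)"
    by (simp add: snd_frame_chart frame_matrix_of_matrix[OF ch])
  moreover have "(p, frame_of_matrix A c p U) \<in> fst (frame_chart A c)"
    using p frame_of_matrix_in_frames[OF ch U] by (simp add: fst_frame_chart)
  ultimately show ?thesis
    unfolding chart_inv_def using inv_into_f_f[OF frame_chart_inj[OF c]] by metis
qed

lemma transition_frame_chart:
  assumes c: "c \<in> A" and d: "d \<in> A" and p: "p \<in> fst c" "p \<in> fst d" and U: "invertible U"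
  shows "transition (frame_chart A c) (frame_chart A d) (snd c p, U)
    = (transition c d (snd c p), matrix (frechet_derivative (transition c d) (at (snd c p))) ** U)"
proof -
  have ch: "c \<in> charts_at A p" "d \<in> charts_at A p" using c d p by (simp_all add: charts_at_def)
  show ?thesis
    using frame_matrix_transition[OF frame_of_matrix_in_frames[OF ch(1) U] ch]
    by (simp add: transition_def chart_inv_frame_chart[OF c p(1) U] snd_frame_chart chart_inv_left[OF A c p(1)]
        frame_matrix_of_matrix[OF ch(1)] transition_deriv_def[unfolded transition_def])
qed

lemma smooth_atlas_frame_atlas: "smooth_atlas (frame_atlas A)"
  unfolding smooth_atlas_def
proof (intro conjI ballI)
  fix C assume "C \<in> frame_atlas A"
  then obtain c where c: "c \<in> A" "C = frame_chart A c" by (auto simp: frame_atlas_def)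
  show "inj_on (snd C) (fst C)" using frame_chart_inj c by simp
  have "open (snd c ` fst c)" using A c by (simp add: smooth_atlas_def)
  then show "open (snd C ` fst C)"
    using frame_chart_image[OF c(1), of "fst c"] c(2) by (simp add: fst_frame_chart open_Times open_invertible)
  fix D assume "D \<in> frame_atlas A"
  then obtain d where d: "d \<in> A" "D = frame_chart A d" by (auto simp: frame_atlas_def)
  have "fst C \<inter> fst D = Sigma (fst d) (frames A) \<inter> fst (frame_chart A c)" using c d by (auto simp: fst_frame_chart)
  then have im: "snd C ` (fst C \<inter> fst D) = (snd c ` (fst c \<inter> fst d)) \<times> {U :: real^'n^'n. invertible U}" (is "_ = ?S")
    using frame_chart_image[OF c(1), of "fst d"] c(2) by (simp add: Int_commute)
  have op: "open ?S" by (intro open_Times open_invertible smooth_transition[OF A] c d)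
  then show "open (snd C ` (fst C \<inter> fst D))" by (simp add: im)
  note tr = smooth_transition(2)[OF A c(1) d(1)]
  have f: "smooth_on ?S fst" "smooth_on ?S snd"
    using smooth_on_fst[OF op smooth_on_id[OF op]] smooth_on_snd[OF op smooth_on_id[OF op]] by auto
  let ?T = "\<lambda>x. (transition c d (fst x), matrix (frechet_derivative (transition c d) (at (fst x))) ** snd x)"
  have sm: "smooth_on ?S ?T"
    by (intro smooth_on_Pair smooth_on_matrix_mult smooth_on_matrix smooth_on_compose[OF op tr f(1)]
        smooth_on_compose[OF op smooth_on_derivative[OF tr] f(1)] f op) auto
  have eq: "?T x = transition C D x"
    if xS: "x \<in> ?S" for x
  proof -
    obtain p U where p: "p \<in> fst c" "p \<in> fst d" "invertible U" and x: "x = (snd c p, U)"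
      using xS by auto
    show ?thesis unfolding x c(2) d(2) transition_frame_chart[OF c(1) d(1) p] by simp
  qed
  from sm eq show "smooth_on (snd C ` (fst C \<inter> fst D)) (transition C D)"
    unfolding im using smooth_on_cong[OF op, of ?T "transition C D"] by blast
qed

lemma mopen_frame_bundle_over:
  assumes W: "mopen A W" shows "mopen (frame_atlas A) (Sigma W (frames A))"
  unfolding mopen_def
proof (intro conjI ballI)
  show "Sigma W (frames A) \<subseteq> carrier (frame_atlas A)"
    using W by (auto simp: carrier_frame_atlas frame_bundle_def mopen_def)
  fix C assume "C \<in> frame_atlas A"
  then obtain c where c: "c \<in> A" "C = frame_chart A c" by (auto simp: frame_atlas_def)
  then show "open (snd C ` (Sigma W (frames A) \<inter> fst C))"
    using frame_chart_image[OF c(1), of W] open_chart_image[OF A W c(1)] by (simp add: open_Times open_invertible)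
qed

lemma frame_bundle_iff: "z \<in> frame_bundle A \<longleftrightarrow> fst z \<in> carrier A \<and> snd z \<in> frames A (fst z)"
  by (cases z) (simp add: frame_bundle_def)

lemma curve_in_frame_bundle:
  assumes "smooth_curve (frame_atlas A) I \<gamma>" "t \<in> I"
  shows "fst (\<gamma> t) \<in> carrier A" "snd (\<gamma> t) \<in> frames A (fst (\<gamma> t))"
  using assms by (auto simp: smooth_curve_def carrier_frame_atlas frame_bundle_iff image_subset_iff)

lemma curve_mem_frame_bundle:
  assumes \<gamma>: "smooth_curve (frame_atlas A) I \<gamma>" "t \<in> I" shows "\<gamma> t \<in> frame_bundle A"
  using \<gamma> by (auto simp: smooth_curve_def carrier_frame_atlas)

lemma smooth_curve_proj:
  assumes \<gamma>: "smooth_curve (frame_atlas A) I \<gamma>"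
  shows "smooth_curve A I (\<lambda>t. fst (\<gamma> t))"
  unfolding smooth_curve_def
proof (intro conjI ballI)
  show "(\<lambda>t. fst (\<gamma> t)) ` I \<subseteq> carrier A" using curve_in_frame_bundle[OF \<gamma>] by auto
  fix c assume c: "c \<in> A"
  then have C: "frame_chart A c \<in> frame_atlas A" by (simp add: frame_atlas_def)
  have eq: "{t \<in> I. \<gamma> t \<in> fst (frame_chart A c)} = {t \<in> I. fst (\<gamma> t) \<in> fst c}"
    using curve_in_frame_bundle(2)[OF \<gamma>] by (auto simp: mem_frame_chart)
  note cc = curve_chart[OF smooth_atlas_frame_atlas \<gamma> C, unfolded eq]
  show "open {t \<in> I. fst (\<gamma> t) \<in> fst c}" by (rule cc(1))
  show "smooth_on {t \<in> I. fst (\<gamma> t) \<in> fst c} (snd c \<circ> (\<lambda>t. fst (\<gamma> t)))"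
    using smooth_on_fst[OF cc] by (simp add: comp_def snd_frame_chart)
qed

lemma velocity_proj:
  assumes \<gamma>: "smooth_curve (frame_atlas A) I \<gamma>" "t \<in> I" and c: "c \<in> charts_at A (fst (\<gamma> t))"
  shows "velocity A (\<lambda>t. fst (\<gamma> t)) t c = fst (velocity (frame_atlas A) \<gamma> t (frame_chart A c))"
proof -
  have "frame_chart A c \<in> charts_at (frame_atlas A) (\<gamma> t)"
    by (rule frame_chart_at[OF curve_in_frame_bundle(2)[OF \<gamma>] c])
  from bounded_linear.has_vector_derivative[OF bounded_linear_fst curve_has_vector_derivative[OF smooth_atlas_frame_atlas \<gamma> this]]
  have "((\<lambda>s. snd c (fst (\<gamma> s))) has_vector_derivative fst (velocity (frame_atlas A) \<gamma> t (frame_chart A c))) (at t)"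
    by (simp add: snd_frame_chart)
  then show ?thesis
    using vector_derivative_unique_at[OF curve_has_vector_derivative[OF A smooth_curve_proj[OF \<gamma>(1)] \<gamma>(2) c]] by simp
qed

lemma proj_push_chart:
  assumes z: "z \<in> frame_bundle A" and X: "X \<in> tangent_space (frame_atlas A) z" and d: "d \<in> charts_at A (fst z)"
  shows "proj_push A z X d = fst (X (frame_chart A d))"
proof -
  let ?B = "frame_atlas A" and ?D = "frame_chart A d"
  have D: "?D \<in> charts_at ?B z" using z d frame_chart_at[of z A d] by (simp add: frame_bundle_iff)
  then have DB: "?D \<in> ?B" "z \<in> fst ?D" by (auto simp: charts_at_def)
  note B = smooth_atlas_frame_atlas
  have "proj_push A z X d = deriv_along ?B z X (\<lambda>q. fst (snd ?D q))"
    using d by (simp add: pushforward_def deriv_along_def comp_def snd_frame_chart)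
  also have "\<dots> = fst (X ?D)"
    using deriv_along_bounded_linear[OF B mopen_chart[OF B DB(1)] deriv_along_chart(1)[OF B D X] DB(2) bounded_linear_fst]
    by (simp add: deriv_along_chart(2)[OF B D X])
  finally show ?thesis .
qed

end

text \<open>A straight line in a chart.  It realizes a tangent vector as a velocity, which is what the
  definition of the connection form asks for.\<close>

lemma exists_curve_with_velocity:
  assumes B: "smooth_atlas B" and z: "z \<in> carrier B" and X: "X \<in> tangent_space B z"
  obtains I \<gamma> where "open_interval I" "0 \<in> I" "smooth_curve B I \<gamma>" "\<gamma> 0 = z" "velocity B \<gamma> 0 = X"
proof -
  obtain c where c: "c \<in> charts_at B z" using z by (auto simp: charts_at_def carrier_def)
  then have cB: "c \<in> B" "z \<in> fst c" by (auto simp: charts_at_def)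
  have op: "open (snd c ` fst c)" using B cB by (simp add: smooth_atlas_def)
  define l where "l = (\<lambda>t. snd c z + t *\<^sub>R X c)"
  have l: "continuous_on UNIV l" unfolding l_def by (intro continuous_intros)
  have pre: "open (l -` O')" if "open O'" for O' using l that by (simp add: continuous_on_open_vimage)
  have "0 \<in> l -` (snd c ` fst c)" using cB by (simp add: l_def)
  then obtain e where e: "e > 0" "ball 0 e \<subseteq> l -` (snd c ` fst c)"
    using pre[OF op] open_contains_ball by meson
  define \<gamma> where "\<gamma> = (\<lambda>t. chart_inv c (l t))"
  have in_c: "\<gamma> t \<in> fst c" "snd c (\<gamma> t) = l t" if "t \<in> ball 0 e" for t
    using that e chart_inv_mem[OF B cB(1), of "l t" "fst c"] by (auto simp: \<gamma>_def)
  have sm: "smooth_curve B (ball 0 e) \<gamma>"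
    unfolding smooth_curve_def
  proof (intro conjI ballI)
    show "\<gamma> ` ball 0 e \<subseteq> carrier B" using in_c cB by (auto simp: carrier_def)
    fix d assume d: "d \<in> B"
    let ?J = "{t \<in> ball 0 e. \<gamma> t \<in> fst d}"
    have J: "?J = ball 0 e \<inter> l -` (snd c ` (fst c \<inter> fst d))"
    proof (intro equalityI subsetI)
      fix t assume "t \<in> ?J"
      then show "t \<in> ball 0 e \<inter> l -` (snd c ` (fst c \<inter> fst d))" using in_c[of t] by (force intro!: image_eqI[of _ _ "\<gamma> t"])
    next
      fix t assume "t \<in> ball 0 e \<inter> l -` (snd c ` (fst c \<inter> fst d))"
      then show "t \<in> ?J" using chart_inv_mem[OF B cB(1), of "l t" "fst d"] by (auto simp: \<gamma>_def Int_commute)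
    qed
    then show oJ: "open ?J" using pre[OF smooth_transition(1)[OF B cB(1) d]] by auto
    have "smooth_on ?J l" unfolding l_def
      by (intro smooth_on_add smooth_on_const smooth_on_scaleR smooth_on_id oJ)
    then have "smooth_on ?J (\<lambda>t. transition c d (l t))"
      by (rule smooth_on_compose[OF oJ smooth_transition(2)[OF B cB(1) d]]) (unfold J, auto)
    then show "smooth_on ?J (snd d \<circ> \<gamma>)" by (simp add: transition_def \<gamma>_def comp_def)
  qed
  have 0: "\<gamma> 0 = z" by (simp add: \<gamma>_def l_def chart_inv_left[OF B cB])
  have "(l has_vector_derivative X c) (at 0)"
    unfolding l_def by (auto intro!: derivative_eq_intros)
  then have "((\<lambda>s. snd c (\<gamma> s)) has_vector_derivative X c) (at 0)"
    by (rule has_vector_derivative_transform_within_open[of _ _ _ "ball 0 e"]) (use e in_c in auto)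
  then have "velocity B \<gamma> 0 c = X c"
    using vector_derivative_unique_at[OF curve_has_vector_derivative[OF B sm, of 0 c]] c 0 e by simp
  then have "velocity B \<gamma> 0 = X"
    using tangent_eqI[OF B velocity_tangent[OF B sm, of 0] _ _] X c 0 e by simp
  moreover have "open_interval (ball (0::real) e)" by (simp add: open_interval_def is_interval_ball_real)
  ultimately show thesis using that sm 0 e by simp
qed

section \<open>The canonical parallelization of the frame bundle\<close>

lemma has_covd_along_unique:
  assumes A: "smooth_atlas A" and p: "\<gamma> t \<in> carrier A"
    and w: "has_covd_along A D \<gamma> V t w" "has_covd_along A D \<gamma> V t w'"
  shows "w = w'"
proof -
  obtain c where c: "c \<in> charts_at A (\<gamma> t)" using p by (auto simp: charts_at_def carrier_def)
  obtain V' where V': "((\<lambda>s. V s c) has_vector_derivative V') (at t)"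
    and wc: "w c = V' + (\<Sum>b\<in>Basis. (V t c \<bullet> b) *\<^sub>R D (\<gamma> t) (velocity A \<gamma> t) (coord_field A c b) c)"
    using w(1) c unfolding has_covd_along_def by blast
  obtain V'' where V'': "((\<lambda>s. V s c) has_vector_derivative V'') (at t)"
    and wc': "w' c = V'' + (\<Sum>b\<in>Basis. (V t c \<bullet> b) *\<^sub>R D (\<gamma> t) (velocity A \<gamma> t) (coord_field A c b) c)"
    using w(2) c unfolding has_covd_along_def by blast
  have "w c = w' c" using wc wc' vector_derivative_unique_at[OF V' V''] by simp
  then show ?thesis
    using w by (intro tangent_eqI[OF A _ _ c]) (simp_all add: has_covd_along_def)
qed

definition conn_matrix ::
    "('m, real^'n) atlas \<Rightarrow> ('m, real^'n) covd \<Rightarrow> ('m, real^'n) chart \<Rightarrow> 'm \<Rightarrow> ('m, real^'n) tvec \<Rightarrow> real^'n^'n" where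
  "conn_matrix A D c p X = matrix (christoffel A D c p X)"

lemma conn_matrix_apply: "conn_matrix A D c p X *v v = christoffel A D c p X v"
  by (simp add: conn_matrix_def matrix_apply[OF linear_christoffel])

text \<open>The pair of the canonical form and the connection form, written \<open>(\<theta>, \<omega>)\<close> at the top.\<close>

definition frame_form ::
    "('m, real^'n) atlas \<Rightarrow> ('m, real^'n) covd \<Rightarrow> ('m, 'n) frame_point \<Rightarrow> ('m, 'n) frame_tvec \<Rightarrow> (real^'n) \<times> (real^'n^'n)" where
  "frame_form A D z X = (inv (snd z) (proj_push A z X), connection_form A D z X)"

text \<open>The inverse of \<open>frame_form\<close>.  In a chart with frame matrix \<open>U\<close> the vector with components \<open>(\<xi>, w)\<close> is
  \<open>(U \<xi>, U w - \<Gamma>(U \<xi>) U)\<close>; every chart gives the same vector, by \<open>frame_vector_chart\<close>.\<close>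

definition frame_vector ::
    "('m, real^'n) atlas \<Rightarrow> ('m, real^'n) covd \<Rightarrow> ('m, 'n) frame_point \<Rightarrow> (real^'n) \<times> (real^'n^'n) \<Rightarrow> ('m, 'n) frame_tvec" where
  "frame_vector A D z y =
     (let c = (SOME c. c \<in> charts_at A (fst z)); U = frame_matrix c (snd z); a = U *v fst y
      in coord_field (frame_atlas A) (frame_chart A c)
           (a, U ** snd y - conn_matrix A D c (fst z) (coord_field A c a (fst z)) ** U) z)"

context
  fixes A :: "('m, real^'n) atlas" and D :: "('m, real^'n) covd"
  assumes A: "smooth_atlas A" and D: "linear_connection A D"
begin

lemma velocity_eq_proj_push:
  assumes \<gamma>: "smooth_curve (frame_atlas A) I \<gamma>" "t \<in> I"
  shows "velocity A (\<lambda>t. fst (\<gamma> t)) t = proj_push A (\<gamma> t) (velocity (frame_atlas A) \<gamma> t)"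
proof
  fix d
  have z: "\<gamma> t \<in> frame_bundle A" by (rule curve_mem_frame_bundle[OF A \<gamma>])
  show "velocity A (\<lambda>t. fst (\<gamma> t)) t d = proj_push A (\<gamma> t) (velocity (frame_atlas A) \<gamma> t) d"
  proof (cases "d \<in> charts_at A (fst (\<gamma> t))")
    case True
    then show ?thesis
      by (simp add: velocity_proj[OF A \<gamma>] proj_push_chart[OF A z velocity_tangent[OF smooth_atlas_frame_atlas[OF A] \<gamma>]])
  qed (simp add: velocity_def pushforward_def)
qed

text \<open>In a chart \<open>c\<close> with frame matrix \<open>U\<close>, the covariant derivative of the moving frame is \<open>U' + \<Gamma> U\<close>.
  As it is the covariant derivative of vector fields on the base, it does not depend on the chart.\<close>

lemma covd_frame_along_chart:
  assumes \<gamma>: "smooth_curve (frame_atlas A) I \<gamma>" "t \<in> I" and c: "c \<in> charts_at A (fst (\<gamma> t))"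
  shows "has_covd_along A D (\<lambda>t. fst (\<gamma> t)) (\<lambda>s. snd (\<gamma> s) y) t
    (coord_field A c ((snd (velocity (frame_atlas A) \<gamma> t (frame_chart A c))
       + conn_matrix A D c (fst (\<gamma> t)) (velocity A (\<lambda>t. fst (\<gamma> t)) t) ** frame_matrix c (snd (\<gamma> t))) *v y) (fst (\<gamma> t)))"
proof (rule has_covd_alongI[OF A D smooth_curve_proj[OF A \<gamma>(1)] \<gamma>(2) frame_tangent[OF curve_in_frame_bundle(2)[OF A \<gamma>(1)]] c])
  let ?B = "frame_atlas A" and ?C = "frame_chart A c"
  let ?X = "velocity ?B \<gamma> t ?C"
  note fr = curve_in_frame_bundle(2)[OF A \<gamma>(1)]
  have C: "?C \<in> charts_at ?B (\<gamma> t)" by (rule frame_chart_at[OF fr[OF \<gamma>(2)] c])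
  note B = smooth_atlas_frame_atlas[OF A]
  have "((\<lambda>s. frame_matrix c (snd (\<gamma> s))) has_vector_derivative snd ?X) (at t)"
    using bounded_linear.has_vector_derivative[OF bounded_linear_snd curve_has_vector_derivative[OF B \<gamma> C]]
    by (simp add: snd_frame_chart)
  from bounded_linear.has_vector_derivative[OF bounded_bilinear.bounded_linear_left[OF bounded_bilinear_matrix_vector_mult, of y] this]
  have "((\<lambda>s. frame_matrix c (snd (\<gamma> s)) *v y) has_vector_derivative snd ?X *v y) (at t)" .
  moreover have "open {s \<in> I. \<gamma> s \<in> fst ?C}" by (rule curve_chart(1)[OF B \<gamma>(1)]) (use C in \<open>simp add: charts_at_def\<close>)
  ultimately show "((\<lambda>s. snd (\<gamma> s) y c) has_vector_derivative snd ?X *v y) (at t)"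
    by (rule has_vector_derivative_transform_within_open)
      (use \<gamma> C in \<open>auto simp: charts_at_def frame_apply[OF fr]\<close>)
qed (simp_all add: coord_field_tangent[OF A c] coord_field_self[OF A c] frame_apply[OF curve_in_frame_bundle(2)[OF A \<gamma>]]
    matrix_vector_mult_add_rdistrib conn_matrix_apply flip: matrix_vector_mul_assoc)

lemma proj_push_tangent:
  assumes z: "z \<in> frame_bundle A" and X: "X \<in> tangent_space (frame_atlas A) z"
  shows "proj_push A z X \<in> tangent_space A (fst z)"
proof -
  have zc: "z \<in> carrier (frame_atlas A)" using z by (simp add: carrier_frame_atlas)
  obtain I \<gamma> where \<gamma>: "open_interval I" "0 \<in> I" "smooth_curve (frame_atlas A) I \<gamma>" "\<gamma> 0 = z" "velocity (frame_atlas A) \<gamma> 0 = X"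
    by (rule exists_curve_with_velocity[OF smooth_atlas_frame_atlas[OF A] zc X])
  show ?thesis
    using velocity_tangent[OF A smooth_curve_proj[OF A \<gamma>(3)] \<gamma>(2)] velocity_eq_proj_push[OF \<gamma>(3,2)] \<gamma>(4,5) by simp
qed

lemma proj_push_eq_coord_field:
  assumes z: "z \<in> frame_bundle A" and X: "X \<in> tangent_space (frame_atlas A) z" and c: "c \<in> charts_at A (fst z)"
  shows "proj_push A z X = coord_field A c (fst (X (frame_chart A c))) (fst z)"
  using coord_field_of_tangent[OF A proj_push_tangent[OF z X] c] proj_push_chart[OF A z X c] by simp

text \<open>The chart formula \<open>\<omega> = U\<^sup>-\<^sup>1 (U' + \<Gamma> U)\<close>.  The value is unique because some curve has the velocity
  \<open>X\<close>, and then \<open>u\<close> is injective.\<close>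

lemma connection_form_chart:
  assumes z: "z \<in> frame_bundle A" and X: "X \<in> tangent_space (frame_atlas A) z" and c: "c \<in> charts_at A (fst z)"
  shows "connection_form A D z X = matrix_inv (frame_matrix c (snd z)) **
    (snd (X (frame_chart A c)) + conn_matrix A D c (fst z) (proj_push A z X) ** frame_matrix c (snd z))" (is "_ = ?w")
    and "smooth_curve (frame_atlas A) I \<gamma> \<Longrightarrow> t \<in> I \<Longrightarrow> \<gamma> t = z \<Longrightarrow> velocity (frame_atlas A) \<gamma> t = X
      \<Longrightarrow> has_covd_along A D (\<lambda>t. fst (\<gamma> t)) (\<lambda>s. snd (\<gamma> s) y) t (snd z (connection_form A D z X *v y))"
proof -
  have u: "snd z \<in> frames A (fst z)" using z by (simp add: frame_bundle_iff[OF A])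
  let ?U = "frame_matrix c (snd z)"
  let ?K = "snd (X (frame_chart A c)) + conn_matrix A D c (fst z) (proj_push A z X) ** ?U"
  have K: "snd z (?w *v y) = coord_field A c (?K *v y) (fst z)" for y
    using coord_field_of_tangent[OF A frame_tangent[OF u, of "?w *v y"] c]
    by (simp add: frame_apply[OF u] matrix_vector_mul_assoc matrix_inv_cancel[OF invertible_frame_matrix[OF A u c]])
  have *: "has_covd_along A D (\<lambda>t. fst (\<gamma> t)) (\<lambda>s. snd (\<gamma> s) y) t (snd z (?w *v y))"
    if \<gamma>: "smooth_curve (frame_atlas A) I \<gamma>" "t \<in> I" "\<gamma> t = z" "velocity (frame_atlas A) \<gamma> t = X" for I \<gamma> t y
    using covd_frame_along_chart[OF \<gamma>(1,2), of c y] velocity_eq_proj_push[OF \<gamma>(1,2)] c unfolding K \<gamma>(3,4) by simp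
  have zc: "z \<in> carrier (frame_atlas A)" using z by (simp add: carrier_frame_atlas)
  obtain J \<delta> where \<delta>: "open_interval J" "0 \<in> J" "smooth_curve (frame_atlas A) J \<delta>" "\<delta> 0 = z" "velocity (frame_atlas A) \<delta> 0 = X"
    by (rule exists_curve_with_velocity[OF smooth_atlas_frame_atlas[OF A] zc X])
  show eq: "connection_form A D z X = ?w"
    unfolding connection_form_def
  proof (rule the_equality)
    fix w assume w: "\<forall>I \<gamma>. open_interval I \<longrightarrow> 0 \<in> I \<longrightarrow> smooth_curve (frame_atlas A) I \<gamma> \<longrightarrow>
     \<gamma> 0 = z \<longrightarrow> velocity (frame_atlas A) \<gamma> 0 = X \<longrightarrow>
     (\<forall>x. has_covd_along A D (\<lambda>t. fst (\<gamma> t)) (\<lambda>t. snd (\<gamma> t) x) 0 (snd z (w *v x)))"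
    have "snd z (w *v y) = snd z (?w *v y)" for y
    proof (rule has_covd_along_unique[OF A])
      show "has_covd_along A D (\<lambda>t. fst (\<delta> t)) (\<lambda>t. snd (\<delta> t) y) 0 (snd z (w *v y))" using w \<delta> by blast
      show "has_covd_along A D (\<lambda>t. fst (\<delta> t)) (\<lambda>t. snd (\<delta> t) y) 0 (snd z (?w *v y))" by (rule *[OF \<delta>(3,2,4,5)])
      show "fst (\<delta> 0) \<in> carrier A" using z \<delta>(4) by (simp add: frame_bundle_iff[OF A])
    qed
    then show "w = ?w" using frame_inj[OF u] by (simp add: matrix_eq inj_eq)
  qed (use * in blast)
  show "smooth_curve (frame_atlas A) I \<gamma> \<Longrightarrow> t \<in> I \<Longrightarrow> \<gamma> t = z \<Longrightarrow> velocity (frame_atlas A) \<gamma> t = X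
      \<Longrightarrow> has_covd_along A D (\<lambda>t. fst (\<gamma> t)) (\<lambda>s. snd (\<gamma> s) y) t (snd z (connection_form A D z X *v y))"
    unfolding eq by (rule *)
qed

lemma covd_frame_along:
  assumes \<gamma>: "smooth_curve (frame_atlas A) I \<gamma>" "t \<in> I"
  shows "has_covd_along A D (\<lambda>t. fst (\<gamma> t)) (\<lambda>s. snd (\<gamma> s) y) t
    (snd (\<gamma> t) (connection_form A D (\<gamma> t) (velocity (frame_atlas A) \<gamma> t) *v y))"
proof -
  have z: "\<gamma> t \<in> frame_bundle A" by (rule curve_mem_frame_bundle[OF A \<gamma>])
  then obtain c where c: "c \<in> charts_at A (fst (\<gamma> t))" by (auto simp: frame_bundle_iff[OF A] charts_at_def carrier_def)
  show ?thesis
    by (rule connection_form_chart(2)[OF z velocity_tangent[OF smooth_atlas_frame_atlas[OF A] \<gamma>] c \<gamma> refl refl])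
qed

lemma frame_form_chart:
  assumes z: "z \<in> frame_bundle A" and X: "X \<in> tangent_space (frame_atlas A) z" and c: "c \<in> charts_at A (fst z)"
  shows "frame_form A D z X = (let U = frame_matrix c (snd z); x = X (frame_chart A c)
    in (matrix_inv U *v fst x, matrix_inv U ** (snd x + conn_matrix A D c (fst z) (coord_field A c (fst x) (fst z)) ** U)))"
proof -
  have u: "snd z \<in> frames A (fst z)" using z by (simp add: frame_bundle_iff[OF A])
  show ?thesis
    using frame_inv_eq[OF A u c proj_push_tangent[OF z X]] connection_form_chart(1)[OF z X c]
    unfolding frame_form_def Let_def by (simp add: proj_push_eq_coord_field[OF z X c] coord_field_self[OF A c])
qed

lemma conn_matrix_lincomb:
  assumes "X \<in> tangent_space A p" "X' \<in> tangent_space A p" "c \<in> charts_at A p"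
  shows "conn_matrix A D c p (\<lambda>d. a *\<^sub>R X d + b *\<^sub>R X' d) = a *\<^sub>R conn_matrix A D c p X + b *\<^sub>R conn_matrix A D c p X'"
  unfolding matrix_eq
  by (simp add: matrix_vector_mult_add_rdistrib conn_matrix_apply christoffel_lincomb[OF A D assms] flip: scaleR_matrix_vector_assoc)

lemma linear_conn_matrix_coord:
  assumes c: "c \<in> charts_at A p"
  shows "linear (\<lambda>x. conn_matrix A D c p (coord_field A c x p))"
proof (rule linearI)
  fix x y r
  note ct = coord_field_tangent[OF A c]
  show "conn_matrix A D c p (coord_field A c (x + y) p) = conn_matrix A D c p (coord_field A c x p) + conn_matrix A D c p (coord_field A c y p)"
    using coord_field_lincomb[OF A c, of 1 x 1 y] conn_matrix_lincomb[OF ct[of x] ct[of y] c, of 1 1] by simp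
  show "conn_matrix A D c p (coord_field A c (r *\<^sub>R x) p) = r *\<^sub>R conn_matrix A D c p (coord_field A c x p)"
    using coord_field_lincomb[OF A c, of r x 0 x] conn_matrix_lincomb[OF ct[of x] ct[of x] c, of r 0] by simp
qed

lemma frame_vector_tangent:
  assumes z: "z \<in> frame_bundle A" shows "frame_vector A D z y \<in> tangent_space (frame_atlas A) z"
proof -
  have u: "snd z \<in> frames A (fst z)" "fst z \<in> carrier A" using z by (simp_all add: frame_bundle_iff[OF A])
  show ?thesis
    unfolding frame_vector_def Let_def
    by (rule coord_field_tangent[OF smooth_atlas_frame_atlas[OF A] frame_chart_at[OF u(1) some_chart[OF u(2)]]])
qed

lemma frame_form_of_coords:
  assumes z: "z \<in> frame_bundle A" and c: "c \<in> charts_at A (fst z)"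
  defines "U \<equiv> frame_matrix c (snd z)"
  shows "frame_form A D z (coord_field (frame_atlas A) (frame_chart A c)
     (U *v fst y, U ** snd y - conn_matrix A D c (fst z) (coord_field A c (U *v fst y) (fst z)) ** U) z) = y"
proof -
  have u: "snd z \<in> frames A (fst z)" using z by (simp_all add: frame_bundle_iff[OF A])
  note B = smooth_atlas_frame_atlas[OF A] and C = frame_chart_at[OF u c]
  have U: "invertible U" unfolding U_def by (rule invertible_frame_matrix[OF A u c])
  show ?thesis
    using frame_form_chart[OF z coord_field_tangent[OF B C] c]
    by (simp add: coord_field_self[OF B C] Let_def matrix_inv_cancel[OF U] flip: U_def)
qed

lemma frame_form_frame_vector:
  assumes z: "z \<in> frame_bundle A" shows "frame_form A D z (frame_vector A D z y) = y"
proof -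
  have "fst z \<in> carrier A" using z by (simp add: frame_bundle_iff[OF A])
  then show ?thesis
    unfolding frame_vector_def Let_def by (intro frame_form_of_coords z some_chart)
qed

lemma frame_form_inj:
  assumes z: "z \<in> frame_bundle A" and X: "X \<in> tangent_space (frame_atlas A) z" "Y \<in> tangent_space (frame_atlas A) z"
    and eq: "frame_form A D z X = frame_form A D z Y"
  shows "X = Y"
proof -
  have u: "snd z \<in> frames A (fst z)" "fst z \<in> carrier A" using z by (simp_all add: frame_bundle_iff[OF A])
  then obtain c where c: "c \<in> charts_at A (fst z)" by (auto simp: charts_at_def carrier_def)
  let ?U = "frame_matrix c (snd z)" and ?C = "frame_chart A c"
  let ?G = "conn_matrix A D c (fst z)"
  have U: "invertible ?U" by (rule invertible_frame_matrix[OF A u(1) c])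
  have e: "matrix_inv ?U *v fst (X ?C) = matrix_inv ?U *v fst (Y ?C)"
    "matrix_inv ?U ** (snd (X ?C) + ?G (coord_field A c (fst (X ?C)) (fst z)) ** ?U)
     = matrix_inv ?U ** (snd (Y ?C) + ?G (coord_field A c (fst (Y ?C)) (fst z)) ** ?U)"
    using eq by (simp_all add: frame_form_chart[OF z X(1) c] frame_form_chart[OF z X(2) c] Let_def)
  have 1: "fst (X ?C) = fst (Y ?C)" using arg_cong[OF e(1), of "(*v) ?U"] by (simp add: matrix_inv_cancel[OF U])
  have "snd (X ?C) = snd (Y ?C)" using arg_cong[OF e(2), of "(**) ?U"] 1 by (simp add: matrix_inv_cancel[OF U])
  with 1 show ?thesis
    by (intro tangent_eqI[OF smooth_atlas_frame_atlas[OF A] X frame_chart_at[OF u(1) c]]) (simp add: prod_eq_iff)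
qed

lemma frame_vector_frame_form:
  assumes z: "z \<in> frame_bundle A" and X: "X \<in> tangent_space (frame_atlas A) z"
  shows "frame_vector A D z (frame_form A D z X) = X"
  by (rule frame_form_inj[OF z frame_vector_tangent[OF z] X frame_form_frame_vector[OF z]])

text \<open>Both sides have the same image under \<open>frame_form\<close>, which is injective on the tangent space.\<close>

lemma frame_vector_chart:
  assumes z: "z \<in> frame_bundle A" and c: "c \<in> charts_at A (fst z)"
  shows "frame_vector A D z y (frame_chart A c) = (let U = frame_matrix c (snd z); a = U *v fst y
    in (a, U ** snd y - conn_matrix A D c (fst z) (coord_field A c a (fst z)) ** U))" (is "_ = ?r")
proof -
  have u: "snd z \<in> frames A (fst z)" using z by (simp_all add: frame_bundle_iff[OF A])
  note B = smooth_atlas_frame_atlas[OF A] and C = frame_chart_at[OF u c]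
  have "frame_vector A D z y = coord_field (frame_atlas A) (frame_chart A c) ?r z"
    by (rule frame_form_inj[OF z frame_vector_tangent[OF z] coord_field_tangent[OF B C]])
      (simp add: frame_form_frame_vector[OF z] frame_form_of_coords[OF z c] Let_def)
  then show ?thesis by (simp add: coord_field_self[OF B C])
qed

lemma frame_form_lincomb:
  assumes z: "z \<in> frame_bundle A" and X: "X \<in> tangent_space (frame_atlas A) z" and Y: "Y \<in> tangent_space (frame_atlas A) z"
  shows "frame_form A D z (\<lambda>C. a *\<^sub>R X C + b *\<^sub>R Y C) = a *\<^sub>R frame_form A D z X + b *\<^sub>R frame_form A D z Y"
proof -
  have u: "snd z \<in> frames A (fst z)" "fst z \<in> carrier A" using z by (simp_all add: frame_bundle_iff[OF A])
  then obtain c where c: "c \<in> charts_at A (fst z)" by (auto simp: charts_at_def carrier_def)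
  note lin = linear_conn_matrix_coord[OF c]
  note bb = bounded_bilinear_matrix_mult
  show ?thesis
    unfolding frame_form_chart[OF z tangent_lincomb[OF smooth_atlas_frame_atlas[OF A] X Y] c]
      frame_form_chart[OF z X c] frame_form_chart[OF z Y c] Let_def
    by (simp add: linear_add[OF lin] linear_cmul[OF lin] matrix_vector_right_distrib matrix_vector_mult_scaleR
        bounded_bilinear.add_left[OF bb] bounded_bilinear.add_right[OF bb]
        bounded_bilinear.scaleR_left[OF bb] bounded_bilinear.scaleR_right[OF bb] scaleR_right_distrib)
qed

end

context
  fixes A :: "('m, real^'n) atlas"
  assumes A: "smooth_atlas A"
begin

lemma frame_atlas_points:
  assumes W: "W \<subseteq> frame_bundle A" and c: "c \<in> A" and x: "x \<in> snd (frame_chart A c) ` (W \<inter> fst (frame_chart A c))"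
  defines "z \<equiv> chart_inv (frame_chart A c) x"
  shows "z \<in> W" "z \<in> frame_bundle A" "c \<in> charts_at A (fst z)" "fst z = chart_inv c (fst x)"
    "frame_matrix c (snd z) = snd x" "snd c (fst z) = fst x" "fst x \<in> snd c ` fst c" "invertible (snd x)"
proof -
  note B = smooth_atlas_frame_atlas[OF A]
  have C: "frame_chart A c \<in> frame_atlas A" using c by (simp add: frame_atlas_def)
  note m = chart_inv_mem[OF B C x, folded z_def]
  show "z \<in> W" by (rule m(1))
  then show zb: "z \<in> frame_bundle A" using W by blast
  have zc: "fst z \<in> fst c" using m(2) by (simp add: mem_frame_chart)
  then show ch: "c \<in> charts_at A (fst z)" using c by (simp add: charts_at_def)
  show e: "frame_matrix c (snd z) = snd x" "snd c (fst z) = fst x"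
    using arg_cong[OF m(3), of snd] arg_cong[OF m(3), of fst] by (simp_all add: snd_frame_chart)
  show "fst z = chart_inv c (fst x)" using chart_inv_left[OF A c zc] e(2) by simp
  show "fst x \<in> snd c ` fst c" using zc e(2) by (metis image_eqI)
  show "invertible (snd x)" using invertible_frame_matrix[OF A _ ch, of "snd z"] zb e(1) by (simp add: frame_bundle_iff[OF A])
qed

text \<open>Smoothness on the frame bundle is checked on an expression \<open>g\<close> in the chart coordinates
  \<open>x = (snd c p, U)\<close> that represents \<open>h\<close>.\<close>

lemma frame_chart_smoothI:
  assumes W: "mopen (frame_atlas A) W" and c: "c \<in> A"
    and g: "smooth_on (snd (frame_chart A c) ` (W \<inter> fst (frame_chart A c))) g"
    and eq: "\<And>z x. z \<in> W \<Longrightarrow> z \<in> frame_bundle A \<Longrightarrow> c \<in> charts_at A (fst z) \<Longrightarrow> z = chart_inv (frame_chart A c) x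
      \<Longrightarrow> fst z = chart_inv c (fst x) \<Longrightarrow> frame_matrix c (snd z) = snd x \<Longrightarrow> h z = g x"
  shows "smooth_on (snd (frame_chart A c) ` (W \<inter> fst (frame_chart A c))) (\<lambda>x. h (chart_inv (frame_chart A c) x))"
proof -
  have C: "frame_chart A c \<in> frame_atlas A" using c by (simp add: frame_atlas_def)
  have W': "W \<subseteq> frame_bundle A" using W by (simp add: mopen_def carrier_frame_atlas)
  have "h (chart_inv (frame_chart A c) x) = g x" if "x \<in> snd (frame_chart A c) ` (W \<inter> fst (frame_chart A c))" for x
    by (rule eq) (use frame_atlas_points[OF W' c that] in simp_all)
  then show ?thesis
    using smooth_on_cong[OF open_chart_image[OF smooth_atlas_frame_atlas[OF A] W C], of "\<lambda>x. h (chart_inv (frame_chart A c) x)" g] g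
    by blast
qed

lemma frame_chart_coords_smooth:
  assumes W: "mopen (frame_atlas A) W" and c: "c \<in> A"
  defines "S \<equiv> snd (frame_chart A c) ` (W \<inter> fst (frame_chart A c))"
  shows "open S" "smooth_on S (fst :: _ \<Rightarrow> real^'n)" "smooth_on S (snd :: _ \<Rightarrow> real^'n^'n)"
    "smooth_on S (\<lambda>x :: (real^'n) \<times> (real^'n^'n). matrix_inv (snd x))" "fst ` S \<subseteq> snd c ` fst c"
proof -
  have C: "frame_chart A c \<in> frame_atlas A" using c by (simp add: frame_atlas_def)
  have W': "W \<subseteq> frame_bundle A" using W by (simp add: mopen_def carrier_frame_atlas)
  show op: "open S" unfolding S_def by (rule open_chart_image[OF smooth_atlas_frame_atlas[OF A] W C])
  show "smooth_on S fst" by (rule smooth_on_fst[OF op smooth_on_id[OF op]])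
  show s: "smooth_on S snd" by (rule smooth_on_snd[OF op smooth_on_id[OF op]])
  show "smooth_on S (\<lambda>x. matrix_inv (snd x))"
    by (rule smooth_on_matrix_inv[OF op s]) (use frame_atlas_points(8)[OF W' c] S_def in blast)
  show "fst ` S \<subseteq> snd c ` fst c" using frame_atlas_points(7)[OF W' c] S_def by blast
qed

lemma smooth_map_frame_atlasI:
  assumes "\<And>c. c \<in> A \<Longrightarrow> smooth_on (snd (frame_chart A c) ` (W \<inter> fst (frame_chart A c))) (\<lambda>x. h (chart_inv (frame_chart A c) x))"
  shows "smooth_map (frame_atlas A) W h"
  using assms by (auto simp: smooth_map_def frame_atlas_def)

lemma smooth_on_base_compose:
  assumes W: "mopen (frame_atlas A) W" and c: "c \<in> A" and g: "smooth_map A (fst c) g"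
  shows "smooth_on (snd (frame_chart A c) ` (W \<inter> fst (frame_chart A c))) (\<lambda>x. g (chart_inv c (fst x)))"
proof -
  have "smooth_on (snd c ` fst c) (\<lambda>x. g (chart_inv c x))" using bspec[OF g[unfolded smooth_map_def] c] by simp
  then show ?thesis
    by (rule smooth_on_compose[OF frame_chart_coords_smooth(1)[OF W c] _ frame_chart_coords_smooth(2)[OF W c] frame_chart_coords_smooth(5)[OF W c]])
qed

lemma smooth_map_pullback:
  assumes W: "mopen A W" and g: "smooth_map A W g"
  shows "smooth_map (frame_atlas A) (Sigma W (frames A)) (\<lambda>z. g (fst z))"
proof (rule smooth_map_frame_atlasI)
  fix c assume c: "c \<in> A"
  note W' = mopen_frame_bundle_over[OF A W]
  let ?S = "snd (frame_chart A c) ` (Sigma W (frames A) \<inter> fst (frame_chart A c))"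
  have "smooth_on (snd c ` (W \<inter> fst c)) (\<lambda>x. g (chart_inv c x))" using bspec[OF g[unfolded smooth_map_def] c] by simp
  then have "smooth_on ?S (\<lambda>x. g (chart_inv c (fst x)))"
    by (rule smooth_on_compose[OF frame_chart_coords_smooth(1)[OF W' c] _ frame_chart_coords_smooth(2)[OF W' c]])
      (unfold frame_chart_image[OF A c], auto)
  then show "smooth_on ?S (\<lambda>x. g (fst (chart_inv (frame_chart A c) x)))"
    by (rule frame_chart_smoothI[OF W' c]) simp
qed

lemma smooth_map_frame_coords:
  assumes W: "mopen A W" and Y: "smooth_vector_field A W Y"
  shows "smooth_map (frame_atlas A) (Sigma W (frames A)) (\<lambda>z. inv (snd z) (Y (fst z)))"
proof (rule smooth_map_frame_atlasI)
  fix c assume c: "c \<in> A"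
  note W' = mopen_frame_bundle_over[OF A W]
  let ?S = "snd (frame_chart A c) ` (Sigma W (frames A) \<inter> fst (frame_chart A c))"
  note cs = frame_chart_coords_smooth[OF W' c]
  have "smooth_on (snd c ` (W \<inter> fst c)) (\<lambda>x. Y (chart_inv c x) c)" using Y c by (simp add: smooth_vector_field_def)
  then have "smooth_on ?S (\<lambda>x. Y (chart_inv c (fst x)) c)"
    by (rule smooth_on_compose[OF cs(1) _ cs(2)]) (unfold frame_chart_image[OF A c], auto)
  then have "smooth_on ?S (\<lambda>x. matrix_inv (snd x) *v Y (chart_inv c (fst x)) c)"
    by (rule smooth_on_matrix_vector_mult[OF cs(1,4)])
  then show "smooth_on ?S (\<lambda>x. inv (snd (chart_inv (frame_chart A c) x)) (Y (fst (chart_inv (frame_chart A c) x))))"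
  proof (rule frame_chart_smoothI[OF W' c])
    fix z x assume "z \<in> Sigma W (frames A)" "c \<in> charts_at A (fst z)"
      and e: "fst z = chart_inv c (fst x)" "frame_matrix c (snd z) = snd x"
    then have "inv (snd z) (Y (fst z)) = matrix_inv (frame_matrix c (snd z)) *v Y (fst z) c"
      using Y by (intro frame_inv_eq[OF A]) (auto simp: smooth_vector_field_def)
    then show "inv (snd z) (Y (fst z)) = matrix_inv (snd x) *v Y (chart_inv c (fst x)) c" by (simp add: e)
  qed
qed

context
  fixes D :: "('m, real^'n) covd"
  assumes D: "linear_connection A D"
begin

lemma smooth_on_conn_matrix:
  assumes W: "mopen (frame_atlas A) W" and c: "c \<in> A"
    and a: "smooth_on (snd (frame_chart A c) ` (W \<inter> fst (frame_chart A c))) a"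
  shows "smooth_on (snd (frame_chart A c) ` (W \<inter> fst (frame_chart A c)))
    (\<lambda>x. conn_matrix A D c (chart_inv c (fst x)) (coord_field A c (a x) (chart_inv c (fst x))))" (is "smooth_on ?S ?f")
proof -
  note cs = frame_chart_coords_smooth[OF W c]
  have W': "W \<subseteq> frame_bundle A" using W by (simp add: mopen_def carrier_frame_atlas)
  have "smooth_on ?S (\<lambda>x. christoffel A D c (chart_inv c (fst x)) (coord_field A c b (chart_inv c (fst x))) v)" for b v
    by (rule smooth_on_base_compose[OF W c smooth_map_christoffel[OF A D c]])
  then have "smooth_on ?S (\<lambda>x. \<Sum>b\<in>Basis. (a x \<bullet> b) *\<^sub>R
      conn_matrix A D c (chart_inv c (fst x)) (coord_field A c b (chart_inv c (fst x))))"
    unfolding conn_matrix_def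
    by (intro smooth_on_sum smooth_on_scaleR smooth_on_inner smooth_on_const smooth_on_matrix cs(1) a)
  moreover have "?f x = (\<Sum>b\<in>Basis. (a x \<bullet> b) *\<^sub>R
      conn_matrix A D c (chart_inv c (fst x)) (coord_field A c b (chart_inv c (fst x))))" if "x \<in> ?S" for x
  proof -
    note p = frame_atlas_points(3,4)[OF W' c that]
    have ch: "c \<in> charts_at A (chart_inv c (fst x))" using p by simp
    note lin = linear_conn_matrix_coord[OF A D ch]
    show ?thesis
      by (subst euclidean_representation[of "a x", symmetric]) (simp only: linear_sum[OF lin] linear_cmul[OF lin])
  qed
  ultimately show ?thesis using smooth_on_cong[OF cs(1), of ?f] by simp
qed

lemma frame_form_smooth:
  assumes W: "mopen (frame_atlas A) W" and Y: "smooth_vector_field (frame_atlas A) W Y"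
  shows "smooth_map (frame_atlas A) W (\<lambda>z. frame_form A D z (Y z))"
proof (rule smooth_map_frame_atlasI)
  fix c assume c: "c \<in> A"
  let ?C = "frame_chart A c"
  let ?S = "snd ?C ` (W \<inter> fst ?C)"
  note cs = frame_chart_coords_smooth[OF W c]
  define y where "y = (\<lambda>x. Y (chart_inv ?C x) ?C)"
  have "?C \<in> frame_atlas A" using c by (simp add: frame_atlas_def)
  then have y: "smooth_on ?S y" using Y by (simp add: smooth_vector_field_def y_def)
  have "smooth_on ?S (\<lambda>x. (matrix_inv (snd x) *v fst (y x), matrix_inv (snd x) ** (snd (y x)
     + conn_matrix A D c (chart_inv c (fst x)) (coord_field A c (fst (y x)) (chart_inv c (fst x))) ** snd x)))"
    by (intro smooth_on_Pair smooth_on_matrix_vector_mult smooth_on_matrix_mult smooth_on_add smooth_on_conn_matrix[OF W c]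
        smooth_on_fst smooth_on_snd[OF _ y] cs y)
  then show "smooth_on ?S (\<lambda>x. frame_form A D (chart_inv ?C x) (Y (chart_inv ?C x)))"
  proof (rule frame_chart_smoothI[OF W c])
    fix z x assume z: "z \<in> W" "z \<in> frame_bundle A" "c \<in> charts_at A (fst z)" "z = chart_inv ?C x"
      and e: "fst z = chart_inv c (fst x)" "frame_matrix c (snd z) = snd x"
    have "Y z \<in> tangent_space (frame_atlas A) z" using Y z by (simp add: smooth_vector_field_def)
    from frame_form_chart[OF A D z(2) this z(3)]
    show "frame_form A D z (Y z) = (matrix_inv (snd x) *v fst (y x), matrix_inv (snd x) ** (snd (y x)
     + conn_matrix A D c (chart_inv c (fst x)) (coord_field A c (fst (y x)) (chart_inv c (fst x))) ** snd x))"
      unfolding y_def Let_def e z(4)[symmetric] .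
  qed
qed

lemma frame_vector_smooth:
  assumes W: "mopen (frame_atlas A) W" and h: "smooth_map (frame_atlas A) W h"
  shows "smooth_vector_field (frame_atlas A) W (\<lambda>z. frame_vector A D z (h z))"
  unfolding smooth_vector_field_def
proof (intro conjI ballI)
  show "frame_vector A D z (h z) \<in> tangent_space (frame_atlas A) z" if "z \<in> W" for z
    by (rule frame_vector_tangent[OF A D]) (use W that in \<open>auto simp: mopen_def carrier_frame_atlas\<close>)
  fix C assume "C \<in> frame_atlas A"
  then obtain c where c: "c \<in> A" "C = frame_chart A c" by (auto simp: frame_atlas_def)
  let ?C = "frame_chart A c"
  let ?S = "snd ?C ` (W \<inter> fst ?C)"
  note cs = frame_chart_coords_smooth[OF W c(1)]
  define y where "y = (\<lambda>x. h (chart_inv ?C x))"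
  have "?C \<in> frame_atlas A" using c by (simp add: frame_atlas_def)
  then have y: "smooth_on ?S y" using h by (simp add: smooth_map_def y_def)
  have a: "smooth_on ?S (\<lambda>x. snd x *v fst (y x))"
    by (intro smooth_on_matrix_vector_mult smooth_on_fst cs y)
  have "smooth_on ?S (\<lambda>x. (snd x *v fst (y x), snd x ** snd (y x)
     - conn_matrix A D c (chart_inv c (fst x)) (coord_field A c (snd x *v fst (y x)) (chart_inv c (fst x))) ** snd x))"
    by (intro smooth_on_Pair smooth_on_matrix_mult smooth_on_diff smooth_on_conn_matrix[OF W c(1)] a
        smooth_on_snd[OF _ y] cs)
  then have "smooth_on ?S (\<lambda>x. frame_vector A D (chart_inv ?C x) (h (chart_inv ?C x)) ?C)"
  proof (rule frame_chart_smoothI[OF W c(1)])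
    fix z x assume z: "z \<in> W" "z \<in> frame_bundle A" "c \<in> charts_at A (fst z)" "z = chart_inv ?C x"
      and e: "fst z = chart_inv c (fst x)" "frame_matrix c (snd z) = snd x"
    from frame_vector_chart[OF A D z(2,3)]
    show "frame_vector A D z (h z) ?C = (snd x *v fst (y x), snd x ** snd (y x)
     - conn_matrix A D c (chart_inv c (fst x)) (coord_field A c (snd x *v fst (y x)) (chart_inv c (fst x))) ** snd x)"
      unfolding y_def Let_def e z(4)[symmetric] .
  qed
  then show "smooth_on (snd C ` (W \<inter> fst C)) (\<lambda>x. frame_vector A D (chart_inv C x) (h (chart_inv C x)) C)"
    by (simp add: c(2))
qed

text \<open>The conditions \<open>\<omega> = 0\<close> and \<open>\<pi>\<^sub>* Z = X\<close> prescribe both components of \<open>Z\<close> in the parallelization, so exactly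
  one vector satisfies them.\<close>

lemma horizontal_lift_eq:
  assumes z: "z \<in> frame_bundle A" and X: "X \<in> tangent_space A (fst z)"
  shows "horizontal_lift A D z X = frame_vector A D z (inv (snd z) X, 0)"
proof -
  have u: "snd z \<in> frames A (fst z)" using z by (simp add: frame_bundle_iff[OF A])
  let ?Z = "frame_vector A D z (inv (snd z) X, 0)"
  note T = frame_vector_tangent[OF A D z, of "(inv (snd z) X, 0)"]
  have f: "inv (snd z) (proj_push A z ?Z) = inv (snd z) X" "connection_form A D z ?Z = 0"
    using frame_form_frame_vector[OF A D z, of "(inv (snd z) X, 0)"] by (simp_all add: frame_form_def)
  have "proj_push A z ?Z = X"
    using f(1) frame_inv_right[OF u X] frame_inv_right[OF u proj_push_tangent[OF A D z T]] by metis
  then show ?thesis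
    unfolding horizontal_lift_def
  proof (intro the_equality conjI T f)
    fix Z assume Z: "Z \<in> tangent_space (frame_atlas A) z \<and> connection_form A D z Z = 0 \<and> proj_push A z Z = X"
    then have "frame_form A D z Z = (inv (snd z) X, 0)" by (simp add: frame_form_def)
    then show "Z = ?Z" using frame_vector_frame_form[OF A D z] Z by metis
  qed
qed

text \<open>Let \<open>a = u\<^sup>-\<^sup>1 Y\<close>, so that \<open>U a\<close> is the coordinate vector of \<open>Y\<close>, which depends on the base point only.
  Differentiating the product along a horizontal vector, for which \<open>U' = - \<Gamma> U\<close>, gives
  \<open>U a' = Y' + \<Gamma> Y\<close>, the coordinate vector of the covariant derivative.\<close>

lemma horizontal_derivative_of_frame_coords:
  assumes W: "mopen A W" and Y: "smooth_vector_field A W Y" and z: "z \<in> frame_bundle A" "fst z \<in> W"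
    and X: "X \<in> tangent_space A (fst z)"
  shows "snd z (deriv_along (frame_atlas A) z (horizontal_lift A D z X) (\<lambda>q. inv (snd q) (Y (fst q)))) = D (fst z) X Y"
proof -
  let ?B = "frame_atlas A"
  note B = smooth_atlas_frame_atlas[OF A]
  have u: "snd z \<in> frames A (fst z)" "fst z \<in> carrier A" using z by (simp_all add: frame_bundle_iff[OF A])
  then obtain c where c: "c \<in> charts_at A (fst z)" by (auto simp: charts_at_def carrier_def)
  let ?C = "frame_chart A c" and ?U = "frame_matrix c (snd z)"
  have cA: "c \<in> A" "fst z \<in> fst c" using c by (auto simp: charts_at_def)
  have C: "?C \<in> charts_at ?B z" by (rule frame_chart_at[OF u(1) c])
  then have CB: "?C \<in> ?B" "z \<in> fst ?C" by (auto simp: charts_at_def)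
  define Z where "Z = horizontal_lift A D z X"
  have Zv: "Z = frame_vector A D z (inv (snd z) X, 0)" unfolding Z_def by (rule horizontal_lift_eq[OF z(1) X])
  have ZT: "Z \<in> tangent_space ?B z" unfolding Zv by (rule frame_vector_tangent[OF A D z(1)])
  have UX: "?U *v inv (snd z) X = X c" using frame_apply[OF u(1), of "inv (snd z) X" c] frame_inv_right[OF u(1) X] by simp
  have ZC: "fst (Z ?C) = X c" "snd (Z ?C) = - (conn_matrix A D c (fst z) X ** ?U)"
    unfolding Zv frame_vector_chart[OF A D z(1) c] by (simp_all add: Let_def UX coord_field_of_tangent[OF A X c]
        bounded_bilinear.zero_right[OF bounded_bilinear_matrix_mult])
  have pZ: "proj_push A z Z = X"
    using proj_push_eq_coord_field[OF A D z(1) ZT c] by (simp add: ZC coord_field_of_tangent[OF A X c])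
  let ?V = "Sigma W (frames A) \<inter> fst ?C"
  have zV: "z \<in> ?V" using z(2) u(1) CB by (cases z) (auto simp: mem_frame_chart)
  have V: "mopen ?B ?V" by (rule mopen_Int[OF B mopen_frame_bundle_over[OF A W] mopen_chart[OF B CB(1)]])
  let ?a = "\<lambda>q. inv (snd q) (Y (fst q))"
  have a: "smooth_map ?B ?V ?a" by (rule smooth_map_subset[OF smooth_map_frame_coords[OF W Y]]) auto
  have M: "smooth_map ?B ?V (\<lambda>q. snd (snd ?C q))"
    by (rule smooth_map_bounded_linear[OF B V bounded_linear_snd smooth_map_subset[OF deriv_along_chart(1)[OF B C ZT]]]) auto
  have dM: "deriv_along ?B z Z (\<lambda>q. snd (snd ?C q)) = snd (Z ?C)"
    using deriv_along_bounded_linear[OF B mopen_chart[OF B CB(1)] deriv_along_chart(1)[OF B C ZT] CB(2) bounded_linear_snd]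
    by (simp add: deriv_along_chart(2)[OF B C ZT])
  have base: "smooth_map A (W \<inter> fst c) (\<lambda>p. Y p c)" by (rule smooth_map_component[OF A W Y cA(1)])
  have Wc: "mopen A (W \<inter> fst c)" by (rule mopen_Int[OF A W mopen_chart[OF A cA(1)]])
  \<comment> \<open>A curve with velocity \<open>Z\<close> projects to one with velocity \<open>X\<close>.\<close>
  have dY: "deriv_along ?B z Z (\<lambda>q. Y (fst q) c) = deriv_along A (fst z) X (\<lambda>p. Y p c)"
  proof -
    have zc: "z \<in> carrier ?B" using z by (simp add: carrier_frame_atlas)
    obtain J \<delta> where \<delta>: "open_interval J" "0 \<in> J" "smooth_curve ?B J \<delta>" "\<delta> 0 = z" "velocity ?B \<delta> 0 = Z"
      by (rule exists_curve_with_velocity[OF B zc ZT])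
    have mem: "z \<in> Sigma (W \<inter> fst c) (frames A)" using z(2) u cA by (cases z) simp
    have 1: "((\<lambda>s. Y (fst (\<delta> s)) c) has_vector_derivative deriv_along ?B z Z (\<lambda>q. Y (fst q) c)) (at 0)"
      using curve_compose_has_vector_derivative[OF B \<delta>(3,2) mopen_frame_bundle_over[OF A Wc] smooth_map_pullback[OF Wc base]] mem
      by (simp add: \<delta>)
    have "velocity A (\<lambda>t. fst (\<delta> t)) 0 = X" using velocity_eq_proj_push[OF A D \<delta>(3,2)] by (simp add: \<delta> pZ)
    then have "((\<lambda>s. Y (fst (\<delta> s)) c) has_vector_derivative deriv_along A (fst z) X (\<lambda>p. Y p c)) (at 0)"
      using curve_compose_has_vector_derivative[OF A smooth_curve_proj[OF A \<delta>(3)] \<delta>(2) Wc base] z(2) cA(2)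
      by (simp add: \<delta>(4))
    with 1 show ?thesis by (rule vector_derivative_unique_at)
  qed
  have "deriv_along ?B z Z (\<lambda>q. snd (snd ?C q) *v ?a q) = deriv_along ?B z Z (\<lambda>q. Y (fst q) c)"
  proof (rule deriv_along_cong[OF B V zV])
    fix q assume "q \<in> ?V"
    then have q: "fst q \<in> W" "snd q \<in> frames A (fst q)" by auto
    then have "Y (fst q) \<in> tangent_space A (fst q)" using Y by (simp add: smooth_vector_field_def)
    then show "snd (snd ?C q) *v ?a q = Y (fst q) c"
      using frame_apply[OF q(2), of "?a q" c] frame_inv_right[OF q(2)] by (simp add: snd_frame_chart)
  qed
  then have "?U *v deriv_along ?B z Z ?a + snd (Z ?C) *v ?a z = deriv_along A (fst z) X (\<lambda>p. Y p c)"
    using deriv_along_bounded_bilinear[OF B V M a zV bounded_bilinear_matrix_vector_mult, of Z]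
    by (simp add: dM[unfolded snd_frame_chart snd_conv] dY snd_frame_chart)
  moreover have YT: "Y (fst z) \<in> tangent_space A (fst z)" using Y z by (simp add: smooth_vector_field_def)
  have "snd (Z ?C) *v ?a z = - christoffel A D c (fst z) X (Y (fst z) c)"
    using frame_apply[OF u(1), of "?a z" c] frame_inv_right[OF u(1) YT]
    by (simp add: ZC bounded_bilinear.minus_left[OF bounded_bilinear_matrix_vector_mult] conn_matrix_apply flip: matrix_vector_mul_assoc)
  ultimately have "?U *v deriv_along ?B z Z ?a = D (fst z) X Y c"
    using covd_in_chart[OF A D W Y z(2) X c] by (simp add: algebra_simps)
  then show ?thesis
    unfolding Z_def[symmetric]
    by (intro tangent_eqI[OF A frame_tangent[OF u(1)] covd_tangent[OF A D W Y z(2) X] c]) (simp add: frame_apply[OF u(1)])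
qed

end

end

section \<open>The lift determined by a tensor field\<close>

text \<open>The function \<open>f(u) = u\<^sup>-\<^sup>1 F u\<close> with values in \<open>gl(n)\<close>.\<close>

definition frame_tensor ::
    "('m \<Rightarrow> ('m, real^'n) tvec \<Rightarrow> ('m, real^'n) tvec) \<Rightarrow> ('m, 'n) frame_point \<Rightarrow> real^'n^'n" where
  "frame_tensor F z = matrix (\<lambda>y. inv (snd z) (F (fst z) (snd z y)))"

definition tensor_matrix ::
    "('m, real^'n) atlas \<Rightarrow> ('m \<Rightarrow> ('m, real^'n) tvec \<Rightarrow> ('m, real^'n) tvec) \<Rightarrow> ('m, real^'n) chart \<Rightarrow> 'm \<Rightarrow> real^'n^'n" where
  "tensor_matrix A F c p = matrix (\<lambda>v. F p (coord_field A c v p) c)"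

text \<open>The coefficient is linear in \<open>y\<close>.  It is \<open>0\<close> for horizontal vectors, which keeps the connection a
  lift, and it is \<open>1\<close> when the \<open>\<omega>\<close>-component of \<open>y\<close> equals \<open>f\<close>, which lets this equality persist along
  geodesics.\<close>

definition frame_correction ::
    "('m, real^'n) atlas \<Rightarrow> ('m \<Rightarrow> ('m, real^'n) tvec \<Rightarrow> ('m, real^'n) tvec) \<Rightarrow> ('m, 'n) frame_point
      \<Rightarrow> ('m, 'n) frame_tvec \<Rightarrow> (real^'n) \<times> (real^'n^'n) \<Rightarrow> (real^'n) \<times> (real^'n^'n)" where
  "frame_correction A F z X y =
     (0, ((snd y \<bullet> frame_tensor F z) / (frame_tensor F z \<bullet> frame_tensor F z)) *\<^sub>R deriv_along (frame_atlas A) z X (frame_tensor F))"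

context
  fixes A :: "('m, real^'n) atlas"
  assumes A: "smooth_atlas A"
begin

context
  fixes F :: "'m \<Rightarrow> ('m, real^'n) tvec \<Rightarrow> ('m, real^'n) tvec"
  assumes F: "tensor_field_11 A F"
begin

lemma tensor_tangent: "p \<in> carrier A \<Longrightarrow> v \<in> tangent_space A p \<Longrightarrow> F p v \<in> tangent_space A p"
  using F unfolding tensor_field_11_def by blast

lemma tensor_lincomb:
  "p \<in> carrier A \<Longrightarrow> v \<in> tangent_space A p \<Longrightarrow> w \<in> tangent_space A p
    \<Longrightarrow> F p (\<lambda>c. a *\<^sub>R v c + b *\<^sub>R w c) = (\<lambda>c. a *\<^sub>R F p v c + b *\<^sub>R F p w c)"
  using F unfolding tensor_field_11_def by blast

lemma linear_tensor_coord:
  assumes c: "c \<in> charts_at A p"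
  shows "linear (\<lambda>v. F p (coord_field A c v p) c)"
proof (rule linearI)
  have p: "p \<in> carrier A" using c by (auto simp: charts_at_def carrier_def)
  note ct = coord_field_tangent[OF A c]
  fix x y r
  show "F p (coord_field A c (x + y) p) c = F p (coord_field A c x p) c + F p (coord_field A c y p) c"
    using coord_field_lincomb[OF A c, of 1 x 1 y] tensor_lincomb[OF p ct[of x] ct[of y], of 1 1] by simp
  show "F p (coord_field A c (r *\<^sub>R x) p) c = r *\<^sub>R F p (coord_field A c x p) c"
    using coord_field_lincomb[OF A c, of r x 0 x] tensor_lincomb[OF p ct[of x] ct[of x], of r 0] by simp
qed

lemma tensor_matrix_apply:
  assumes c: "c \<in> charts_at A p" and v: "v \<in> tangent_space A p"
  shows "tensor_matrix A F c p *v v c = F p v c"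
  by (simp add: tensor_matrix_def matrix_apply[OF linear_tensor_coord[OF c]] coord_field_of_tangent[OF A v c])

lemma frame_tensor_chart:
  assumes z: "z \<in> frame_bundle A" and c: "c \<in> charts_at A (fst z)"
  shows "frame_tensor F z = matrix_inv (frame_matrix c (snd z)) ** tensor_matrix A F c (fst z) ** frame_matrix c (snd z)"
proof -
  have u: "snd z \<in> frames A (fst z)" "fst z \<in> carrier A" using z by (simp_all add: frame_bundle_iff[OF A])
  have "inv (snd z) (F (fst z) (snd z y)) = (matrix_inv (frame_matrix c (snd z)) ** tensor_matrix A F c (fst z) ** frame_matrix c (snd z)) *v y" for y
    using frame_inv_eq[OF A u(1) c tensor_tangent[OF u(2) frame_tangent[OF u(1)]]]
      tensor_matrix_apply[OF c frame_tangent[OF u(1), of y]]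
    by (simp add: frame_apply[OF u(1)] flip: matrix_vector_mul_assoc)
  then show ?thesis by (simp add: frame_tensor_def)
qed

lemma frame_tensor_apply:
  assumes z: "z \<in> frame_bundle A"
  shows "snd z (frame_tensor F z *v y) = F (fst z) (snd z y)"
proof -
  have u: "snd z \<in> frames A (fst z)" "fst z \<in> carrier A" using z by (simp_all add: frame_bundle_iff[OF A])
  then obtain c where c: "c \<in> charts_at A (fst z)" by (auto simp: charts_at_def carrier_def)
  note U = invertible_frame_matrix[OF A u(1) c]
  show ?thesis
  proof (rule tangent_eqI[OF A frame_tangent[OF u(1)] tensor_tangent[OF u(2) frame_tangent[OF u(1)]] c])
    show "snd z (frame_tensor F z *v y) c = F (fst z) (snd z y) c"
      using tensor_matrix_apply[OF c frame_tangent[OF u(1), of y]]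
      by (simp add: frame_apply[OF u(1)] frame_tensor_chart[OF z c] matrix_inv_cancel[OF U] flip: matrix_vector_mul_assoc)
  qed
qed

text \<open>With \<open>w = \<omega>(X)\<close>, the right-hand side says that the vertical projection of \<open>X\<close> is \<open>F\<close>.\<close>

lemma eq_frame_tensor_iff:
  assumes z: "z \<in> frame_bundle A"
  shows "w = frame_tensor F z \<longleftrightarrow> (\<forall>y. snd z (w *v y) = F (fst z) (snd z y))"
  using frame_inj[of "snd z" A "fst z"] z
  by (auto simp: matrix_eq frame_bundle_iff[OF A] inj_eq simp flip: frame_tensor_apply[OF z])

lemma frame_tensor_nonzero:
  assumes z: "z \<in> frame_bundle A" and F_nz: "\<exists>v\<in>tangent_space A (fst z). F (fst z) v \<noteq> (\<lambda>_. 0)"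
  shows "frame_tensor F z \<noteq> 0"
proof
  assume 0: "frame_tensor F z = 0"
  have u: "snd z \<in> frames A (fst z)" "fst z \<in> carrier A" using z by (simp_all add: frame_bundle_iff[OF A])
  obtain v where v: "v \<in> tangent_space A (fst z)" "F (fst z) v \<noteq> (\<lambda>_. 0)" using F_nz by blast
  have "F (fst z) v = snd z 0"
    using frame_tensor_apply[OF z, of "inv (snd z) v"] 0 by (simp add: frame_inv_right[OF u(1) v(1)])
  moreover have "snd z 0 = (\<lambda>_. 0)" using frame_apply[OF u(1), of 0] by auto
  ultimately show False using v(2) by simp
qed

lemma smooth_frame_tensor: "smooth_map (frame_atlas A) (carrier (frame_atlas A)) (frame_tensor F)"
proof (rule smooth_map_frame_atlasI[OF A])
  fix c assume c: "c \<in> A"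
  note W = mopen_carrier[OF smooth_atlas_frame_atlas[OF A]]
  note cs = frame_chart_coords_smooth[OF A W c]
  let ?S = "snd (frame_chart A c) ` (carrier (frame_atlas A) \<inter> fst (frame_chart A c))"
  have "smooth_vector_field A (fst c) (\<lambda>p. F p (coord_field A c v p))" for v
    using F mopen_chart[OF A c] smooth_coord_field[OF A c] unfolding tensor_field_11_def by blast
  from smooth_map_component[OF A mopen_chart[OF A c] this c]
  have "smooth_on ?S (\<lambda>x. F (chart_inv c (fst x)) (coord_field A c v (chart_inv c (fst x))) c)" for v
    by (intro smooth_on_base_compose[OF A W c, of "\<lambda>p. F p (coord_field A c v p) c"]) simp
  then have "smooth_on ?S (\<lambda>x. tensor_matrix A F c (chart_inv c (fst x)))"
    unfolding tensor_matrix_def by (intro smooth_on_matrix cs)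
  then have "smooth_on ?S (\<lambda>x. matrix_inv (snd x) ** tensor_matrix A F c (chart_inv c (fst x)) ** snd x)"
    by (intro smooth_on_matrix_mult cs)
  then show "smooth_on ?S (\<lambda>x. frame_tensor F (chart_inv (frame_chart A c) x))"
    by (rule frame_chart_smoothI[OF A W c]) (simp add: frame_tensor_chart)
qed

end

context
  fixes D :: "('m, real^'n) covd" and F :: "'m \<Rightarrow> ('m, real^'n) tvec \<Rightarrow> ('m, real^'n) tvec"
  assumes D: "linear_connection A D" and F: "tensor_field_11 A F"
    and F_nz: "\<forall>p\<in>carrier A. \<exists>v\<in>tangent_space A p. F p v \<noteq> (\<lambda>_. 0)"
begin

lemma parallelization_frame_bundle:
  "parallelization (frame_atlas A) (frame_form A D) (frame_vector A D) (frame_correction A F)"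
proof (rule parallelization.intro, unfold carrier_frame_atlas)
  note B = smooth_atlas_frame_atlas[OF A]
  note f = smooth_frame_tensor[OF F]
  show "smooth_atlas (frame_atlas A)" by (rule B)
  fix z X assume z: "z \<in> frame_bundle A" and X: "X \<in> tangent_space (frame_atlas A) z"
  show "linear (frame_correction A F z X)"
    by (rule linearI) (simp_all add: frame_correction_def inner_add_left add_divide_distrib scaleR_left_distrib)
  show "frame_correction A F z (\<lambda>C. a *\<^sub>R X C + b *\<^sub>R Y C) y = a *\<^sub>R frame_correction A F z X y + b *\<^sub>R frame_correction A F z Y y"
    if "Y \<in> tangent_space (frame_atlas A) z" for Y a b y
    using deriv_along_lincomb[OF B mopen_carrier[OF B] f _ X that] z
    by (simp add: frame_correction_def carrier_frame_atlas scaleR_right_distrib mult.commute)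
next
  note B = smooth_atlas_frame_atlas[OF A]
  fix W X and y :: "('m, 'n) frame_point \<Rightarrow> (real^'n) \<times> (real^'n^'n)"
  assume W: "mopen (frame_atlas A) W" and X: "smooth_vector_field (frame_atlas A) W X" and y: "smooth_map (frame_atlas A) W y"
  have f: "smooth_map (frame_atlas A) W (frame_tensor F)"
    by (rule smooth_map_subset[OF smooth_frame_tensor[OF F]]) (use W in \<open>simp add: mopen_def\<close>)
  note df = smooth_map_deriv_along[OF B W f X]
  show "smooth_map (frame_atlas A) W (\<lambda>p. frame_correction A F p (X p) (y p))"
    unfolding smooth_map_def
  proof
    fix C assume C: "C \<in> frame_atlas A"
    let ?S = "snd C ` (W \<inter> fst C)"
    have op: "open ?S" by (rule open_chart_image[OF B W C])
    have nz: "frame_tensor F (chart_inv C x) \<noteq> 0" if "x \<in> ?S" for x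
      using chart_inv_mem(1)[OF B C that] W
      by (intro frame_tensor_nonzero[OF F] bspec[OF F_nz]) (auto simp: mopen_def carrier_frame_atlas frame_bundle_def)
    show "smooth_on ?S (\<lambda>x. frame_correction A F (chart_inv C x) (X (chart_inv C x)) (y (chart_inv C x)))"
      unfolding frame_correction_def
      by (intro smooth_on_Pair smooth_on_scaleR smooth_on_divide smooth_on_inner smooth_on_snd smooth_on_const op)
        (use bspec[OF f[unfolded smooth_map_def] C] bspec[OF df[unfolded smooth_map_def] C] bspec[OF y[unfolded smooth_map_def] C] nz in simp_all)
  qed
qed (simp_all add: frame_vector_frame_form[OF A D] frame_form_frame_vector[OF A D] frame_vector_tangent[OF A D]
    frame_form_lincomb[OF A D] frame_form_smooth[OF A D] frame_vector_smooth[OF A D])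

text \<open>The components of a horizontal lift are \<open>(u\<^sup>-\<^sup>1 Y, 0)\<close>, so the correction vanishes, and the projection
  of the covariant derivative is \<open>u\<close> applied to the derivative of \<open>u\<^sup>-\<^sup>1 Y\<close>.\<close>

lemma is_lift_conn:
  "is_lift A D (parallelization.conn (frame_atlas A) (frame_form A D) (frame_vector A D) (frame_correction A F))"
  unfolding is_lift_def
proof (intro allI impI ballI)
  interpret P: parallelization "frame_atlas A" "frame_form A D" "frame_vector A D" "frame_correction A F"
    by (rule parallelization_frame_bundle)
  let ?B = "frame_atlas A"
  note B = smooth_atlas_frame_atlas[OF A]
  fix W Y z X assume W: "mopen A W" and Y: "smooth_vector_field A W Y" and z: "z \<in> frame_bundle A" "fst z \<in> W"
    and X: "X \<in> tangent_space A (fst z)"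
  have u: "snd z \<in> frames A (fst z)" using z by (simp add: frame_bundle_iff[OF A])
  let ?Z = "horizontal_lift A D z X" and ?a = "\<lambda>q. inv (snd q) (Y (fst q))" and ?V = "Sigma W (frames A)"
  let ?Y = "\<lambda>q. horizontal_lift A D q (Y (fst q))"
  have zV: "z \<in> ?V" using z(2) u by (cases z) simp
  note V = mopen_frame_bundle_over[OF A W]
  have PY: "frame_form A D q (?Y q) = (?a q, 0)" if "q \<in> ?V" for q
  proof -
    have q: "q \<in> frame_bundle A" "fst q \<in> W" using that W by (auto simp: frame_bundle_def mopen_def)
    then show ?thesis
      using Y by (simp add: horizontal_lift_eq[OF A D] frame_form_frame_vector[OF A D] smooth_vector_field_def)
  qed
  have bl: "bounded_linear (\<lambda>x :: real^'n. (x, 0 :: real^'n^'n))" by (intro bounded_linear_Pair bounded_linear_ident bounded_linear_zero)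
  have "deriv_along ?B z ?Z (\<lambda>q. frame_form A D q (?Y q)) = deriv_along ?B z ?Z (\<lambda>q. (?a q, 0))"
    by (rule deriv_along_cong[OF B V zV PY])
  also have "\<dots> = (deriv_along ?B z ?Z ?a, 0)"
    by (rule deriv_along_bounded_linear[OF B V smooth_map_frame_coords[OF A W Y] zV bl])
  finally have N: "P.conn z ?Z ?Y = frame_vector A D z (deriv_along ?B z ?Z ?a, 0)"
    unfolding P.conn_def using PY[OF zV] by (simp add: frame_correction_def)
  have "inv (snd z) (proj_push A z (P.conn z ?Z ?Y)) = deriv_along ?B z ?Z ?a"
    using frame_form_frame_vector[OF A D z(1), of "(deriv_along ?B z ?Z ?a, 0)"] unfolding N by (simp add: frame_form_def)
  moreover have "proj_push A z (P.conn z ?Z ?Y) \<in> tangent_space A (fst z)"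
    unfolding N by (rule proj_push_tangent[OF A D z(1) frame_vector_tangent[OF A D z(1)]])
  ultimately have "proj_push A z (P.conn z ?Z ?Y) = snd z (deriv_along ?B z ?Z ?a)"
    using frame_inv_right[OF u, of "proj_push A z (P.conn z ?Z ?Y)"] by simp
  then show "proj_push A z (P.conn z ?Z ?Y) = D (fst z) X Y"
    using horizontal_derivative_of_frame_coords[OF A D W Y z X] by simp
qed

end

end

section \<open>Linear ordinary differential equations\<close>

text \<open>Gronwall's argument.  On the compact interval between \<open>s\<close> and \<open>t\<close> the function \<open>k\<close> has a bound \<open>K\<close>; there
  \<open>|d|\<^sup>2 exp (- 2 K r)\<close> is nonincreasing and \<open>|d|\<^sup>2 exp (2 K r)\<close> is nondecreasing, which settles the times
  after and before \<open>s\<close>.\<close>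

lemma linear_ode_zero_unique:
  fixes d :: "real \<Rightarrow> 'a::real_inner"
  assumes I: "is_interval I" and s: "s \<in> I" "d s = 0" and t: "t \<in> I"
    and d: "\<And>r. r \<in> I \<Longrightarrow> (d has_vector_derivative d' r) (at r)"
    and k: "continuous_on I k" and le: "\<And>r. r \<in> I \<Longrightarrow> norm (d' r) \<le> k r * norm (d r)"
  shows "d t = 0"
proof -
  let ?S = "{min s t..max s t}"
  have "min s t \<in> I" "max s t \<in> I" using s(1) t by (simp_all add: min_def max_def)
  then have S: "?S \<subseteq> I" using mem_is_interval_1_I[OF I, of "min s t" "max s t"] by auto
  have "compact (k ` ?S)" by (intro compact_continuous_image continuous_on_subset[OF k S]) simp
  then have "bdd_above (k ` ?S)" by (intro bounded_imp_bdd_above compact_imp_bounded)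
  then obtain K where K: "\<And>r. r \<in> ?S \<Longrightarrow> k r \<le> K" by (force simp: bdd_above_def)
  define h where "h = (\<lambda>r. d r \<bullet> d r)"
  have h: "(h has_real_derivative 2 * (d r \<bullet> d' r)) (at r)" if "r \<in> ?S" for r
    using bounded_bilinear.has_vector_derivative[OF bounded_bilinear_inner d d, of r] that S
    by (auto simp: h_def has_real_derivative_iff_has_vector_derivative inner_commute)
  have bound: "\<bar>d r \<bullet> d' r\<bar> \<le> K * h r" if "r \<in> ?S" for r
  proof -
    have "\<bar>d r \<bullet> d' r\<bar> \<le> norm (d r) * norm (d' r)" by (rule Cauchy_Schwarz_ineq2)
    also have "\<dots> \<le> norm (d r) * (K * norm (d r))"
      using that S le[of r] mult_right_mono[OF K[OF that], of "norm (d r)"] by (intro mult_left_mono) auto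
    finally show ?thesis by (simp add: h_def power2_norm_eq_inner[symmetric] power2_eq_square algebra_simps)
  qed
  have "h t \<le> 0"
  proof (cases "s \<le> t")
    case True
    have "h t * exp (- 2 * K * t) \<le> h s * exp (- 2 * K * s)"
    proof (rule DERIV_nonpos_imp_nonincreasing[OF True])
      fix r assume "s \<le> r" "r \<le> t"
      then have r: "r \<in> ?S" using True by simp
      have "((\<lambda>r. h r * exp (- 2 * K * r)) has_real_derivative 2 * (d r \<bullet> d' r) * exp (- 2 * K * r) + h r * (exp (- 2 * K * r) * (- 2 * K))) (at r)"
        by (auto intro!: derivative_eq_intros h[OF r])
      moreover have "2 * (d r \<bullet> d' r) * exp (- 2 * K * r) + h r * (exp (- 2 * K * r) * (- 2 * K)) = 2 * (d r \<bullet> d' r - K * h r) * exp (- 2 * K * r)"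
        by (simp add: algebra_simps)
      moreover have "\<dots> \<le> 0" using bound[OF r] by (intro mult_nonpos_nonneg[OF _ exp_ge_zero]) (simp add: abs_le_iff)
      ultimately show "\<exists>y. ((\<lambda>r. h r * exp (- 2 * K * r)) has_real_derivative y) (at r) \<and> y \<le> 0" by metis
    qed
    then show ?thesis using s(2) by (simp add: h_def mult_le_0_iff)
  next
    case False
    have "h t * exp (2 * K * t) \<le> h s * exp (2 * K * s)"
    proof (rule DERIV_nonneg_imp_nondecreasing[where f="\<lambda>r. h r * exp (2 * K * r)"])
      show "t \<le> s" using False by simp
      fix r assume "t \<le> r" "r \<le> s"
      then have r: "r \<in> ?S" using False by simp
      have "((\<lambda>r. h r * exp (2 * K * r)) has_real_derivative 2 * (d r \<bullet> d' r) * exp (2 * K * r) + h r * (exp (2 * K * r) * (2 * K))) (at r)"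
        by (auto intro!: derivative_eq_intros h[OF r])
      moreover have "2 * (d r \<bullet> d' r) * exp (2 * K * r) + h r * (exp (2 * K * r) * (2 * K)) = 2 * (d r \<bullet> d' r + K * h r) * exp (2 * K * r)"
        by (simp add: algebra_simps)
      moreover have "\<dots> \<ge> 0" using bound[OF r] by (intro mult_nonneg_nonneg[OF _ exp_ge_zero]) (simp add: abs_le_iff)
      ultimately show "\<exists>y. ((\<lambda>r. h r * exp (2 * K * r)) has_real_derivative y) (at r) \<and> 0 \<le> y" by metis
    qed
    then show ?thesis using s(2) by (simp add: h_def mult_le_0_iff)
  qed
  then have "d t \<bullet> d t = 0" unfolding h_def by (intro antisym inner_ge_zero)
  then show ?thesis by simp
qed

text \<open>Picard's method: on a short interval the integral operator is a contraction of the space of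
  bounded continuous functions.  Functions on the interval are extended to the real line by clamping
  the argument.\<close>

lemma linear_ode_local_solution:
  fixes prod :: "'b::real_normed_vector \<Rightarrow> 'a::euclidean_space \<Rightarrow> 'a"
  assumes bb: "bounded_bilinear prod" and J: "open J" "t0 \<in> J" and B: "continuous_on J B"
  obtains e u where "e > 0" "ball t0 e \<subseteq> J" "u t0 = u0"
    "\<And>t. t \<in> ball t0 e \<Longrightarrow> (u has_vector_derivative prod (B t) (u t)) (at t)"
proof -
  obtain r where r: "r > 0" "cball t0 r \<subseteq> J" using J open_contains_cball by blast
  have "compact (B ` cball t0 r)" by (intro compact_continuous_image continuous_on_subset[OF B r(2)]) simp
  then obtain M where M: "M > 0" "\<And>t. t \<in> cball t0 r \<Longrightarrow> norm (B t) \<le> M"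
    using compact_imp_bounded bounded_pos by (metis image_eqI)
  obtain K where K: "K > 0" "\<And>x y. norm (prod x y) \<le> norm x * norm y * K"
    using bounded_bilinear.pos_bounded[OF bb] by blast
  \<comment> \<open>The operator has the Lipschitz constant \<open>M * K * e\<close>, which this choice makes at most \<open>1/2\<close>.\<close>
  define e where "e = min r (1 / (2 * M * K))"
  have e: "e > 0" "e \<le> r" "M * K * e \<le> 1/2"
    using r M K by (auto simp: e_def min_def field_simps)
  define a where "a = t0 - e"
  define b where "b = t0 + e"
  have ab: "a \<le> b" "t0 \<in> {a..b}" using e by (auto simp: a_def b_def)
  have sub: "{a..b} \<subseteq> cball t0 r" using e by (auto simp: a_def b_def dist_real_def)
  have Bc: "continuous_on {a..b} B" by (rule continuous_on_subset[OF B]) (use sub r in blast)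
  define G where "G = (\<lambda>(\<phi> :: (real, 'a) bcontfun) t. integral {a..t} (\<lambda>\<tau>. prod (B \<tau>) (apply_bcontfun \<phi> \<tau>)))"
  have G: "(G \<phi> has_vector_derivative prod (B t) (apply_bcontfun \<phi> t)) (at t within {a..b})" if "t \<in> {a..b}" for t \<phi>
    unfolding G_def
    by (rule integral_has_vector_derivative[OF bounded_bilinear.continuous_on[OF bb Bc continuous_on_apply_bcontfun] that])
  define h where "h = (\<lambda>\<phi> t. u0 + (G \<phi> t - G \<phi> t0))"
  have "continuous_on (cbox a b) (h \<phi>)" for \<phi>
    unfolding h_def cbox_interval
    by (intro continuous_intros continuous_on_vector_derivative[OF G])
  then have "\<exists>g :: real \<Rightarrow>\<^sub>C 'a. \<forall>x. apply_bcontfun g x = h \<phi> (clamp a b x)" for \<phi>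
    by (rule continuous_on_cbox_bcontfunE) blast
  then obtain T :: "(real \<Rightarrow>\<^sub>C 'a) \<Rightarrow> (real \<Rightarrow>\<^sub>C 'a)" where T: "\<And>\<phi> x. apply_bcontfun (T \<phi>) x = h \<phi> (clamp a b x)"
    by metis
  have "\<exists>!\<phi>. T \<phi> = \<phi>"
  proof (rule banach_fix_type[of "1/2"])
    show "\<forall>\<phi> \<psi>. dist (T \<phi>) (T \<psi>) \<le> 1/2 * dist \<phi> \<psi>"
    proof (intro allI dist_bound)
      fix \<phi> \<psi> :: "(real, 'a) bcontfun" and x
      let ?y = "clamp a b x"
      have y: "?y \<in> {a..b}" using clamp_in_interval[of a b x] ab by simp
      have dist_y: "norm (?y - t0) \<le> e" using y by (auto simp: a_def b_def)
      have nn: "0 \<le> M * K * dist \<phi> \<psi>" using M K by simp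
      have "norm ((G \<phi> ?y - G \<psi> ?y) - (G \<phi> t0 - G \<psi> t0)) \<le> M * K * dist \<phi> \<psi> * norm (?y - t0)"
      proof (rule differentiable_bound[of "{a..b}" "\<lambda>t. G \<phi> t - G \<psi> t"])
        fix t assume t: "t \<in> {a..b}"
        let ?v = "prod (B t) (apply_bcontfun \<phi> t) - prod (B t) (apply_bcontfun \<psi> t)"
        show "((\<lambda>t. G \<phi> t - G \<psi> t) has_derivative (\<lambda>x. x *\<^sub>R ?v)) (at t within {a..b})"
          using has_vector_derivative_diff[OF G[OF t] G[OF t]] by (simp add: has_vector_derivative_def)
        have "norm ?v \<le> M * K * dist \<phi> \<psi>"
        proof -
          have "?v = prod (B t) (apply_bcontfun \<phi> t - apply_bcontfun \<psi> t)" by (simp add: bounded_bilinear.diff_right[OF bb])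
          then have "norm ?v \<le> norm (B t) * norm (apply_bcontfun \<phi> t - apply_bcontfun \<psi> t) * K" using K(2) by simp
          also have "\<dots> \<le> M * dist \<phi> \<psi> * K"
            using M(2)[of t] t sub K(1) dist_bounded[of \<phi> t \<psi>] M(1)
            by (intro mult_right_mono mult_mono) (auto simp: dist_norm subset_iff)
          finally show ?thesis by (simp add: mult_ac)
        qed
        then show "onorm (\<lambda>x. x *\<^sub>R ?v) \<le> M * K * dist \<phi> \<psi>"
          by (intro onorm_le) (simp add: mult.commute mult_left_mono)
      qed (use y ab in auto)
      also have "\<dots> \<le> M * K * dist \<phi> \<psi> * e" by (rule mult_left_mono[OF dist_y nn])
      also have "\<dots> \<le> 1/2 * dist \<phi> \<psi>" using mult_right_mono[OF e(3), of "dist \<phi> \<psi>"] by (simp add: mult_ac)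
      finally show "dist (apply_bcontfun (T \<phi>) x) (apply_bcontfun (T \<psi>) x) \<le> 1/2 * dist \<phi> \<psi>"
        by (simp add: T h_def dist_norm algebra_simps)
    qed
  qed auto
  then obtain \<phi> where \<phi>: "T \<phi> = \<phi>" by blast
  have val: "apply_bcontfun \<phi> t = h \<phi> t" if "t \<in> {a..b}" for t
    using T[of \<phi> t] that clamp_cancel_cbox[of t a b] by (simp add: \<phi>)
  show thesis
  proof (rule that[of e "apply_bcontfun \<phi>"])
    show "ball t0 e \<subseteq> J" using e r by (meson ball_subset_cball order_trans subset_ball)
    show "apply_bcontfun \<phi> t0 = u0" using val[OF ab(2)] by (simp add: h_def)
    fix t assume "t \<in> ball t0 e"
    then have t: "t \<in> {a<..<b}" by (auto simp: a_def b_def dist_real_def)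
    then have "(G \<phi> has_vector_derivative prod (B t) (apply_bcontfun \<phi> t)) (at t)"
      using G[of t \<phi>] at_within_Icc_at[of a t b] by simp
    then have "((\<lambda>t. u0 + (G \<phi> t - G \<phi> t0)) has_vector_derivative prod (B t) (apply_bcontfun \<phi> t)) (at t)"
      by (auto intro!: derivative_eq_intros)
    then have "(h \<phi> has_vector_derivative prod (B t) (apply_bcontfun \<phi> t)) (at t)" by (simp add: h_def)
    then show "(apply_bcontfun \<phi> has_vector_derivative prod (B t) (apply_bcontfun \<phi> t)) (at t)"
      by (rule has_vector_derivative_transform_within_open[of _ _ _ "{a<..<b}"]) (use t val in auto)
  qed (rule e(1))
qed

text \<open>Bootstrapping: if \<open>u\<close> is \<open>k\<close> times continuously differentiable, then so is its derivative
  \<open>prod B u\<close>.\<close>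

lemma linear_ode_solution_smooth:
  fixes prod :: "'b::real_normed_vector \<Rightarrow> 'a::real_normed_vector \<Rightarrow> 'a"
  assumes bb: "bounded_bilinear prod" and J: "open J" and B: "smooth_on J B"
    and u: "\<And>t. t \<in> J \<Longrightarrow> (u has_vector_derivative prod (B t) (u t)) (at t)"
  shows "smooth_on J u"
  unfolding smooth_on_def
proof
  fix k show "Ck_on k J u"
  proof (induction k)
    case 0
    have "isCont u t" if "t \<in> J" for t by (rule has_vector_derivative_continuous[OF u[OF that]])
    then show ?case by (simp add: continuous_at_imp_continuous_on)
  next
    case (Suc k)
    show ?case
    proof (rule Ck_on_SucI[OF J])
      show "(u has_derivative (\<lambda>v. v *\<^sub>R prod (B t) (u t))) (at t)" if "t \<in> J" for t
        using u[OF that] by (simp add: has_vector_derivative_def)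
      show "Ck_on k J (\<lambda>t. v *\<^sub>R prod (B t) (u t))" for v
        using B by (intro Ck_on_bounded_linear[OF J bounded_linear_scaleR_right] Ck_on_bounded_bilinear[OF J bb] Suc.IH)
          (simp add: smooth_on_def)
    qed
  qed
qed

text \<open>\<open>P t u\<close> reads: \<open>u\<close> satisfies the equation at the time \<open>t\<close>.  The essential hypothesis is \<open>exist\<close>: near
  each time, one interval serves all initial times and values in it, as it does for linear equations.
  Therefore the times reached by a solution from \<open>t0\<close> form a set that is open and closed in \<open>I\<close>.\<close>

lemma glue_local_solutions:
  fixes P :: "real \<Rightarrow> (real \<Rightarrow> 'a) \<Rightarrow> bool"
  assumes germ: "\<And>J t u v. open J \<Longrightarrow> t \<in> J \<Longrightarrow> J \<subseteq> I \<Longrightarrow> (\<And>s. s \<in> J \<Longrightarrow> u s = v s) \<Longrightarrow> P t u \<Longrightarrow> P t v"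
    and val: "\<And>t u. t \<in> I \<Longrightarrow> P t u \<Longrightarrow> u t \<in> V t"
    and exist: "\<And>t. t \<in> I \<Longrightarrow> \<exists>J. open_interval J \<and> t \<in> J \<and> J \<subseteq> I \<and> (\<forall>s\<in>J. \<forall>x\<in>V s. \<exists>u. u s = x \<and> (\<forall>r\<in>J. P r u))"
    and unique: "\<And>J u v s t. open_interval J \<Longrightarrow> J \<subseteq> I \<Longrightarrow> s \<in> J \<Longrightarrow> t \<in> J \<Longrightarrow> u s = v s
      \<Longrightarrow> (\<forall>r\<in>J. P r u) \<Longrightarrow> (\<forall>r\<in>J. P r v) \<Longrightarrow> u t = v t"
    and I: "open_interval I" "t0 \<in> I" and x0: "x0 \<in> V t0"
  obtains u where "u t0 = x0" "\<forall>t\<in>I. P t u"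
proof -
  define good where "good = (\<lambda>t J u. open_interval J \<and> J \<subseteq> I \<and> t0 \<in> J \<and> t \<in> J \<and> u t0 = x0 \<and> (\<forall>r\<in>J. P r u))"
  have step: "\<exists>K w. good t K w"
    if J: "open_interval J" "J \<subseteq> I" "s \<in> J" "t \<in> J"
    and ex: "\<forall>s\<in>J. \<forall>x\<in>V s. \<exists>u. u s = x \<and> (\<forall>r\<in>J. P r u)" and s: "good s K u" for s t J K u
  proof -
    have K: "open_interval K" "K \<subseteq> I" "t0 \<in> K" "s \<in> K" "u t0 = x0" "\<forall>r\<in>K. P r u"
      using s unfolding good_def by blast+
    then have "u s \<in> V s" using val by blast
    then obtain v where v: "v s = u s" "\<forall>r\<in>J. P r v" using ex J(3) by blast
    \<comment> \<open>On the overlap of the two intervals \<open>u\<close> and \<open>v\<close> agree by uniqueness, since they agree at \<open>s\<close>.\<close>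
    define w where "w = (\<lambda>r. if r \<in> K then u r else v r)"
    have JK: "open_interval (J \<inter> K)" using J(1) K(1) by (auto simp: open_interval_def is_interval_Int)
    have eqv: "w r = v r" if "r \<in> J" for r
      using unique[OF JK, of s r u v] J K that v by (auto simp: w_def)
    have "connected (J \<union> K)" using J(1,3) K(1,4)
      by (intro connected_Un) (auto simp: open_interval_def is_interval_connected_1)
    then have "open_interval (J \<union> K)" using J(1) K(1) by (auto simp: open_interval_def is_interval_connected_1)
    moreover have "P r w" if "r \<in> J \<union> K" for r
    proof (cases "r \<in> K")
      case True
      show ?thesis by (rule germ[of K r u]) (use True K in \<open>auto simp: w_def open_interval_def\<close>)
    next
      case False
      then have rJ: "r \<in> J" using that by blast
      show ?thesis
      proof (rule germ[of J r v])
        show "open J" "J \<subseteq> I" "r \<in> J" "P r v" using J(1,2) rJ v(2) by (auto simp: open_interval_def)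
      qed (simp add: eqv)
    qed
    ultimately have "good t (J \<union> K) w"
      unfolding good_def using K(2,3) J(2,4) by (intro conjI ballI) (auto simp: w_def K(5))
    then show ?thesis by blast
  qed
  have good0: "\<exists>J u. good t0 J u"
  proof -
    obtain J where J: "open_interval J" "t0 \<in> J" "J \<subseteq> I" "\<forall>s\<in>J. \<forall>x\<in>V s. \<exists>u. u s = x \<and> (\<forall>r\<in>J. P r u)"
      using exist[OF I(2)] by blast
    then obtain u where "u t0 = x0" "\<forall>r\<in>J. P r u" using x0 by blast
    then have "good t0 J u" using J by (simp add: good_def)
    then show ?thesis by blast
  qed
  have all: "\<exists>J u. good t J u" if t: "t \<in> I" for t
  proof (rule connected_induction_simple[where P="\<lambda>t. \<exists>J u. good t J u", OF _ I(2) t good0])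
    show "connected I" using I by (simp add: open_interval_def is_interval_connected_1)
    fix a assume a: "a \<in> I"
    obtain J where J: "open_interval J" "a \<in> J" "J \<subseteq> I" "\<forall>s\<in>J. \<forall>x\<in>V s. \<exists>u. u s = x \<and> (\<forall>r\<in>J. P r u)"
      using exist[OF a] by blast
    then have oJ: "openin (top_of_set I) J" by (simp add: open_interval_def open_subset)
    have hop: "\<exists>J u. good y J u" if xy: "x \<in> J" "y \<in> J" "\<exists>J u. good x J u" for x y
    proof -
      obtain K u where "good x K u" using xy(3) by blast
      then show ?thesis by (rule step[OF J(1,3) xy(1,2) J(4)])
    qed
    show "\<exists>T. openin (top_of_set I) T \<and> a \<in> T \<and> (\<forall>x\<in>T. \<forall>y\<in>T. (\<exists>J u. good x J u) \<longrightarrow> (\<exists>J u. good y J u))"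
      by (rule exI[of _ J], intro conjI ballI impI oJ J(2)) (rule hop)
  qed
  then obtain Jf uf where g: "\<And>t. t \<in> I \<Longrightarrow> good t (Jf t) (uf t)" by metis
  \<comment> \<open>Near \<open>t\<close> this is \<open>uf t\<close>, because all the solutions \<open>uf s\<close> start from the same value at \<open>t0\<close>.\<close>
  define w where "w = (\<lambda>t. uf t t)"
  have "P t w" if t: "t \<in> I" for t
  proof (rule germ[of "Jf t" t "uf t"])
    fix s assume s: "s \<in> Jf t"
    have sI: "s \<in> I" using g[OF t] s by (auto simp: good_def)
    have JJ: "open_interval (Jf t \<inter> Jf s)" using g[OF t] g[OF sI] by (auto simp: good_def open_interval_def is_interval_Int)
    show "uf t s = w s"
      using unique[OF JJ, of t0 s "uf t" "uf s"] g[OF t] g[OF sI] s by (auto simp: good_def w_def)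
  qed (use g[OF t] in \<open>auto simp: good_def open_interval_def\<close>)
  moreover have "w t0 = x0" using g[OF I(2)] by (simp add: good_def w_def)
  ultimately show thesis using that by blast
qed

section \<open>Transport of frames along a curve\<close>

text \<open>The frame equation at the time \<open>t\<close>: the covariant derivative of \<open>u\<close> along \<open>\<sigma>\<close> is \<open>F u\<close>.\<close>

definition frame_transport ::
    "('m, real^'n) atlas \<Rightarrow> ('m, real^'n) covd \<Rightarrow> ('m \<Rightarrow> ('m, real^'n) tvec \<Rightarrow> ('m, real^'n) tvec)
      \<Rightarrow> (real \<Rightarrow> 'm) \<Rightarrow> real \<Rightarrow> (real \<Rightarrow> ('m, 'n) frame) \<Rightarrow> bool" where
  "frame_transport A D F \<sigma> t u \<longleftrightarrow> u t \<in> frames A (\<sigma> t) \<and>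
     (\<forall>x. has_covd_along A D \<sigma> (\<lambda>s. u s x) t (F (\<sigma> t) (u t x)))"

text \<open>In the chart \<open>c\<close> the equation for frames and for vector fields along \<open>\<sigma>\<close> reads \<open>V' = M V\<close> with this
  matrix \<open>M = F - \<Gamma>(\<sigma>')\<close>.\<close>

definition transport_matrix ::
    "('m, real^'n) atlas \<Rightarrow> ('m, real^'n) covd \<Rightarrow> ('m \<Rightarrow> ('m, real^'n) tvec \<Rightarrow> ('m, real^'n) tvec)
      \<Rightarrow> ('m, real^'n) chart \<Rightarrow> (real \<Rightarrow> 'm) \<Rightarrow> real \<Rightarrow> real^'n^'n" where
  "transport_matrix A D F c \<sigma> t = tensor_matrix A F c (\<sigma> t) - conn_matrix A D c (\<sigma> t) (velocity A \<sigma> t)"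

lemma has_covd_along_cong:
  assumes J: "open J" "t \<in> J" and eq: "\<And>s. s \<in> J \<Longrightarrow> V s = W s" and V: "has_covd_along A D \<sigma> V t w"
  shows "has_covd_along A D \<sigma> W t w"
proof -
  have tr: "((\<lambda>s. W s c) has_vector_derivative V') (at t)" if "((\<lambda>s. V s c) has_vector_derivative V') (at t)" for c V'
    by (rule has_vector_derivative_transform_within_open[OF that J]) (simp add: eq)
  show ?thesis
    using V tr unfolding has_covd_along_def eq[OF J(2)] by blast
qed

lemma smooth_curve_subset:
  assumes \<gamma>: "smooth_curve A I \<gamma>" and J: "open J" "J \<subseteq> I"
  shows "smooth_curve A J \<gamma>"
  unfolding smooth_curve_def
proof (intro conjI ballI)
  show "\<gamma> ` J \<subseteq> carrier A" using \<gamma> J by (auto simp: smooth_curve_def)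
  fix c assume "c \<in> A"
  then have c: "open {t \<in> I. \<gamma> t \<in> fst c}" "smooth_on {t \<in> I. \<gamma> t \<in> fst c} (snd c \<circ> \<gamma>)"
    using \<gamma> by (simp_all add: smooth_curve_def)
  have "{t \<in> J. \<gamma> t \<in> fst c} = J \<inter> {t \<in> I. \<gamma> t \<in> fst c}" using J by auto
  then show "open {t \<in> J. \<gamma> t \<in> fst c}" using c(1) J(1) by auto
  show "smooth_on {t \<in> J. \<gamma> t \<in> fst c} (snd c \<circ> \<gamma>)" by (rule smooth_on_subset[OF c(2)]) (use J in auto)
qed

lemma frame_matrix_has_vector_derivative:
  fixes u :: "real \<Rightarrow> ('m, 'n::finite) frame"
  assumes "\<And>x. ((\<lambda>s. u s x c) has_vector_derivative M x) (at t)"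
  shows "((\<lambda>s. frame_matrix c (u s)) has_vector_derivative matrix M) (at t)"
proof -
  define L where "L = (\<lambda>(j :: 'n) (v :: real^'n). (\<chi> i k. if k = j then v $ i else 0) :: real^'n^'n)"
  have L: "bounded_linear (L j)" for j
    unfolding linear_conv_bounded_linear[symmetric] L_def by (rule linearI) (auto simp: vec_eq_iff)
  have m: "matrix f = (\<Sum>j\<in>UNIV. L j (f (axis j 1)))" for f :: "real^'n \<Rightarrow> real^'n"
    by (simp add: matrix_def L_def vec_eq_iff if_distrib[of "\<lambda>x. x $ _"] cong: if_cong)
  show ?thesis
    unfolding frame_matrix_def m
    by (intro has_vector_derivative_sum bounded_linear.has_vector_derivative[OF L] assms)
qed

lemma matrix_inv_has_vector_derivative:
  fixes U :: "real \<Rightarrow> real^'n^'n"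
  assumes "(U has_vector_derivative U') (at t)" "invertible (U t)"
  obtains W where "((\<lambda>s. matrix_inv (U s)) has_vector_derivative W) (at t)"
proof -
  have sm: "smooth_on {U :: real^'n^'n. invertible U} matrix_inv"
    by (rule smooth_on_matrix_inv[OF open_invertible smooth_on_id[OF open_invertible]]) simp
  have "(matrix_inv has_derivative frechet_derivative matrix_inv (at (U t))) (at (U t))"
    by (rule smooth_on_has_derivative[OF sm]) (simp add: assms(2))
  from vector_derivative_diff_chain_within[OF assms(1) has_derivative_at_withinI[OF this]]
  show thesis using that by (simp add: comp_def)
qed

lemma smooth_curve_empty:
  fixes A :: "('a, 'b::euclidean_space) atlas"
  shows "smooth_curve A {} \<gamma>"
proof -
  have "Ck_on k {} f" for k and f :: "real \<Rightarrow> 'b" by (induction k arbitrary: f) auto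
  then show ?thesis by (simp add: smooth_curve_def smooth_on_def)
qed

lemma frames_nonempty:
  assumes A: "smooth_atlas A" and p: "p \<in> carrier A"
  obtains u where "u \<in> frames A p"
  using frame_of_matrix_in_frames[OF A some_chart[OF p], of "mat 1"] that by (auto simp: invertible_def)

context
  fixes A :: "('m, real^'n) atlas" and D :: "('m, real^'n) covd"
    and F :: "'m \<Rightarrow> ('m, real^'n) tvec \<Rightarrow> ('m, real^'n) tvec"
  assumes A: "smooth_atlas A" and D: "linear_connection A D" and F: "tensor_field_11 A F"
begin

lemma forced_field_has_vector_derivative:
  assumes "has_covd_along A D \<sigma> V t (F (\<sigma> t) (V t))" "V t \<in> tangent_space A (\<sigma> t)" "c \<in> charts_at A (\<sigma> t)"
  shows "((\<lambda>s. V s c) has_vector_derivative transport_matrix A D F c \<sigma> t *v V t c) (at t)"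
proof -
  obtain V' where V': "((\<lambda>s. V s c) has_vector_derivative V') (at t)"
    using assms unfolding has_covd_along_def by blast
  have "F (\<sigma> t) (V t) c = V' + christoffel A D c (\<sigma> t) (velocity A \<sigma> t) (V t c)"
    by (rule has_covd_along_chart[OF A D assms(1,3) V'])
  then have "V' = transport_matrix A D F c \<sigma> t *v V t c"
    using tensor_matrix_apply[OF A F assms(3,2)] 
    by (simp add: transport_matrix_def matrix_vector_mult_diff_rdistrib conn_matrix_apply)
  then show ?thesis using V' by simp
qed

lemma has_covd_along_forcedI:
  assumes \<sigma>: "smooth_curve A I \<sigma>" "t \<in> I" and V: "\<And>s. s \<in> I \<Longrightarrow> V s \<in> tangent_space A (\<sigma> s)"
    and c: "c \<in> charts_at A (\<sigma> t)"
    and V': "((\<lambda>s. V s c) has_vector_derivative transport_matrix A D F c \<sigma> t *v V t c) (at t)"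
  shows "has_covd_along A D \<sigma> V t (F (\<sigma> t) (V t))"
proof -
  have p: "\<sigma> t \<in> carrier A" using c by (auto simp: charts_at_def carrier_def)
  show ?thesis
    by (rule has_covd_alongI[OF A D \<sigma> V c V' tensor_tangent[OF A F p V[OF \<sigma>(2)]]])
      (simp_all add: transport_matrix_def matrix_vector_mult_diff_rdistrib conn_matrix_apply
        tensor_matrix_apply[OF A F c V[OF \<sigma>(2)]])
qed

lemma frame_transport_matrix_derivative:
  assumes "frame_transport A D F \<sigma> t u" "c \<in> charts_at A (\<sigma> t)"
  shows "((\<lambda>s. frame_matrix c (u s)) has_vector_derivative transport_matrix A D F c \<sigma> t ** frame_matrix c (u t)) (at t)"
proof -
  have u: "u t \<in> frames A (\<sigma> t)" using assms by (simp add: frame_transport_def)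
  have "((\<lambda>s. u s x c) has_vector_derivative (transport_matrix A D F c \<sigma> t ** frame_matrix c (u t)) *v x) (at t)" for x
    using forced_field_has_vector_derivative[of \<sigma> "\<lambda>s. u s x" t c] assms frame_tangent[OF u, of x]
    by (simp add: frame_transport_def frame_apply[OF u] matrix_vector_mul_assoc)
  from frame_matrix_has_vector_derivative[of u c, OF this] show ?thesis by simp
qed

text \<open>If a frame \<open>u\<close> and a vector field \<open>V\<close> solve the same linear equation, then the components of \<open>V\<close> in \<open>u\<close> are
  constant: with \<open>a = U\<^sup>-\<^sup>1 V\<close>, the equations \<open>U' = M U\<close> and \<open>(U a)' = M U a\<close> leave \<open>U a' = 0\<close>.  It is applied
  to a second frame, which yields uniqueness, and to \<open>\<sigma>'\<close>, which yields constancy of \<open>\<theta>\<close>.\<close>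

lemma forced_frame_coords_constant:
  assumes \<sigma>: "smooth_curve A J \<sigma>" "t \<in> J"
    and u: "\<And>s. s \<in> J \<Longrightarrow> u s \<in> frames A (\<sigma> s)" "frame_transport A D F \<sigma> t u"
    and V: "\<And>s. s \<in> J \<Longrightarrow> V s \<in> tangent_space A (\<sigma> s)" "has_covd_along A D \<sigma> V t (F (\<sigma> t) (V t))"
  shows "((\<lambda>s. inv (u s) (V s)) has_vector_derivative 0) (at t)"
proof -
  obtain c where c: "c \<in> charts_at A (\<sigma> t)"
    using \<sigma> by (auto simp: smooth_curve_def charts_at_def carrier_def image_subset_iff)
  have cA: "c \<in> A" "\<sigma> t \<in> fst c" using c by (auto simp: charts_at_def)
  let ?J = "{s \<in> J. \<sigma> s \<in> fst c}"
  have J: "open ?J" "t \<in> ?J" using curve_chart(1)[OF A \<sigma>(1) cA(1)] \<sigma>(2) cA by auto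
  have ch: "c \<in> charts_at A (\<sigma> s)" if "s \<in> ?J" for s using that cA by (simp add: charts_at_def)
  define U where "U = (\<lambda>s. frame_matrix c (u s))"
  define a where "a = (\<lambda>s. matrix_inv (U s) *v V s c)"
  let ?M = "transport_matrix A D F c \<sigma> t"
  have inv: "invertible (U s)" if "s \<in> ?J" for s
    unfolding U_def using invertible_frame_matrix[OF A u(1) ch[OF that]] that by simp
  have U': "(U has_vector_derivative ?M ** U t) (at t)"
    unfolding U_def by (rule frame_transport_matrix_derivative[OF u(2) c])
  have V': "((\<lambda>s. V s c) has_vector_derivative ?M *v V t c) (at t)"
    by (rule forced_field_has_vector_derivative[OF V(2) V(1)[OF \<sigma>(2)] c])
  obtain W where "((\<lambda>s. matrix_inv (U s)) has_vector_derivative W) (at t)"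
    by (rule matrix_inv_has_vector_derivative[OF U' inv[OF J(2)]])
  from bounded_bilinear.has_vector_derivative[OF bounded_bilinear_matrix_vector_mult this V']
  obtain a' where a': "(a has_vector_derivative a') (at t)" unfolding a_def by blast
  have Ua: "U s *v a s = V s c" if "s \<in> ?J" for s
    by (simp add: a_def matrix_inv_cancel[OF inv[OF that]])
  have "((\<lambda>s. V s c) has_vector_derivative U t *v a' + (?M ** U t) *v a t) (at t)"
    by (rule has_vector_derivative_transform_within_open[OF
          bounded_bilinear.has_vector_derivative[OF bounded_bilinear_matrix_vector_mult U' a'] J Ua])
  from vector_derivative_unique_at[OF this V']
  have "U t *v a' = 0" using Ua[OF J(2)] by (simp flip: matrix_vector_mul_assoc)
  then have "a' = 0" using matrix_inv_cancel(2)[OF inv[OF J(2)], of a'] by simp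
  with a' have "(a has_vector_derivative 0) (at t)" by simp
  then show ?thesis
    by (rule has_vector_derivative_transform_within_open[OF _ J])
      (simp add: a_def U_def frame_inv_eq[OF A u(1) ch V(1)])
qed

lemma frame_transport_unique:
  assumes \<sigma>: "smooth_curve A I \<sigma>" and J: "open_interval J" "J \<subseteq> I" "s \<in> J" "t \<in> J" and eq: "u s = v s"
    and u: "\<forall>r\<in>J. frame_transport A D F \<sigma> r u" and v: "\<forall>r\<in>J. frame_transport A D F \<sigma> r v"
  shows "u t = v t"
proof
  fix x
  have uf: "u r \<in> frames A (\<sigma> r)" and vf: "v r \<in> frames A (\<sigma> r)" if "r \<in> J" for r
    using u v that by (simp_all add: frame_transport_def)
  have oJ: "open J" "convex J" using J(1) by (simp_all add: open_interval_def is_interval_convex)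
  have zero: "((\<lambda>r. inv (u r) (v r x)) has_vector_derivative 0) (at r within J)" if r: "r \<in> J" for r
    by (rule has_vector_derivative_at_within, rule forced_frame_coords_constant[OF smooth_curve_subset[OF \<sigma> oJ(1) J(2)] r uf])
      (use u v r in \<open>simp_all add: frame_tangent[OF vf] frame_transport_def\<close>)
  obtain k where "\<And>r. r \<in> J \<Longrightarrow> inv (u r) (v r x) = k"
    using has_vector_derivative_zero_constant[OF oJ(2) zero] by blast
  then have "inv (u t) (v t x) = inv (u s) (v s x)" using J(3,4) by simp
  also have "\<dots> = x" using frame_inv_left[OF uf[OF J(3)]] eq by simp
  finally show "u t x = v t x" using frame_inv_right[OF uf[OF J(4)] frame_tangent[OF vf[OF J(4)], of x]] by simp
qed

lemma transport_matrix_smooth: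
  assumes \<sigma>: "smooth_curve A I \<sigma>" and c: "c \<in> A"
  shows "smooth_on {t \<in> I. \<sigma> t \<in> fst c} (transport_matrix A D F c \<sigma>)"
proof -
  let ?J = "{t \<in> I. \<sigma> t \<in> fst c}"
  note J = curve_chart[OF A \<sigma> c]
  have "smooth_vector_field A (fst c) (\<lambda>p. F p (coord_field A c v p))" for v
    using F mopen_chart[OF A c] smooth_coord_field[OF A c] unfolding tensor_field_11_def by blast
  from smooth_map_component[OF A mopen_chart[OF A c] this c]
  have "smooth_on ?J (\<lambda>t. F (\<sigma> t) (coord_field A c v (\<sigma> t)) c)" for v
    by (intro smooth_on_curve_compose[OF A \<sigma> c]) auto
  then have T: "smooth_on ?J (\<lambda>t. tensor_matrix A F c (\<sigma> t))"
    unfolding tensor_matrix_def by (intro smooth_on_matrix J(1))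
  have "smooth_on ?J (\<lambda>t. christoffel A D c (\<sigma> t) (coord_field A c b (\<sigma> t)) v)" for b v
    by (rule smooth_on_curve_compose[OF A \<sigma> c smooth_map_christoffel[OF A D c] order_refl])
  then have K: "smooth_on ?J (\<lambda>t. conn_matrix A D c (\<sigma> t) (coord_field A c b (\<sigma> t)))" for b
    unfolding conn_matrix_def by (intro smooth_on_matrix J(1))
  let ?v = "\<lambda>t. vector_derivative (\<lambda>t. snd c (\<sigma> t)) (at t)"
  have "smooth_on ?J (\<lambda>t. \<Sum>b\<in>Basis. (?v t \<bullet> b) *\<^sub>R conn_matrix A D c (\<sigma> t) (coord_field A c b (\<sigma> t)))"
    by (intro smooth_on_sum smooth_on_scaleR smooth_on_inner smooth_on_const smooth_on_vector_derivative J K)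
  then have sm: "smooth_on ?J (\<lambda>t. tensor_matrix A F c (\<sigma> t)
      - (\<Sum>b\<in>Basis. (?v t \<bullet> b) *\<^sub>R conn_matrix A D c (\<sigma> t) (coord_field A c b (\<sigma> t))))" (is "smooth_on ?J ?M")
    by (rule smooth_on_diff[OF J(1) T])
  have eq: "?M t = transport_matrix A D F c \<sigma> t" if t: "t \<in> ?J" for t
  proof -
    have ch: "c \<in> charts_at A (\<sigma> t)" using t c by (simp add: charts_at_def)
    have "velocity A \<sigma> t \<in> tangent_space A (\<sigma> t)" by (rule velocity_tangent[OF A \<sigma>]) (use t in simp)
    from coord_field_of_tangent[OF A this ch]
    have vel: "velocity A \<sigma> t = coord_field A c (?v t) (\<sigma> t)" using ch by (simp add: velocity_def comp_def)
    note lin = linear_conn_matrix_coord[OF A D ch]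
    have "conn_matrix A D c (\<sigma> t) (velocity A \<sigma> t) = (\<Sum>b\<in>Basis. (?v t \<bullet> b) *\<^sub>R conn_matrix A D c (\<sigma> t) (coord_field A c b (\<sigma> t)))"
      unfolding vel by (subst euclidean_representation[of "?v t", symmetric]) (simp only: linear_sum[OF lin] linear_cmul[OF lin])
    then show ?thesis by (simp add: transport_matrix_def)
  qed
  show ?thesis using smooth_on_cong[OF J(1), of ?M "transport_matrix A D F c \<sigma>", OF eq] sm by simp
qed

text \<open>Near \<open>t\<close> there is a matrix solution \<open>U\<close> with \<open>U(t) = 1\<close>, invertible after shrinking the interval.
  The solutions with other initial times \<open>s\<close> and values are \<open>U C\<close> with constant matrices \<open>C\<close>.\<close>

lemma frame_transport_local:
  assumes \<sigma>: "smooth_curve A I \<sigma>" "t \<in> I"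
  shows "\<exists>J. open_interval J \<and> t \<in> J \<and> J \<subseteq> I \<and>
    (\<forall>s\<in>J. \<forall>x\<in>frames A (\<sigma> s). \<exists>u. u s = x \<and> (\<forall>r\<in>J. frame_transport A D F \<sigma> r u))"
proof -
  obtain c where c: "c \<in> charts_at A (\<sigma> t)"
    using \<sigma> by (auto simp: smooth_curve_def charts_at_def carrier_def image_subset_iff)
  have cA: "c \<in> A" "\<sigma> t \<in> fst c" using c by (auto simp: charts_at_def)
  let ?I = "{s \<in> I. \<sigma> s \<in> fst c}" and ?M = "transport_matrix A D F c \<sigma>"
  have tI: "t \<in> ?I" using \<sigma>(2) cA by simp
  obtain e U where e: "e > 0" "ball t e \<subseteq> ?I" and Ut: "U t = (mat 1 :: real^'n^'n)"
    and U: "\<And>s. s \<in> ball t e \<Longrightarrow> (U has_vector_derivative ?M s ** U s) (at s)"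
    using linear_ode_local_solution[OF bounded_bilinear_matrix_mult curve_chart(1)[OF A \<sigma>(1) cA(1)] tI
          smooth_on_continuous_on[OF transport_matrix_smooth[OF \<sigma>(1) cA(1)]], of "mat 1"] by blast
  have "isCont U t" using has_vector_derivative_continuous[OF U] e(1) by simp
  moreover have "U t \<in> {U. invertible U}" by (auto simp: Ut invertible_def)
  ultimately have "\<forall>\<^sub>F s in at t. U s \<in> {U. invertible U}"
    unfolding isCont_def using topological_tendstoD open_invertible by blast
  then obtain d where d: "d > 0" "\<And>s. s \<noteq> t \<Longrightarrow> dist s t < d \<Longrightarrow> invertible (U s)"
    unfolding eventually_at by auto
  define J where "J = ball t (min d e)"
  have J: "open_interval J" "t \<in> J" "J \<subseteq> ball t e" "open J"
    using d e by (auto simp: J_def open_interval_def is_interval_ball_real)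
  have JI: "J \<subseteq> I" using J(3) e(2) by auto
  have inv: "invertible (U s)" if "s \<in> J" for s
    using d(2)[of s] that Ut by (cases "s = t") (auto simp: J_def dist_commute invertible_def)
  have ch: "c \<in> charts_at A (\<sigma> s)" if "s \<in> J" for s using that J(3) e(2) cA by (auto simp: charts_at_def)
  have "\<exists>u. u s = x \<and> (\<forall>r\<in>J. frame_transport A D F \<sigma> r u)" if s: "s \<in> J" and x: "x \<in> frames A (\<sigma> s)" for s x
  proof -
    define C where "C = matrix_inv (U s) ** frame_matrix c x"
    have Us: "U s ** C = frame_matrix c x" by (simp add: C_def matrix_inv_cancel[OF inv[OF s]])
    have "invertible (U s ** C)" unfolding Us by (rule invertible_frame_matrix[OF A x ch[OF s]])
    then have "invertible C" by (simp add: invertible_det_nz det_mul)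
    define u where "u r = frame_of_matrix A c (\<sigma> r) (U r ** C)" for r
    have uf: "u r \<in> frames A (\<sigma> r)" if "r \<in> J" for r
      unfolding u_def by (rule frame_of_matrix_in_frames[OF A ch[OF that] invertible_mult[OF inv[OF that] \<open>invertible C\<close>]])
    have uc: "u r y c = (U r ** C) *v y" if "r \<in> J" for r y
      by (simp add: u_def frame_of_matrix_def coord_field_self[OF A ch[OF that]])
    have "frame_transport A D F \<sigma> r u" if r: "r \<in> J" for r
      unfolding frame_transport_def
    proof (intro conjI allI uf r)
      fix y
      have "((\<lambda>s. (U s ** C) *v y) has_vector_derivative ((?M r ** U r) ** C) *v y) (at r)"
        by (intro bounded_linear.has_vector_derivative[OF bounded_bilinear.bounded_linear_left[OF bounded_bilinear_matrix_vector_mult]]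
            bounded_linear.has_vector_derivative[OF bounded_bilinear.bounded_linear_left[OF bounded_bilinear_matrix_mult]] U)
          (use r J in auto)
      then have "((\<lambda>s. u s y c) has_vector_derivative ?M r *v u r y c) (at r)"
        unfolding uc[OF r] matrix_vector_mul_assoc matrix_mul_assoc
        by (rule has_vector_derivative_transform_within_open[OF _ J(4) r]) (simp add: uc)
      then show "has_covd_along A D \<sigma> (\<lambda>s. u s y) r (F (\<sigma> r) (u r y))"
        by (intro has_covd_along_forcedI[OF smooth_curve_subset[OF \<sigma>(1) J(4) JI] r _ ch[OF r], of "\<lambda>s. u s y"])
          (simp_all add: frame_tangent[OF uf])
    qed
    moreover have "u s = x" unfolding u_def Us by (rule frame_of_frame_matrix[OF A x ch[OF s]])
    ultimately show ?thesis by blast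
  qed
  then show ?thesis using J JI by blast
qed

lemma frame_transport_exists:
  assumes \<sigma>: "smooth_curve A I \<sigma>" and I: "open_interval I" "t0 \<in> I" and u0: "u0 \<in> frames A (\<sigma> t0)"
  obtains u where "u t0 = u0" "\<forall>t\<in>I. frame_transport A D F \<sigma> t u"
proof (rule glue_local_solutions[where P = "frame_transport A D F \<sigma>" and V = "\<lambda>t. frames A (\<sigma> t)" and I = I, OF _ _ _ _ I u0])
  show "frame_transport A D F \<sigma> t v"
    if J: "open J" "t \<in> J" and eq: "\<And>s. s \<in> J \<Longrightarrow> u s = v s" and u: "frame_transport A D F \<sigma> t u" for J t u v
    using u eq[OF J(2)] has_covd_along_cong[OF J, of "\<lambda>s. u s x" "\<lambda>s. v s x" for x] eq
    unfolding frame_transport_def by metis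
  show "u t \<in> frames A (\<sigma> t)" if "frame_transport A D F \<sigma> t u" for t u
    using that by (simp add: frame_transport_def)
  show "\<exists>J. open_interval J \<and> t \<in> J \<and> J \<subseteq> I \<and> (\<forall>s\<in>J. \<forall>x\<in>frames A (\<sigma> s). \<exists>u. u s = x \<and> (\<forall>r\<in>J. frame_transport A D F \<sigma> r u))"
    if "t \<in> I" for t by (rule frame_transport_local[OF \<sigma> that])
  show "u t = v t" if "open_interval J" "J \<subseteq> I" "s \<in> J" "t \<in> J" "u s = v s"
    "\<forall>r\<in>J. frame_transport A D F \<sigma> r u" "\<forall>r\<in>J. frame_transport A D F \<sigma> r v" for J u v s t
    by (rule frame_transport_unique[OF \<sigma> that])
qed (rule that)

lemma frame_transport_smooth_curve:
  assumes \<sigma>: "smooth_curve A I \<sigma>" and u: "\<forall>t\<in>I. frame_transport A D F \<sigma> t u"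
  shows "smooth_curve (frame_atlas A) I (\<lambda>t. (\<sigma> t, u t))"
  unfolding smooth_curve_def
proof (intro conjI ballI)
  have uf: "u t \<in> frames A (\<sigma> t)" if "t \<in> I" for t using u that by (simp add: frame_transport_def)
  show "(\<lambda>t. (\<sigma> t, u t)) ` I \<subseteq> carrier (frame_atlas A)"
    using \<sigma> uf by (auto simp: carrier_frame_atlas frame_bundle_def smooth_curve_def)
  fix C assume "C \<in> frame_atlas A"
  then obtain c where c: "c \<in> A" "C = frame_chart A c" by (auto simp: frame_atlas_def)
  have eq: "{t \<in> I. (\<sigma> t, u t) \<in> fst C} = {t \<in> I. \<sigma> t \<in> fst c}" using uf by (auto simp: c(2) mem_frame_chart)
  note J = curve_chart[OF A \<sigma> c(1)]
  show "open {t \<in> I. (\<sigma> t, u t) \<in> fst C}" unfolding eq by (rule J(1))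
  have "smooth_on {t \<in> I. \<sigma> t \<in> fst c} (\<lambda>t. frame_matrix c (u t))"
    by (rule linear_ode_solution_smooth[OF bounded_bilinear_matrix_mult J(1) transport_matrix_smooth[OF \<sigma> c(1)]
          frame_transport_matrix_derivative]) (use u c in \<open>auto simp: charts_at_def\<close>)
  from smooth_on_Pair[OF J this]
  show "smooth_on {t \<in> I. (\<sigma> t, u t) \<in> fst C} (snd C \<circ> (\<lambda>t. (\<sigma> t, u t)))"
    unfolding eq by (simp add: c(2) comp_def snd_frame_chart)
qed

lemma frame_tensor_along:
  assumes \<gamma>: "smooth_curve (frame_atlas A) I \<gamma>" "t \<in> I"
  shows "((\<lambda>s. frame_tensor F (\<gamma> s)) has_vector_derivative
     deriv_along (frame_atlas A) (\<gamma> t) (velocity (frame_atlas A) \<gamma> t) (frame_tensor F)) (at t)"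
  by (rule curve_compose_has_vector_derivative[OF smooth_atlas_frame_atlas[OF A] \<gamma>
        mopen_carrier[OF smooth_atlas_frame_atlas[OF A]] smooth_frame_tensor[OF A F]])
    (use \<gamma> in \<open>auto simp: smooth_curve_def\<close>)

section \<open>Geodesics and forced motion\<close>

context
  assumes F_nz: "\<forall>p\<in>carrier A. \<exists>v\<in>tangent_space A p. F p v \<noteq> (\<lambda>_. 0)"
begin

interpretation P: parallelization "frame_atlas A" "frame_form A D" "frame_vector A D" "frame_correction A F"
  by (rule parallelization_frame_bundle[OF A D F F_nz])

text \<open>The second component of the geodesic is the frame transported from \<open>u0\<close> by \<open>F\<close>.  The last
  conclusion determines the initial velocity of the geodesic.\<close>

lemma forced_solution_lifts_to_geodesic:
  assumes \<sigma>: "forced_solution A D F I \<sigma>" and t0: "t0 \<in> I" and u0: "u0 \<in> frames A (\<sigma> t0)"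
  obtains \<gamma> where "geodesic (frame_atlas A) P.conn I \<gamma>" "\<gamma> t0 = (\<sigma> t0, u0)" "\<And>t. fst (\<gamma> t) = \<sigma> t"
    "\<And>t. t \<in> I \<Longrightarrow> frame_form A D (\<gamma> t) (velocity (frame_atlas A) \<gamma> t)
        = (inv (snd (\<gamma> t)) (velocity A \<sigma> t), frame_tensor F (\<gamma> t))"
proof -
  have I: "open_interval I" and sm: "smooth_curve A I \<sigma>"
    and cov: "\<And>t. t \<in> I \<Longrightarrow> has_covd_along A D \<sigma> (velocity A \<sigma>) t (F (\<sigma> t) (velocity A \<sigma> t))"
    using \<sigma> by (simp_all add: forced_solution_def)
  obtain u where u: "u t0 = u0" "\<forall>t\<in>I. frame_transport A D F \<sigma> t u"
    by (rule frame_transport_exists[OF sm I t0 u0])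
  define \<gamma> where "\<gamma> = (\<lambda>t. (\<sigma> t, u t))"
  let ?B = "frame_atlas A"
  have \<gamma>: "smooth_curve ?B I \<gamma>" unfolding \<gamma>_def by (rule frame_transport_smooth_curve[OF sm u(2)])
  have fst_\<gamma>: "(\<lambda>t. fst (\<gamma> t)) = \<sigma>" by (simp add: \<gamma>_def)
  have uf: "u t \<in> frames A (\<sigma> t)" if "t \<in> I" for t using u(2) that by (simp add: frame_transport_def)
  have om: "connection_form A D (\<gamma> t) (velocity ?B \<gamma> t) = frame_tensor F (\<gamma> t)" if t: "t \<in> I" for t
    unfolding eq_frame_tensor_iff[OF A F curve_mem_frame_bundle[OF A \<gamma> t]]
  proof
    fix y
    have p: "\<sigma> t \<in> carrier A" using sm t by (auto simp: smooth_curve_def)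
    have "has_covd_along A D \<sigma> (\<lambda>s. u s y) t (F (\<sigma> t) (u t y))"
      using bspec[OF u(2) t] unfolding frame_transport_def by blast
    then show "snd (\<gamma> t) (connection_form A D (\<gamma> t) (velocity ?B \<gamma> t) *v y) = F (fst (\<gamma> t)) (snd (\<gamma> t) y)"
      using covd_frame_along[OF A D \<gamma> t, of y]
      unfolding fst_\<gamma> by (intro has_covd_along_unique[where \<gamma>=\<sigma> and t=t, OF A p]) (simp_all add: \<gamma>_def)
  qed
  have form: "frame_form A D (\<gamma> t) (velocity ?B \<gamma> t) = (inv (snd (\<gamma> t)) (velocity A \<sigma> t), frame_tensor F (\<gamma> t))"
    if t: "t \<in> I" for t
    using velocity_eq_proj_push[OF A D \<gamma> t] by (simp add: frame_form_def om[OF t] fst_\<gamma>)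
  have "geodesic ?B P.conn I \<gamma>"
    unfolding P.geodesic_iff[OF I \<gamma>]
  proof
    fix t assume t: "t \<in> I"
    let ?f' = "deriv_along ?B (\<gamma> t) (velocity ?B \<gamma> t) (frame_tensor F)"
    have "((\<lambda>s. inv (u s) (velocity A \<sigma> s)) has_vector_derivative 0) (at t)"
      by (rule forced_frame_coords_constant[OF sm t uf _ velocity_tangent[OF A sm] cov[OF t]]) (use u(2) t in auto)
    then have "((\<lambda>s. (inv (snd (\<gamma> s)) (velocity A \<sigma> s), frame_tensor F (\<gamma> s))) has_vector_derivative (0, ?f')) (at t)"
      using has_vector_derivative_Pair[OF _ frame_tensor_along[OF \<gamma> t]] by (simp add: \<gamma>_def)
    then have "((\<lambda>s. frame_form A D (\<gamma> s) (velocity ?B \<gamma> s)) has_vector_derivative (0, ?f')) (at t)"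
      by (rule has_vector_derivative_transform_within_open[of _ _ _ I]) (use I t form in \<open>auto simp: open_interval_def\<close>)
    then show "((\<lambda>s. frame_form A D (\<gamma> s) (velocity ?B \<gamma> s)) has_vector_derivative
        frame_correction A F (\<gamma> t) (velocity ?B \<gamma> t) (frame_form A D (\<gamma> t) (velocity ?B \<gamma> t))) (at t)"
      using frame_tensor_nonzero[OF A F curve_mem_frame_bundle[OF A \<gamma> t] bspec[OF F_nz curve_in_frame_bundle(1)[OF A \<gamma> t]]] by (simp add: form[OF t] frame_correction_def)
  qed
  then show thesis by (rule that) (use u(1) form in \<open>simp_all add: \<gamma>_def\<close>)
qed

text \<open>The difference \<open>w - f\<close> solves a homogeneous linear equation, and it vanishes at \<open>t0\<close>.\<close>

lemma geodesic_connection_form: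
  assumes \<gamma>: "geodesic (frame_atlas A) P.conn I \<gamma>" and t0: "t0 \<in> I"
    and init: "connection_form A D (\<gamma> t0) (velocity (frame_atlas A) \<gamma> t0) = frame_tensor F (\<gamma> t0)" and t: "t \<in> I"
  shows "connection_form A D (\<gamma> t) (velocity (frame_atlas A) \<gamma> t) = frame_tensor F (\<gamma> t)"
proof -
  let ?B = "frame_atlas A"
  note B = smooth_atlas_frame_atlas[OF A]
  have I: "open_interval I" and sm: "smooth_curve ?B I \<gamma>" using \<gamma> by (simp_all add: geodesic_def)
  define f where "f = (\<lambda>s. frame_tensor F (\<gamma> s))"
  define f' where "f' = (\<lambda>s. deriv_along ?B (\<gamma> s) (velocity ?B \<gamma> s) (frame_tensor F))"
  define w where "w = (\<lambda>s. connection_form A D (\<gamma> s) (velocity ?B \<gamma> s))"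
  have f: "(f has_vector_derivative f' s) (at s)" if "s \<in> I" for s
    unfolding f_def f'_def by (rule frame_tensor_along[OF sm that])
  have nz: "f s \<noteq> 0" if "s \<in> I" for s
    unfolding f_def by (rule frame_tensor_nonzero[OF A F curve_mem_frame_bundle[OF A sm that] bspec[OF F_nz curve_in_frame_bundle(1)[OF A sm that]]])
  have w: "(w has_vector_derivative ((w s \<bullet> f s) / (f s \<bullet> f s)) *\<^sub>R f' s) (at s)" if "s \<in> I" for s
    using bounded_linear.has_vector_derivative[OF bounded_linear_snd bspec[OF iffD1[OF P.geodesic_iff[OF I sm] \<gamma>] that]]
    by (simp add: frame_form_def frame_correction_def w_def f_def f'_def)
  have d: "((\<lambda>s. w s - f s) has_vector_derivative (((w s - f s) \<bullet> f s) / (f s \<bullet> f s)) *\<^sub>R f' s) (at s)" if "s \<in> I" for s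
    using has_vector_derivative_diff[OF w[OF that] f[OF that]] nz[OF that]
    by (simp add: inner_diff_left diff_divide_distrib scaleR_left_diff_distrib)
  have "isCont f' s" if s: "s \<in> I" for s
  proof -
    obtain C where C: "C \<in> ?B" "\<gamma> s \<in> fst C" using curve_mem_frame_bundle[OF A sm s] by (auto simp flip: carrier_frame_atlas simp: carrier_def)
    let ?J = "{r \<in> I. \<gamma> r \<in> fst C}"
    have oJ: "open ?J" "s \<in> ?J" using curve_chart(1)[OF B sm C(1)] s C by auto
    have "smooth_on ?J f" unfolding f_def
      by (rule smooth_on_curve_compose[OF B sm C(1) smooth_frame_tensor[OF A F]]) (use C in \<open>auto simp: carrier_def\<close>)
    from smooth_on_vector_derivative[OF oJ(1) this]
    have "smooth_on ?J f'"
      using smooth_on_cong[OF oJ(1), of f' "\<lambda>r. vector_derivative f (at r)"] vector_derivative_at[OF f] by simp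
    then show ?thesis using smooth_on_continuous_on continuous_on_eq_continuous_at oJ by blast
  qed
  moreover have "isCont f s" if "s \<in> I" for s using has_vector_derivative_continuous[OF f[OF that]] .
  ultimately have k: "continuous_on I (\<lambda>s. norm (f' s) / norm (f s))"
    using nz by (intro continuous_at_imp_continuous_on) (auto intro!: continuous_intros)
  have "w t - f t = 0"
  proof (rule linear_ode_zero_unique[OF _ t0 _ t d k])
    show "is_interval I" using I by (simp add: open_interval_def)
    show "w t0 - f t0 = 0" using init by (simp add: w_def f_def)
    fix s assume s: "s \<in> I"
    have "\<bar>(w s - f s) \<bullet> f s\<bar> / (norm (f s))\<^sup>2 \<le> (norm (w s - f s) * norm (f s)) / (norm (f s))\<^sup>2"
      by (rule divide_right_mono[OF Cauchy_Schwarz_ineq2]) simp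
    also have "\<dots> = norm (w s - f s) / norm (f s)" using nz[OF s] by (simp add: power2_eq_square)
    finally have "\<bar>(w s - f s) \<bullet> f s\<bar> / (norm (f s))\<^sup>2 * norm (f' s) \<le> norm (w s - f s) / norm (f s) * norm (f' s)"
      by (rule mult_right_mono) simp
    then show "norm ((((w s - f s) \<bullet> f s) / (f s \<bullet> f s)) *\<^sub>R f' s) \<le> norm (f' s) / norm (f s) * norm (w s - f s)"
      by (simp add: power2_norm_eq_inner mult.commute)
  qed
  then show ?thesis by (simp add: w_def f_def)
qed

text \<open>As \<open>\<theta>\<close> is constant along the geodesic, the velocity of the projection is \<open>u \<xi>\<close> for a fixed \<open>\<xi>\<close>, and its
  covariant derivative is \<open>u \<omega> \<xi> = u f \<xi> = F u \<xi>\<close>.\<close>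

lemma geodesic_projects_to_forced_solution:
  assumes \<gamma>: "geodesic (frame_atlas A) P.conn I \<gamma>" and t0: "t0 \<in> I"
    and init: "connection_form A D (\<gamma> t0) (velocity (frame_atlas A) \<gamma> t0) = frame_tensor F (\<gamma> t0)"
  shows "forced_solution A D F I (\<lambda>t. fst (\<gamma> t))"
  unfolding forced_solution_def
proof (intro conjI ballI)
  let ?B = "frame_atlas A" and ?\<sigma> = "\<lambda>t. fst (\<gamma> t)"
  have I: "open_interval I" and sm: "smooth_curve ?B I \<gamma>" using \<gamma> by (simp_all add: geodesic_def)
  show "open_interval I" by (rule I)
  show "smooth_curve A I ?\<sigma>" by (rule smooth_curve_proj[OF A sm])
  have conv: "open I" "convex I" using I by (simp_all add: open_interval_def is_interval_convex)
  define th where "th = (\<lambda>s. inv (snd (\<gamma> s)) (velocity A ?\<sigma> s))"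
  have fr: "snd (\<gamma> s) \<in> frames A (fst (\<gamma> s))" if "s \<in> I" for s using curve_in_frame_bundle(2)[OF A sm that] .
  have zero: "(th has_vector_derivative 0) (at s within I)" if s: "s \<in> I" for s
  proof -
    have d: "((\<lambda>s. fst (frame_form A D (\<gamma> s) (velocity ?B \<gamma> s))) has_vector_derivative 0) (at s)"
      using bounded_linear.has_vector_derivative[OF bounded_linear_fst bspec[OF iffD1[OF P.geodesic_iff[OF I sm] \<gamma>] s]]
      by (simp add: frame_correction_def)
    show ?thesis
      by (rule has_vector_derivative_at_within, rule has_vector_derivative_transform_within_open[OF d conv(1) s])
        (simp add: frame_form_def th_def velocity_eq_proj_push[OF A D sm])
  qed
  obtain \<xi> where \<xi>: "\<And>s. s \<in> I \<Longrightarrow> th s = \<xi>"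
    using has_vector_derivative_zero_constant[OF conv(2) zero] by blast
  have vel: "velocity A ?\<sigma> s = snd (\<gamma> s) \<xi>" if s: "s \<in> I" for s
    using frame_inv_right[OF fr[OF s] velocity_tangent[OF A smooth_curve_proj[OF A sm] s]] \<xi>[OF s] by (simp add: th_def)
  fix t assume t: "t \<in> I"
  have "has_covd_along A D ?\<sigma> (\<lambda>s. snd (\<gamma> s) \<xi>) t (snd (\<gamma> t) (frame_tensor F (\<gamma> t) *v \<xi>))"
    using covd_frame_along[OF A D sm t, of \<xi>] geodesic_connection_form[OF \<gamma> t0 init t] by simp
  then have "has_covd_along A D ?\<sigma> (\<lambda>s. snd (\<gamma> s) \<xi>) t (F (fst (\<gamma> t)) (velocity A ?\<sigma> t))"
    using frame_tensor_apply[OF A F curve_mem_frame_bundle[OF A sm t]] vel[OF t] by simp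
  then show "has_covd_along A D ?\<sigma> (velocity A ?\<sigma>) t (F (fst (\<gamma> t)) (velocity A ?\<sigma> t))"
    by (rule has_covd_along_cong[OF conv(1) t, rotated]) (simp add: vel)
qed

end

end

theorem theorem1:
  fixes A :: "('m, real^'n) atlas"
    and D :: "('m, real^'n) covd"
    and F :: "'m \<Rightarrow> ('m, real^'n) tvec \<Rightarrow> ('m, real^'n) tvec"
  assumes "smooth_manifold A"
    and "linear_connection A D"
    and "tensor_field_11 A F"
    and "\<And>p. p \<in> carrier A \<Longrightarrow> \<exists>v\<in>tangent_space A p. F p v \<noteq> (\<lambda>_. 0)"
  shows "\<exists>N. linear_connection (frame_atlas A) N \<and> is_lift A D N \<and>
    (\<forall>u\<in>frame_bundle A. \<forall>X\<in>tangent_space (frame_atlas A) u.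
       (\<forall>v\<in>tangent_space A (fst u). vertical_projection A D u X v = F (fst u) v) \<longrightarrow>
       (\<forall>I \<gamma>. 0 \<in> I \<longrightarrow> geodesic (frame_atlas A) N I \<gamma> \<longrightarrow>
          \<gamma> 0 = u \<longrightarrow> velocity (frame_atlas A) \<gamma> 0 = X \<longrightarrow>
          forced_solution A D F I (fst \<circ> \<gamma>) \<and>
          velocity A (fst \<circ> \<gamma>) 0 = proj_push A u X) \<and>
       (\<forall>I \<sigma>. 0 \<in> I \<longrightarrow> forced_solution A D F I \<sigma> \<longrightarrow>
          \<sigma> 0 = fst u \<longrightarrow> velocity A \<sigma> 0 = proj_push A u X \<longrightarrow>
          (\<exists>\<gamma>. geodesic (frame_atlas A) N I \<gamma> \<and> \<gamma> 0 = u \<and>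
               velocity (frame_atlas A) \<gamma> 0 = X \<and> (\<forall>t\<in>I. \<sigma> t = fst (\<gamma> t))))) \<and>
    (\<forall>I \<sigma>. forced_solution A D F I \<sigma> \<longrightarrow>
       (\<exists>\<gamma>. geodesic (frame_atlas A) N I \<gamma> \<and> (\<forall>t\<in>I. \<sigma> t = fst (\<gamma> t))))"
proof -
  have A: "smooth_atlas A" using assms(1) by (simp add: smooth_manifold_def)
  note D = assms(2) and F = assms(3)
  have F_nz: "\<forall>p\<in>carrier A. \<exists>v\<in>tangent_space A p. F p v \<noteq> (\<lambda>_. 0)" using assms(4) by blast
  note ctx = A D F F_nz
  interpret P: parallelization "frame_atlas A" "frame_form A D" "frame_vector A D" "frame_correction A F"
    by (rule parallelization_frame_bundle[OF ctx])
  show ?thesis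
  proof (intro exI[of _ P.conn] conjI ballI allI impI)
    show "linear_connection (frame_atlas A) P.conn" by (rule P.linear_connection_conn)
    show "is_lift A D P.conn" by (rule is_lift_conn[OF A D F F_nz])
  next
    fix u X I \<gamma>
    assume u: "u \<in> frame_bundle A" and X: "X \<in> tangent_space (frame_atlas A) u"
      and nu: "\<forall>v\<in>tangent_space A (fst u). vertical_projection A D u X v = F (fst u) v"
    have fr: "snd u \<in> frames A (fst u)" using u by (simp add: frame_bundle_iff[OF A])
    have om: "connection_form A D u X = frame_tensor F u"
      unfolding eq_frame_tensor_iff[OF A F u]
    proof
      fix y show "snd u (connection_form A D u X *v y) = F (fst u) (snd u y)"
        using bspec[OF nu frame_tangent[OF fr, of y]] by (simp add: vertical_projection_def frame_inv_left[OF fr])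
    qed
    show "forced_solution A D F I (fst \<circ> \<gamma>)" "velocity A (fst \<circ> \<gamma>) 0 = proj_push A u X"
      if \<gamma>: "0 \<in> I" "geodesic (frame_atlas A) P.conn I \<gamma>" "\<gamma> 0 = u" "velocity (frame_atlas A) \<gamma> 0 = X"
      using geodesic_projects_to_forced_solution[OF ctx \<gamma>(2,1)] velocity_eq_proj_push[OF A D _ \<gamma>(1), of \<gamma>] \<gamma> om
      by (simp_all add: comp_def geodesic_def)
    fix \<sigma>
    show "\<exists>\<gamma>. geodesic (frame_atlas A) P.conn I \<gamma> \<and> \<gamma> 0 = u \<and> velocity (frame_atlas A) \<gamma> 0 = X \<and> (\<forall>t\<in>I. \<sigma> t = fst (\<gamma> t))"
      if \<sigma>: "0 \<in> I" "forced_solution A D F I \<sigma>" "\<sigma> 0 = fst u" "velocity A \<sigma> 0 = proj_push A u X"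
    proof -
      have "snd u \<in> frames A (\<sigma> 0)" using fr \<sigma> by simp
      from forced_solution_lifts_to_geodesic[OF ctx \<sigma>(2,1) this] obtain \<gamma> where
        \<gamma>: "geodesic (frame_atlas A) P.conn I \<gamma>" "\<gamma> 0 = (\<sigma> 0, snd u)" "\<And>t. fst (\<gamma> t) = \<sigma> t"
          "\<And>t. t \<in> I \<Longrightarrow> frame_form A D (\<gamma> t) (velocity (frame_atlas A) \<gamma> t)
            = (inv (snd (\<gamma> t)) (velocity A \<sigma> t), frame_tensor F (\<gamma> t))" by blast
      have 0: "\<gamma> 0 = u" using \<gamma>(2) \<sigma>(3) by simp
      have "frame_form A D u (velocity (frame_atlas A) \<gamma> 0) = frame_form A D u X"
        using \<gamma>(4)[OF \<sigma>(1)] by (simp add: 0 \<sigma>(4) frame_form_def[of A D u X] om)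
      moreover have "velocity (frame_atlas A) \<gamma> 0 \<in> tangent_space (frame_atlas A) u"
        using velocity_tangent[OF smooth_atlas_frame_atlas[OF A] _ \<sigma>(1), of \<gamma>] \<gamma>(1) 0 by (simp add: geodesic_def)
      ultimately have "velocity (frame_atlas A) \<gamma> 0 = X" using frame_form_inj[OF A D u] X by blast
      then show ?thesis using \<gamma>(1,3) 0 by auto
    qed
  next
    fix I \<sigma> assume \<sigma>: "forced_solution A D F I \<sigma>"
    show "\<exists>\<gamma>. geodesic (frame_atlas A) P.conn I \<gamma> \<and> (\<forall>t\<in>I. \<sigma> t = fst (\<gamma> t))"
    proof (cases "I = {}")
      case True
      then show ?thesis using \<sigma> smooth_curve_empty by (auto simp: geodesic_def forced_solution_def)
    next
      case False
      then obtain t0 where t0: "t0 \<in> I" by blast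
      then have "\<sigma> t0 \<in> carrier A" using \<sigma> by (auto simp: forced_solution_def smooth_curve_def)
      then obtain u0 where "u0 \<in> frames A (\<sigma> t0)" by (rule frames_nonempty[OF A])
      from forced_solution_lifts_to_geodesic[OF ctx \<sigma> t0 this] show ?thesis by metis
    qed
  qed
qed

end
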